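(* Let $G$ be a graph of finite maximum degree whose cycle space is generated by cycles of bounded length. If $G$ has a thick end, then the half-grid is an asymptotic minor of $G$.
   Context: $\mathbb{N}=\{0,1,2,\dots\}$. A ray is a one-way infinite path. An end of $G$ is an equivalence class of rays of $G$, where two rays are equivalent if $G$ contains infinitely many pairwise disjoint paths between them. An end is thick if it contains infinitely many pairwise disjoint rays (equivalently, for every $n\in\mathbb{N}$, $n$ pairwise disjoint rays). The cycle space of $G$ is the subspace of the $\mathbb{F}_2$-vector space of subsets of $E(G)$ (with symmetric difference as addition) spanned by the edge sets of the (finite) cycles of $G$. It is generated by cycles of bounded length if there is $n\in\mathbb{N}$ such that the cycles of length at most $n$ generate it. The half-grid is the graph on $\mathbb{N}\times\mathbb{Z}$ in which $(m,n)$ and $(m',n')$ are adjacent iff $|m-m'|+|n-n'|=1$. For sets of vertices (or subgraphs) $U,U'$ of $G$, $d_G(U,U')$ is the minimum distance in $G$ between an element of $U$ and an element of $U'$. An $A$--$B$ path is a path that meets $A$ precisely in its first vertex and $B$ precisely in its last vertex. A model $(\mathcal{V},\mathcal{E})$ of a graph $X$ in $G$ consists of a collection $\mathcal V$ of disjoint sets $V_x\subseteq V(G)$ for $x\in V(X)$ with each $G[V_x]$ connected (branch sets), and a collection $\mathcal E$ of pairwise internally disjoint $V_{x_0}$--$V_{x_1}$ paths $E_e$ for edges $e=x_0x_1$ of $X$ (branch paths) such that $E_e$ is disjoint from every $V_x$ with $x\neq x_0,x_1$. The model is $K$-fat, for $K\in\mathbb{N}$, if $d_G(Y,Z)\ge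 K$ for every two distinct $Y,Z\in\mathcal V\cup\mathcal E$, unless one of them is $E_e$ and the other is $V_x$ for a vertex $x$ incident with $e$. The graph $X$ is a $K$-fat minor of $G$ if $G$ contains a $K$-fat model of $X$, and $X$ is an asymptotic minor of $G$ if it is a $K$-fat minor of $G$ for every $K\in\mathbb{N}$. *)

theory Defs
  imports Main "HOL-Library.Extended_Nat"
begin

record 'a ugraph =
  vertices :: "'a set"
  edges :: "'a set set"

definition simple_graph :: "'a ugraph \<Rightarrow> bool" where
  "simple_graph G \<longleftrightarrow> (\<forall>e\<in>edges G. e \<subseteq> vertices G \<and> card e = 2)"

definition neighbours :: "'a ugraph \<Rightarrow> 'a \<Rightarrow> 'a set" where
  "neighbours G v = {w. {v, w} \<in> edges G}"

definition finite_max_degree :: "'a ugraph \<Rightarrow> bool" where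
  "finite_max_degree G \<longleftrightarrow>
     (\<exists>d. \<forall>v\<in>vertices G. finite (neighbours G v) \<and> card (neighbours G v) \<le> d)"

definition induced_subgraph :: "'a ugraph \<Rightarrow> 'a set \<Rightarrow> 'a ugraph" where
  "induced_subgraph G U = \<lparr>vertices = vertices G \<inter> U, edges = {e \<in> edges G. e \<subseteq> U}\<rparr>"

text \<open>A finite path is represented by the list of its vertices in order; a single vertex is a
  (trivial) path, the empty list is not.\<close>

definition graph_path :: "'a ugraph \<Rightarrow> 'a list \<Rightarrow> bool" where
  "graph_path G p \<longleftrightarrow> p \<noteq> [] \<and> distinct p \<and> set p \<subseteq> vertices G \<and>
     (\<forall>i. Suc i < length p \<longrightarrow> {p ! i, p ! Suc i} \<in> edges G)"

definition graph_connected :: "'a ugraph \<Rightarrow> bool" where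
  "graph_connected G \<longleftrightarrow> vertices G \<noteq> {} \<and>
     (\<forall>u\<in>vertices G. \<forall>v\<in>vertices G. \<exists>p. graph_path G p \<and> hd p = u \<and> last p = v)"

definition path_between :: "'a ugraph \<Rightarrow> 'a set \<Rightarrow> 'a set \<Rightarrow> 'a list \<Rightarrow> bool" where
  "path_between G A B p \<longleftrightarrow> graph_path G p \<and> set p \<inter> A = {hd p} \<and> set p \<inter> B = {last p}"

definition inner_vertices :: "'a list \<Rightarrow> 'a set" where
  "inner_vertices p = set (butlast (tl p))"

definition internally_disjoint :: "'a list \<Rightarrow> 'a list \<Rightarrow> bool" where
  "internally_disjoint p q \<longleftrightarrow> inner_vertices p \<inter> set q = {} \<and> set p \<inter> inner_vertices q = {}"

text \<open>Distances are extended naturals: the infimum over the empty set is \<open>\<infinity>\<close>, so vertices in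
  different components (and the empty set and anything) are at infinite distance.\<close>

definition graph_dist :: "'a ugraph \<Rightarrow> 'a \<Rightarrow> 'a \<Rightarrow> enat" where
  "graph_dist G u v = (INF p \<in> {p. graph_path G p \<and> hd p = u \<and> last p = v}. enat (length p - 1))"

definition set_dist :: "'a ugraph \<Rightarrow> 'a set \<Rightarrow> 'a set \<Rightarrow> enat" where
  "set_dist G U W = (INF u \<in> U. INF w \<in> W. graph_dist G u w)"

text \<open>A one-way infinite path has a unique first vertex, so it is the same as an injective
  enumeration of its vertices.\<close>

definition is_ray :: "'a ugraph \<Rightarrow> (nat \<Rightarrow> 'a) \<Rightarrow> bool" where
  "is_ray G r \<longleftrightarrow> inj r \<and> range r \<subseteq> vertices G \<and> (\<forall>i. {r i, r (Suc i)} \<in> edges G)"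

definition equivalent_rays :: "'a ugraph \<Rightarrow> ((nat \<Rightarrow> 'a) \<times> (nat \<Rightarrow> 'a)) set" where
  "equivalent_rays G = {(r, s). is_ray G r \<and> is_ray G s \<and>
     (\<exists>P. infinite P \<and> (\<forall>p\<in>P. path_between G (range r) (range s) p) \<and>
          (\<forall>p\<in>P. \<forall>q\<in>P. p \<noteq> q \<longrightarrow> set p \<inter> set q = {}))}"

definition graph_ends :: "'a ugraph \<Rightarrow> (nat \<Rightarrow> 'a) set set" where
  "graph_ends G = {r. is_ray G r} // equivalent_rays G"

definition thick_end :: "(nat \<Rightarrow> 'a) set \<Rightarrow> bool" where
  "thick_end \<omega> \<longleftrightarrow> (\<exists>R\<subseteq>\<omega>. infinite R \<and> (\<forall>r\<in>R. \<forall>s\<in>R. r \<noteq> s \<longrightarrow> range r \<inter> range s = {}))"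

definition graph_cycle :: "'a ugraph \<Rightarrow> 'a list \<Rightarrow> bool" where
  "graph_cycle G c \<longleftrightarrow> graph_path G c \<and> length c \<ge> 3 \<and> {last c, hd c} \<in> edges G"

definition cycle_edges :: "'a list \<Rightarrow> 'a set set" where
  "cycle_edges c = {{c ! i, c ! Suc i} |i. Suc i < length c} \<union> {{last c, hd c}}"

text \<open>Sets with symmetric difference as addition form a vector space over the field with two
  elements; closure under scalar multiplication amounts to containing the empty set.\<close>

definition F2_subspace :: "'b set set \<Rightarrow> bool" where
  "F2_subspace S \<longleftrightarrow> {} \<in> S \<and> (\<forall>A\<in>S. \<forall>B\<in>S. sym_diff A B \<in> S)"

definition F2_span :: "'b set set \<Rightarrow> 'b set set" where
  "F2_span C = F2_subspace hull C"

definition cycle_space :: "'a ugraph \<Rightarrow> 'a set set set" where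
  "cycle_space G = F2_span {cycle_edges c |c. graph_cycle G c}"

definition cycle_space_generated_by_bounded_cycles :: "'a ugraph \<Rightarrow> bool" where
  "cycle_space_generated_by_bounded_cycles G \<longleftrightarrow>
     (\<exists>n. F2_span {cycle_edges c |c. graph_cycle G c \<and> length c \<le> n} = cycle_space G)"

text \<open>The branch path of an edge \<open>{x, y}\<close> is stored as a vertex list in one of its two
  directions; the choice of direction is irrelevant.\<close>

definition minor_model ::
  "'x ugraph \<Rightarrow> 'a ugraph \<Rightarrow> ('x \<Rightarrow> 'a set) \<Rightarrow> ('x set \<Rightarrow> 'a list) \<Rightarrow> bool" where
  "minor_model X G V E \<longleftrightarrow>
     (\<forall>x\<in>vertices X. V x \<subseteq> vertices G \<and> graph_connected (induced_subgraph G (V x))) \<and>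
     (\<forall>x\<in>vertices X. \<forall>y\<in>vertices X. x \<noteq> y \<longrightarrow> V x \<inter> V y = {}) \<and>
     (\<forall>e\<in>edges X. \<exists>x y. e = {x, y} \<and> path_between G (V x) (V y) (E e)) \<and>
     (\<forall>e\<in>edges X. \<forall>f\<in>edges X. e \<noteq> f \<longrightarrow> internally_disjoint (E e) (E f)) \<and>
     (\<forall>e\<in>edges X. \<forall>x\<in>vertices X. x \<notin> e \<longrightarrow> set (E e) \<inter> V x = {})"

definition fat_model ::
  "nat \<Rightarrow> 'x ugraph \<Rightarrow> 'a ugraph \<Rightarrow> ('x \<Rightarrow> 'a set) \<Rightarrow> ('x set \<Rightarrow> 'a list) \<Rightarrow> bool" where
  "fat_model K X G V E \<longleftrightarrow> minor_model X G V E \<and>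
     (\<forall>x\<in>vertices X. \<forall>y\<in>vertices X. x \<noteq> y \<longrightarrow> enat K \<le> set_dist G (V x) (V y)) \<and>
     (\<forall>e\<in>edges X. \<forall>f\<in>edges X. e \<noteq> f \<longrightarrow> enat K \<le> set_dist G (set (E e)) (set (E f))) \<and>
     (\<forall>e\<in>edges X. \<forall>x\<in>vertices X. x \<notin> e \<longrightarrow> enat K \<le> set_dist G (set (E e)) (V x))"

definition fat_minor :: "nat \<Rightarrow> 'x ugraph \<Rightarrow> 'a ugraph \<Rightarrow> bool" where
  "fat_minor K X G \<longleftrightarrow> (\<exists>V E. fat_model K X G V E)"

definition asymptotic_minor :: "'x ugraph \<Rightarrow> 'a ugraph \<Rightarrow> bool" where
  "asymptotic_minor X G \<longleftrightarrow> (\<forall>K. fat_minor K X G)"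

definition half_grid :: "(nat \<times> int) ugraph" where
  "half_grid = \<lparr>vertices = UNIV,
     edges = {{(m, n), (m', n')} |m n m' n'. \<bar>int m - int m'\<bar> + \<bar>n - n'\<bar> = 1}\<rparr>"

end

theory Submission
  imports Defs "HOL-Library.Diagonal_Subsequence"
begin

text \<open>
  Fix \<open>K\<close> and work in the component of \<open>G\<close> that contains the thick end, with a root vertex in it; the
  level of a vertex is its distance from the root.

  The hypothesis on the cycle space is used through one fact, \<open>bond_nbhd_conn\<close>: if a vertex set \<open>D\<close>
  and its complement are both connected, then the vertices outside \<open>D\<close> that have a neighbour in \<open>D\<close>
  form a coarsely connected set: a ball of bounded radius around that set induces a connected
  subgraph. In a planar picture such boundaries are curves, and they provide both the columns of the
  grid and the means to construct them.

  The first half of the proof finds a connected set \<open>P\<close> and, for every \<open>j\<close>, a component \<open>C j\<close> of what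
  remains when the ball of radius \<open>j\<close> around \<open>P\<close> is removed, such that the \<open>C j\<close> are nested and have
  infinite boundaries (\<open>diverging_components\<close>). Take a geodesic ray \<open>R\<close> in the end. The degrees
  are bounded, so a ball of given radius around a late vertex of \<open>R\<close> cannot meet all of
  sufficiently many disjoint rays of the end; going around the ball one finds a component of the
  complement of a tube around \<open>R\<close> whose boundary begins before and ends after the ball. By the bond
  lemma that boundary contains a track running alongside \<open>R\<close>, near it but not too near (\<open>track\<close>).
  Tracks exist at every scale. Arrange them in a sequence in which consecutive ones overlap and the
  scale grows slowly. Two connected sets \<open>P\<close> and \<open>Q\<close> then move outwards together, one on a track and
  one on \<open>R\<close>. When a track ends, its user hops over to the next track if the two come close;
  otherwise there is enough room for the two to exchange their roles. So \<open>P\<close> and \<open>Q\<close> diverge, and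
  \<open>C j\<close> is the component that contains a tail of \<open>Q\<close>.

  The second half builds the grid. Choose distances \<open>\<rho> 0 < \<rho> 1 < \<dots>\<close> that are far apart. The
  neighbourhood of the boundary of \<open>C (\<rho> i)\<close> is connected by the bond lemma, and its vertices have
  distance about \<open>\<rho> i\<close> from \<open>P\<close>; it serves as column \<open>i\<close>, and different columns are automatically
  far apart. A geodesic to \<open>P\<close> from a late vertex of the boundary of \<open>C (\<rho> k)\<close> crosses the columns
  \<open>k, \<dots>, 0\<close> one after the other and serves as a row. A diagonal argument thins out the rows so that
  in every column consecutive crossings can be joined far out. Thinning once more, rows and joining
  pieces live in disjoint bands of levels, which yields a fat model of the triangular grid
  \<open>i \<le> t\<close> (\<open>triangle_model\<close>). The half-grid arises from that grid by contracting finite connected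
  sets, and contraction preserves fatness (\<open>fat_sets_contract\<close>).
\<close>

section \<open>Connected sets and distances\<close>

text \<open>The graph is represented by its adjacency relation, so that walks are relation powers and
  connectivity is a reflexive transitive closure. Later \<open>V\<close> will be one component of \<open>G\<close>.\<close>
locale conn_graph =
  fixes V :: "'a set" and r :: "('a \<times> 'a) set"
  assumes r_sub: "r \<subseteq> V \<times> V"
    and r_sym: "(x, y) \<in> r \<Longrightarrow> (y, x) \<in> r"
    and r_conn: "x \<in> V \<Longrightarrow> y \<in> V \<Longrightarrow> (x, y) \<in> r\<^sup>*"
    and r_fin: "finite (r `` {x})"
begin

abbreviation linked :: "'a set \<Rightarrow> ('a \<times> 'a) set" where
  "linked A \<equiv> (r \<inter> A \<times> A)\<^sup>*"

definition conn :: "'a set \<Rightarrow> bool" where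
  "conn S \<longleftrightarrow> S \<subseteq> V \<and> (\<forall>x\<in>S. \<forall>y\<in>S. (x, y) \<in> linked S)"

definition component :: "'a set \<Rightarrow> 'a \<Rightarrow> 'a set" where
  "component A x = {y. (x, y) \<in> linked A}"

definition boundary :: "'a set \<Rightarrow> 'a set" where
  "boundary D = {y. y \<notin> D \<and> (\<exists>x\<in>D. (x, y) \<in> r)}"

lemma linked_sym: "(x, y) \<in> linked A \<Longrightarrow> (y, x) \<in> linked A"
proof -
  have "sym (r \<inter> A \<times> A)" by (auto simp: sym_def r_sym)
  then have "sym (linked A)" by (rule sym_rtrancl)
  then show "(x, y) \<in> linked A \<Longrightarrow> (y, x) \<in> linked A" by (auto simp: sym_def)
qed

lemma linked_trans: "(x, y) \<in> linked A \<Longrightarrow> (y, z) \<in> linked A \<Longrightarrow> (x, z) \<in> linked A"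
  by (rule rtrancl_trans)

lemma linked_mono: "(x, y) \<in> linked A \<Longrightarrow> A \<subseteq> B \<Longrightarrow> (x, y) \<in> linked B"
  by (rule rtrancl_mono[THEN subsetD, of "r \<inter> A \<times> A"]) auto

lemma linked_in: "(x, y) \<in> linked A \<Longrightarrow> x \<in> A \<Longrightarrow> y \<in> A"
  by (induction rule: rtrancl_induct) auto

lemma linked_edge: "(x, y) \<in> r \<Longrightarrow> x \<in> A \<Longrightarrow> y \<in> A \<Longrightarrow> (x, y) \<in> linked A"
  by auto

lemma conn_sub: "conn S \<Longrightarrow> S \<subseteq> V"
  by (simp add: conn_def)

lemma conn_linked: "conn S \<Longrightarrow> x \<in> S \<Longrightarrow> y \<in> S \<Longrightarrow> S \<subseteq> A \<Longrightarrow> (x, y) \<in> linked A"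
  unfolding conn_def using linked_mono by blast

lemma connI:
  assumes "S \<subseteq> V" "\<And>y. y \<in> S \<Longrightarrow> (c, y) \<in> linked S"
  shows "conn S"
  unfolding conn_def using assms linked_sym linked_trans by blast

lemma conn_singleton: "x \<in> V \<Longrightarrow> conn {x}"
  by (rule connI[where c=x]) auto

lemma conn_Un:
  assumes "conn A" "conn B" "A \<inter> B \<noteq> {}"
  shows "conn (A \<union> B)"
proof -
  obtain c where c: "c \<in> A" "c \<in> B" using assms by auto
  show ?thesis
  proof (rule connI[where c=c])
    show "A \<union> B \<subseteq> V" using assms conn_sub by auto
    fix y assume "y \<in> A \<union> B"
    then show "(c, y) \<in> linked (A \<union> B)"
      using conn_linked[OF assms(1) c(1)] conn_linked[OF assms(2) c(2)] by blast
  qed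
qed

lemma conn_Union_point:
  assumes "\<And>i. i \<in> I \<Longrightarrow> conn (A i)" "\<And>i. i \<in> I \<Longrightarrow> c \<in> A i"
  shows "conn (\<Union>i\<in>I. A i)"
proof (rule connI[where c=c])
  show "(\<Union>i\<in>I. A i) \<subseteq> V" using assms conn_sub by blast
  fix y assume "y \<in> (\<Union>i\<in>I. A i)"
  then obtain i where i: "i \<in> I" "y \<in> A i" by auto
  show "(c, y) \<in> linked (\<Union>i\<in>I. A i)"
    by (rule conn_linked[OF assms(1)[OF i(1)]]) (use i assms in auto)
qed

lemma conn_Un_family:
  assumes "conn C" "\<And>i. i \<in> I \<Longrightarrow> conn (A i)" "\<And>i. i \<in> I \<Longrightarrow> A i \<inter> C \<noteq> {}"
  shows "conn (C \<union> (\<Union>i\<in>I. A i))"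
proof (cases "C = {} \<or> I = {}")
  case True
  then have "I = {}" using assms(3) by auto
  then show ?thesis using assms(1) by simp
next
  case False
  then obtain c where c: "c \<in> C" by auto
  have "conn (\<Union>i\<in>I. C \<union> A i)"
  proof (rule conn_Union_point[where c=c])
    fix i assume i: "i \<in> I"
    show "conn (C \<union> A i)" by (rule conn_Un) (use assms i in auto)
    show "c \<in> C \<union> A i" using c by simp
  qed
  moreover have "(\<Union>i\<in>I. C \<union> A i) = C \<union> (\<Union>i\<in>I. A i)" using False by auto
  ultimately show ?thesis by simp
qed

lemma conn_chain:
  fixes A :: "nat \<Rightarrow> 'a set"
  assumes "\<And>i. i \<ge> n \<Longrightarrow> conn (A i)" "\<And>i. i \<ge> n \<Longrightarrow> A i \<inter> A (Suc i) \<noteq> {}"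
  shows "conn (\<Union>i\<in>{n..}. A i)"
proof -
  have fin: "conn (\<Union>i\<in>{n..n+k}. A i)" for k
  proof (induction k)
    case 0
    then show ?case using assms(1)[of n] by simp
  next
    case (Suc k)
    have eq: "(\<Union>i\<in>{n..n+Suc k}. A i) = (\<Union>i\<in>{n..n+k}. A i) \<union> A (Suc (n+k))"
      by (auto simp: atLeastAtMostSuc_conv)
    show ?case unfolding eq
      proof (rule conn_Un[OF Suc assms(1)])
        have "A (n + k) \<subseteq> (\<Union>i\<in>{n..n+k}. A i)" by (rule UN_upper) simp
        then show "(\<Union>i\<in>{n..n+k}. A i) \<inter> A (Suc (n + k)) \<noteq> {}"
          using assms(2)[of "n+k"] by auto
      qed simp
  qed
  obtain c where c: "c \<in> A n" using assms(2)[of n] by auto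
  have "conn (\<Union>k\<in>UNIV. (\<Union>i\<in>{n..n+k}. A i))"
    by (rule conn_Union_point[where c=c]) (use fin c in auto)
  moreover have "(\<Union>k\<in>UNIV. (\<Union>i\<in>{n..n+k}. A i)) = (\<Union>i\<in>{n..}. A i)"
  proof -
    have "x \<in> (\<Union>k\<in>UNIV. (\<Union>i\<in>{n..n+k}. A i))" if "i \<ge> n" "x \<in> A i" for x i
      using that by (intro UN_I[of "i - n"] UN_I[of i]) auto
    then show ?thesis by auto
  qed
  ultimately show ?thesis by simp
qed

lemma conn_ray:
  assumes "\<And>n. (p n, p (Suc n)) \<in> r"
  shows "conn (p ` {m..})"
proof -
  have "conn {p n, p (Suc n)}" for n
    by (rule connI[where c="p n"]) (use assms[of n] r_sub linked_edge in auto)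
  then have "conn (\<Union>n\<in>{m..}. {p n, p (Suc n)})" by (intro conn_chain) auto
  moreover have "(\<Union>n\<in>{m..}. {p n, p (Suc n)}) = p ` {m..}" by auto
  ultimately show ?thesis by simp
qed

lemma conn_walk:
  assumes "m \<le> n" "p m \<in> V" "\<And>j. m \<le> j \<Longrightarrow> j < n \<Longrightarrow> (p j, p (Suc j)) \<in> r"
  shows "conn (p ` {m..n})"
  using assms(1,3)
proof (induction n rule: dec_induct)
  case base
  then show ?case using conn_singleton[OF assms(2)] by simp
next
  case (step n)
  have "conn {p n, p (Suc n)}"
    by (rule connI[where c="p n"]) (use step(4)[of n] step(1) r_sub linked_edge in auto)
  moreover have "conn (p ` {m..n})" using step by auto
  ultimately have "conn (p ` {m..n} \<union> {p n, p (Suc n)})"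
    by (intro conn_Un) (use step(1) in auto)
  moreover have "p ` {m..n} \<union> {p n, p (Suc n)} = p ` {m..Suc n}"
    using step(1) by (auto simp: atLeastAtMostSuc_conv)
  ultimately show ?case by simp
qed

lemma conn_ray_segment: "(\<And>n. (p n, p (Suc n)) \<in> r) \<Longrightarrow> conn (p ` {m..n})"
  using conn_walk[of m n p] r_sub by (cases "m \<le> n") (auto simp: conn_def)

lemma linked_crossing:
  assumes "(x, y) \<in> linked S" "x \<in> A" "y \<notin> A"
  shows "\<exists>u v. (u, v) \<in> r \<and> u \<in> S \<inter> A \<and> v \<in> S - A \<and> (x, u) \<in> linked (S \<inter> A)"
proof (rule ccontr)
  assume neg: "\<not> ?thesis"
  have "y \<in> A \<and> (x, y) \<in> linked (S \<inter> A)"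
    using assms(1)
  proof (induction rule: rtrancl_induct)
    case base then show ?case using assms(2) by simp
  next
    case (step y z)
    then have "z \<in> A" using neg by blast
    moreover have "(y, z) \<in> linked (S \<inter> A)" using step \<open>z \<in> A\<close> by auto
    ultimately show ?case using step.IH by (meson rtrancl_trans)
  qed
  then show False using assms(3) by simp
qed

lemma conn_crossing:
  assumes "conn S" "x \<in> S \<inter> A" "y \<in> S - A"
  shows "\<exists>u v. (u, v) \<in> r \<and> u \<in> S \<inter> A \<and> v \<in> S - A"
  using linked_crossing[of x y S A] conn_linked[OF assms(1), of x y S] assms by auto

lemma component_sub: "x \<in> A \<Longrightarrow> component A x \<subseteq> A"
  using linked_in by (auto simp: component_def)

lemma component_self: "x \<in> component A x"
  by (simp add: component_def)

lemma component_conn: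
  assumes "A \<subseteq> V" "x \<in> A" shows "conn (component A x)"
proof (rule connI[where c=x])
  show "component A x \<subseteq> V" using component_sub assms by blast
  fix y assume "y \<in> component A x"
  then have "(x, y) \<in> linked A" by (simp add: component_def)
  then show "(x, y) \<in> linked (component A x)"
  proof (induction rule: rtrancl_induct)
    case (step y z)
    then have "(x, z) \<in> linked A" by (meson rtrancl.rtrancl_into_rtrancl)
    then have "(y, z) \<in> r \<inter> component A x \<times> component A x" using step by (auto simp: component_def)
    then show ?case using step.IH by (meson rtrancl.rtrancl_into_rtrancl)
  qed simp
qed

lemma component_max:
  assumes "conn S" "S \<subseteq> A" "s \<in> S" "s \<in> component A x"
  shows "S \<subseteq> component A x"
proof
  fix y assume "y \<in> S"
  then have "(s, y) \<in> linked A" using conn_linked assms by blast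
  then show "y \<in> component A x" using assms(4) by (auto simp: component_def intro: linked_trans)
qed

lemma component_step:
  assumes "u \<in> component A x" "x \<in> A" "(u, v) \<in> r" "v \<in> A"
  shows "v \<in> component A x"
proof -
  have "u \<in> A" using assms component_sub by blast
  then show ?thesis using assms linked_edge by (auto simp: component_def intro: linked_trans)
qed

lemma boundary_comp_not_in:
  assumes "x \<in> A" "y \<in> boundary (component A x)" shows "y \<in> V - A"
  using assms component_step r_sub unfolding boundary_def by blast

text \<open>A walk from another component to \<open>X\<close> enters \<open>X\<close> straight from that component. So every other
  component stays attached to \<open>X\<close> when one of them is removed, and a component together with
  its complement satisfies the hypotheses of the bond lemma.\<close>
lemma conn_compl_component:
  assumes X: "conn X" "X \<noteq> {}" and x: "x \<in> V - X"
  shows "conn (V - component (V - X) x)"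
proof -
  let ?D = "component (V - X) x"
  obtain c where c: "c \<in> X" using X by auto
  have Xsub: "X \<subseteq> V - ?D" using X(1) conn_sub component_sub[OF x] by auto
  show ?thesis
  proof (rule connI[where c=c])
    fix y assume y: "y \<in> V - ?D"
    show "(c, y) \<in> linked (V - ?D)"
    proof (cases "y \<in> X")
      case True
      then show ?thesis using conn_linked[OF X(1) c] Xsub by blast
    next
      case False
      have cV: "c \<in> V" using c X(1) conn_sub by auto
      have "(y, c) \<in> linked V"
        using r_conn[of y c] y cV r_sub by (simp add: inf.absorb1)
      from linked_crossing[OF this, of "V - X"] False y c
      obtain u v where "(u, v) \<in> r" "u \<in> V \<inter> (V - X)" "v \<in> V - (V - X)"
        "(y, u) \<in> linked (V \<inter> (V - X))" by blast
      moreover have "V \<inter> (V - X) = V - X" by auto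
      ultimately have uv: "(u, v) \<in> r" "u \<in> V - X" "v \<in> X" "(y, u) \<in> linked (V - X)" by auto
      have "(y, v) \<in> linked (V - ?D)"
      proof -
        have "component (V - X) y \<subseteq> V - ?D"
        proof
          fix w assume w: "w \<in> component (V - X) y"
          then have "w \<in> V - X" using component_sub[of y "V - X"] y False by auto
          moreover have "w \<notin> ?D"
          proof
            assume "w \<in> ?D"
            then have "(x, w) \<in> linked (V - X)" "(y, w) \<in> linked (V - X)" using w by (auto simp: component_def)
            then have "y \<in> ?D" using linked_sym linked_trans unfolding component_def by blast
            then show False using y by simp
          qed
          ultimately show "w \<in> V - ?D" by simp
        qed
        moreover have "conn (component (V - X) y)" using component_conn[of "V - X" y] y False by auto
        moreover have "u \<in> component (V - X) y" using uv by (simp add: component_def)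
        ultimately have "(y, u) \<in> linked (V - ?D)" "u \<in> V - ?D"
          using conn_linked component_self by blast+
        moreover have "v \<in> V - ?D" using uv Xsub by auto
        ultimately show ?thesis using uv linked_edge linked_trans by blast
      qed
      moreover have "(c, v) \<in> linked (V - ?D)" using conn_linked[OF X(1) c uv(3)] Xsub by blast
      ultimately show ?thesis using linked_sym linked_trans by blast
    qed
  qed simp
qed

definition d :: "'a \<Rightarrow> 'a \<Rightarrow> nat" where
  "d x y = (LEAST n. (x, y) \<in> r ^^ n)"

lemma d_le: "(x, y) \<in> r ^^ n \<Longrightarrow> d x y \<le> n"
  unfolding d_def by (rule Least_le)

lemma d_walk: "x \<in> V \<Longrightarrow> y \<in> V \<Longrightarrow> (x, y) \<in> r ^^ d x y"
  unfolding d_def using r_conn[of x y] by (meson LeastI rtrancl_imp_relpow)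

lemma d_refl[simp]: "d x x = 0"
  using d_le[of x x 0] by simp

lemma d_zero: "x \<in> V \<Longrightarrow> y \<in> V \<Longrightarrow> d x y = 0 \<Longrightarrow> x = y"
  using d_walk[of x y] by simp

lemma d_edge: "(x, y) \<in> r \<Longrightarrow> d x y \<le> 1"
  using d_le[of x y 1] by simp

lemma d_tri: "x \<in> V \<Longrightarrow> y \<in> V \<Longrightarrow> z \<in> V \<Longrightarrow> d x z \<le> d x y + d y z"
  by (rule d_le) (use d_walk in \<open>auto simp: relpow_add\<close>)

lemma relpow_sym: "(x, y) \<in> r ^^ n \<Longrightarrow> (y, x) \<in> r ^^ n"
proof (induction n arbitrary: y)
  case (Suc n)
  then obtain z where "(x, z) \<in> r ^^ n" "(z, y) \<in> r" by auto
  then show ?case using Suc.IH r_sym relpow_Suc_I2 by metis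
qed simp

lemma d_sym: "d x y = d y x"
  unfolding d_def using relpow_sym by metis

lemma d_between:
  assumes "x \<in> V" "y \<in> V" "k \<le> d x y"
  shows "\<exists>z\<in>V. d x z = k \<and> d z y = d x y - k"
proof -
  have "(x, y) \<in> r ^^ (k + (d x y - k))" using d_walk assms by simp
  then obtain z where z: "(x, z) \<in> r ^^ k" "(z, y) \<in> r ^^ (d x y - k)"
    unfolding relpow_add by auto
  have zV: "z \<in> V"
    using z(1) assms(1) r_sub by (cases k) auto
  have "d x z \<le> k" "d z y \<le> d x y - k" using z d_le by auto
  moreover have "d x y \<le> d x z + d z y" using d_tri assms zV by auto
  ultimately show ?thesis using zV assms(3) by (intro bexI[of _ z]) auto
qed

text \<open>The union of all geodesics from \<open>x\<close> to \<open>y\<close>: a connected set joining \<open>x\<close> to \<open>y\<close> close to both,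
  for which no path has to be chosen.\<close>
definition geodesics :: "'a \<Rightarrow> 'a \<Rightarrow> 'a set" where
  "geodesics x y = {z \<in> V. d x z + d z y = d x y}"

lemma geodesics_ends: "x \<in> V \<Longrightarrow> y \<in> V \<Longrightarrow> x \<in> geodesics x y \<and> y \<in> geodesics x y"
  by (auto simp: geodesics_def)

lemma geodesics_conn:
  assumes x: "x \<in> V" and y: "y \<in> V"
  shows "conn (geodesics x y)"
proof (rule connI[where c=y])
  show "geodesics x y \<subseteq> V" by (auto simp: geodesics_def)
  fix z assume "z \<in> geodesics x y"
  then show "(y, z) \<in> linked (geodesics x y)"
  proof (induction "d z y" arbitrary: z)
    case 0
    then have "z = y" using d_zero y by (auto simp: geodesics_def)
    then show ?case by simp
  next
    case (Suc n)
    have zV: "z \<in> V" and zs: "d x z + d z y = d x y" using Suc by (auto simp: geodesics_def)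
    from d_between[OF zV y, of 1] Suc(2)
    obtain w where w: "w \<in> V" "d z w = 1" "d w y = n" by auto
    have "d x w \<le> d x z + 1" using d_tri[OF x zV w(1)] w by simp
    moreover have "d x y \<le> d x w + d w y" using d_tri[OF x w(1) y] .
    ultimately have wg: "w \<in> geodesics x y" using zs Suc(2) w by (auto simp: geodesics_def)
    have "(z, w) \<in> r" using d_walk[OF zV w(1)] w(2) by simp
    then have "(w, z) \<in> linked (geodesics x y)" using r_sym linked_edge wg Suc(3) by blast
    moreover have "(y, w) \<in> linked (geodesics x y)" using Suc(1)[of w] w wg by simp
    ultimately show ?case using linked_trans by blast
  qed
qed

lemma ball_Suc:
  assumes "x \<in> V"
  shows "{v \<in> V. d x v \<le> Suc n} \<subseteq> {v \<in> V. d x v \<le> n} \<union> (\<Union>u\<in>{v \<in> V. d x v \<le> n}. r `` {u})"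
proof
  fix v assume v: "v \<in> {v \<in> V. d x v \<le> Suc n}"
  show "v \<in> {v \<in> V. d x v \<le> n} \<union> (\<Union>u\<in>{v \<in> V. d x v \<le> n}. r `` {u})"
  proof (cases "d x v \<le> n")
    case False
    then have dv: "d x v = Suc n" using v by auto
    then obtain u where u: "u \<in> V" "d x u = n" "d u v = 1"
      using d_between[of x v n] v assms by auto
    have "(u, v) \<in> r" using d_walk[of u v] u v by simp
    then show ?thesis using u by auto
  qed (use v in auto)
qed

lemma finite_ball: "x \<in> V \<Longrightarrow> finite {v \<in> V. d x v \<le> n}"
proof (induction n)
  case 0
  have "{v \<in> V. d x v \<le> 0} \<subseteq> {x}" using d_zero 0 by auto
  then show ?case using finite_subset by blast
next
  case (Suc n)
  have "finite ({v \<in> V. d x v \<le> n} \<union> (\<Union>u\<in>{v \<in> V. d x v \<le> n}. r `` {u}))"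
    using Suc r_fin by auto
  then show ?case using ball_Suc[OF Suc.prems] finite_subset by blast
qed

definition dist_set :: "'a set \<Rightarrow> 'a \<Rightarrow> nat" where
  "dist_set X v = (LEAST n. \<exists>x\<in>X. d x v = n)"

lemma dist_set_attained: "X \<noteq> {} \<Longrightarrow> \<exists>x\<in>X. d x v = dist_set X v"
  unfolding dist_set_def by (rule LeastI_ex) auto

lemma dist_set_le: "x \<in> X \<Longrightarrow> dist_set X v \<le> d x v"
  unfolding dist_set_def by (rule Least_le) auto

lemma dist_set_tri:
  assumes "X \<noteq> {}" "X \<subseteq> V" "u \<in> V" "v \<in> V"
  shows "dist_set X v \<le> dist_set X u + d u v"
proof -
  obtain x where x: "x \<in> X" "d x u = dist_set X u" using dist_set_attained[OF assms(1)] by blast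
  have "dist_set X v \<le> d x v" using dist_set_le x by simp
  also have "\<dots> \<le> d x u + d u v" using d_tri[of x u v] x assms by auto
  finally show ?thesis using x by simp
qed

abbreviation nbhd :: "'a set \<Rightarrow> nat \<Rightarrow> 'a set" where
  "nbhd X h \<equiv> {v \<in> V. dist_set X v \<le> h}"

lemma conn_nbhd:
  assumes "conn X" "X \<noteq> {}"
  shows "conn (nbhd X h)"
proof -
  have XV: "X \<subseteq> V" using assms conn_sub by simp
  let ?I = "{(x, v). x \<in> X \<and> v \<in> V \<and> d x v \<le> h}"
  have eq: "nbhd X h = X \<union> (\<Union>i\<in>?I. geodesics (fst i) (snd i))"
  proof (intro set_eqI iffI)
    fix v assume v: "v \<in> {v \<in> V. dist_set X v \<le> h}"
    obtain x where "x \<in> X" "d x v = dist_set X v" using dist_set_attained[OF assms(2)] by blast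
    then have x: "x \<in> X" "d x v \<le> h" using v by auto
    then have "(x, v) \<in> ?I" "v \<in> geodesics x v" using v geodesics_ends XV by auto
    then have "v \<in> (\<Union>i\<in>?I. geodesics (fst i) (snd i))" by force
    then show "v \<in> X \<union> (\<Union>i\<in>?I. geodesics (fst i) (snd i))" by blast
  next
    fix v assume "v \<in> X \<union> (\<Union>i\<in>?I. geodesics (fst i) (snd i))"
    then consider "v \<in> X" | x w where "x \<in> X" "w \<in> V" "d x w \<le> h" "v \<in> geodesics x w" by auto
    then show "v \<in> {v \<in> V. dist_set X v \<le> h}"
    proof cases
      case 1
      then have "dist_set X v \<le> 0" using dist_set_le[of v X v] by simp
      then show ?thesis using 1 XV by auto
    next
      case 2
      then show ?thesis using dist_set_le[of x X v] by (auto simp: geodesics_def)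
    qed
  qed
  show ?thesis unfolding eq
  proof (rule conn_Un_family[OF assms(1)])
    fix i assume "i \<in> ?I"
    then show "conn (geodesics (fst i) (snd i))" "geodesics (fst i) (snd i) \<inter> X \<noteq> {}"
      using geodesics_conn geodesics_ends XV by auto blast+
  qed
qed

text \<open>Collect the vertices of \<open>H\<close> below the band and the components of the band that touch its
  bottom. As \<open>f\<close> changes by at most one along an edge, this collection can only be left through a
  vertex at the top of the band, and that vertex belongs to one of the collected components.\<close>
lemma conn_truncate:
  fixes f :: "'a \<Rightarrow> nat"
  assumes H: "conn H" and lip: "\<And>u v. (u, v) \<in> r \<Longrightarrow> f v \<le> f u + 1"
    and x: "x \<in> H" "f x \<le> lo" and y: "y \<in> H" "hi \<le> f y" and lohi: "lo < hi"
  shows "\<exists>T a b. conn T \<and> T \<subseteq> H \<and> (\<forall>v\<in>T. lo \<le> f v \<and> f v \<le> hi) \<and> a \<in> T \<and> f a = lo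
    \<and> b \<in> T \<and> f b = hi"
proof -
  let ?B = "{v \<in> H. lo \<le> f v \<and> f v \<le> hi}"
  have BV: "?B \<subseteq> V" using H conn_sub by auto
  have "\<exists>a\<in>?B. f a = lo \<and> (\<exists>b\<in>component ?B a. f b = hi)"
  proof (rule ccontr)
    assume neg: "\<not> ?thesis"
    let ?A = "{v \<in> H. f v < lo} \<union> (\<Union>a\<in>{v \<in> H. f v = lo}. component ?B a)"
    have aB: "a \<in> ?B" if "a \<in> {v \<in> H. f v = lo}" for a using that lohi by auto
    have sub: "f v < hi" if "v \<in> ?A" for v
    proof (rule ccontr)
      assume "\<not> f v < hi"
      then have "v \<in> (\<Union>a\<in>{v \<in> H. f v = lo}. component ?B a)" using that lohi by auto
      then obtain a where a: "a \<in> {v \<in> H. f v = lo}" "v \<in> component ?B a" by blast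
      then have "v \<in> ?B" using component_sub[OF aB] by blast
      then have "f v = hi" using \<open>\<not> f v < hi\<close> by auto
      then show False using neg a aB by blast
    qed
    have "x \<in> ?A"
    proof (cases "f x = lo")
      case True
      then have "x \<in> {v \<in> H. f v = lo}" using x by simp
      then show ?thesis using component_self by blast
    qed (use x in auto)
    moreover have "y \<notin> ?A" using sub[of y] y by auto
    ultimately obtain u v where uv: "(u, v) \<in> r" "u \<in> H \<inter> ?A" "v \<in> H - ?A"
      using conn_crossing[OF H, of x ?A y] x(1) y(1) by blast
    have v1: "lo < f v"
    proof (rule ccontr)
      assume "\<not> lo < f v"
      then consider "f v < lo" | "f v = lo" by linarith
      then show False
      proof cases
        case 2
        then have "v \<in> {v \<in> H. f v = lo}" using uv by simp
        then have "v \<in> ?A" using component_self by blast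
        then show False using uv by simp
      qed (use uv in auto)
    qed
    have v2: "f v \<le> hi" using sub[of u] uv lip[of u v] by fastforce
    have vB: "v \<in> ?B" using v1 v2 uv by auto
    have "\<not> f u < lo" using v1 lip[OF uv(1)] by linarith
    then have "u \<in> (\<Union>a\<in>{v \<in> H. f v = lo}. component ?B a)" using uv(2) by auto
    then obtain a where a: "a \<in> {v \<in> H. f v = lo}" "u \<in> component ?B a" by blast
    then have "v \<in> component ?B a" using component_step[OF a(2) aB[OF a(1)] uv(1) vB] by simp
    then show False using uv(3) a(1) by blast
  qed
  then obtain a b where ab: "a \<in> ?B" "f a = lo" "b \<in> component ?B a" "f b = hi" by auto
  show ?thesis
    by (rule exI[of _ "component ?B a"], rule exI[of _ a], rule exI[of _ b])
       (use ab component_conn[OF BV ab(1)] component_sub[OF ab(1)] component_self in auto)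
qed

lemma linked_finite_conn:
  assumes "(x, y) \<in> linked A" "x \<in> A" "A \<subseteq> V"
  shows "\<exists>F. finite F \<and> conn F \<and> F \<subseteq> A \<and> x \<in> F \<and> y \<in> F"
  using assms(1)
proof (induction rule: rtrancl_induct)
  case base
  show ?case using assms conn_singleton by (intro exI[of _ "{x}"]) auto
next
  case (step y z)
  then obtain F where F: "finite F" "conn F" "F \<subseteq> A" "x \<in> F" "y \<in> F" by auto
  have yz: "(y, z) \<in> r" "y \<in> A" "z \<in> A" using step by auto
  have "conn {y, z}" by (rule connI[where c=y]) (use yz assms(3) linked_edge in auto)
  then have "conn (F \<union> {y, z})" by (rule conn_Un[OF F(2)]) (use F in auto)
  then show ?case using F yz by (intro exI[of _ "F \<union> {y, z}"]) auto
qed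

end

section \<open>Boundaries are coarsely connected\<close>

lemma graph_path_succ:
  "graph_path G p \<longleftrightarrow> p \<noteq> [] \<and> distinct p \<and> set p \<subseteq> vertices G \<and>
     successively (\<lambda>u v. {u, v} \<in> edges G) p"
  unfolding graph_path_def successively_conv_nth by auto

lemma graph_path_sublist:
  assumes "graph_path G (xs @ p @ ys)" "p \<noteq> []"
  shows "graph_path G p"
  using assms by (auto simp: graph_path_succ successively_append_iff)

text \<open>Recursive counterpart of the first part of \<open>cycle_edges\<close>, for induction on the list.\<close>
fun path_edges :: "'a list \<Rightarrow> 'a set set" where
  "path_edges (x # y # zs) = insert {x, y} (path_edges (y # zs))"
| "path_edges _ = {}"

lemma path_edges_nth: "path_edges p = {{p ! i, p ! Suc i} |i. Suc i < length p}"
proof (induction p rule: path_edges.induct)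
  case (1 x y zs)
  have "{{(x # y # zs) ! i, (x # y # zs) ! Suc i} |i. Suc i < length (x # y # zs)}
    = insert {x, y} {{(y # zs) ! i, (y # zs) ! Suc i} |i. Suc i < length (y # zs)}" (is "?L = ?R")
  proof (intro set_eqI iffI)
    fix e assume "e \<in> ?L"
    then obtain i where i: "e = {(x # y # zs) ! i, (x # y # zs) ! Suc i}"
      "Suc i < length (x # y # zs)" by auto
    then show "e \<in> ?R" by (cases i) auto
  next
    fix e assume "e \<in> ?R"
    then consider "e = {x, y}" | i where "e = {(y # zs) ! i, (y # zs) ! Suc i}"
      "Suc i < length (y # zs)" by auto
    then show "e \<in> ?L"
    proof cases
      case 1
      then have "e = {(x # y # zs) ! 0, (x # y # zs) ! Suc 0} \<and> Suc 0 < length (x # y # zs)" by simp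
      then show ?thesis by blast
    next
      case 2
      then have "e = {(x # y # zs) ! Suc i, (x # y # zs) ! Suc (Suc i)}
        \<and> Suc (Suc i) < length (x # y # zs)" by simp
      then show ?thesis by blast
    qed
  qed
  then show ?case using 1 by simp
qed auto

lemma cycle_edges_path_edges: "cycle_edges c = insert {last c, hd c} (path_edges c)"
  unfolding cycle_edges_def path_edges_nth by auto

lemma path_edges_subset: "e \<in> path_edges p \<Longrightarrow> e \<subseteq> set p"
  by (induction p rule: path_edges.induct) auto

lemma finite_path_edges[simp]: "finite (path_edges p)"
  by (induction p rule: path_edges.induct) auto

lemma path_edges_append:
  "p \<noteq> [] \<Longrightarrow> q \<noteq> [] \<Longrightarrow>
    path_edges (p @ q) = path_edges p \<union> path_edges q \<union> {{last p, hd q}}"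
proof (induction p rule: path_edges.induct)
  case ("2_2" x)
  then show ?case by (cases q) auto
qed auto

definition crosses :: "'a set \<Rightarrow> 'a set \<Rightarrow> bool" where
  "crosses D e \<longleftrightarrow> e \<inter> D \<noteq> {} \<and> e - D \<noteq> {}"

text \<open>Going along the path, each crossing edge switches the side. The path is distinct, so no edge is
  repeated, and counting edges as a set agrees with counting switches.\<close>
lemma even_crossing_path:
  "distinct p \<Longrightarrow> p \<noteq> [] \<Longrightarrow>
    even (card {e \<in> path_edges p. crosses D e}) \<longleftrightarrow> (hd p \<in> D \<longleftrightarrow> last p \<in> D)"
proof (induction p rule: path_edges.induct)
  case (1 x y zs)
  have new: "{x, y} \<notin> path_edges (y # zs)" using path_edges_subset 1(2) by fastforce
  have IH: "even (card {e \<in> path_edges (y # zs). crosses D e})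
    \<longleftrightarrow> (y \<in> D \<longleftrightarrow> last (y # zs) \<in> D)" using 1 by auto
  show ?case
  proof (cases "crosses D {x, y}")
    case True
    then have "{e \<in> path_edges (x # y # zs). crosses D e}
      = insert {x, y} {e \<in> path_edges (y # zs). crosses D e}" by auto
    then have "card {e \<in> path_edges (x # y # zs). crosses D e}
      = Suc (card {e \<in> path_edges (y # zs). crosses D e})" using new by simp
    moreover have "x \<in> D \<longleftrightarrow> y \<notin> D" using True by (auto simp: crosses_def)
    ultimately show ?thesis using IH by auto
  next
    case False
    then have "{e \<in> path_edges (x # y # zs). crosses D e}
      = {e \<in> path_edges (y # zs). crosses D e}" by auto
    moreover have "x \<in> D \<longleftrightarrow> y \<in> D" using False by (auto simp: crosses_def)
    ultimately show ?thesis using IH by auto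
  qed
qed auto

lemma even_crossing_cycle:
  assumes "graph_cycle G c"
  shows "even (card {e \<in> cycle_edges c. crosses D e})"
proof -
  have c: "distinct c" "length c \<ge> 3" using assms by (auto simp: graph_cycle_def graph_path_def)
  obtain x y z zs where xyz: "c = x # y # z # zs"
    using c(2) by (metis Suc_le_length_iff numeral_3_eq_3)
  have ev: "even (card {e \<in> path_edges c. crosses D e}) \<longleftrightarrow> (hd c \<in> D \<longleftrightarrow> last c \<in> D)"
    using even_crossing_path[of c D] c xyz by simp
  have new: "{last c, hd c} \<notin> path_edges c"
  proof
    assume "{last c, hd c} \<in> path_edges c"
    then consider "{last c, hd c} = {x, y}" | "{last c, hd c} \<subseteq> set (y # z # zs)"
      using path_edges_subset[of "{last c, hd c}" "y # z # zs"] xyz by auto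
    then show False using c xyz last_in_set[of "z # zs"]
      by cases (auto simp: doubleton_eq_iff split: if_splits)
  qed
  show ?thesis
  proof (cases "crosses D {last c, hd c}")
    case True
    then have "{e \<in> cycle_edges c. crosses D e}
      = insert {last c, hd c} {e \<in> path_edges c. crosses D e}"
      by (auto simp: cycle_edges_path_edges)
    then have "card {e \<in> cycle_edges c. crosses D e} = Suc (card {e \<in> path_edges c. crosses D e})"
      using new by simp
    moreover have "hd c \<in> D \<longleftrightarrow> last c \<notin> D" using True by (auto simp: crosses_def)
    ultimately show ?thesis using ev by auto
  next
    case False
    then have "{e \<in> cycle_edges c. crosses D e} = {e \<in> path_edges c. crosses D e}"
      by (auto simp: cycle_edges_path_edges)
    moreover have "hd c \<in> D \<longleftrightarrow> last c \<in> D" using False by (auto simp: crosses_def)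
    ultimately show ?thesis using ev by auto
  qed
qed

text \<open>The parity of the intersection with \<open>F\<close> is a linear functional; this is its kernel.\<close>
lemma F2_subspace_even: "F2_subspace {A. finite A \<and> even (card (A \<inter> F))}"
proof -
  have "even (card (sym_diff A B \<inter> F))"
    if "finite A" "finite B" "even (card (A \<inter> F))" "even (card (B \<inter> F))" for A B
  proof -
    have eq: "sym_diff A B \<inter> F = ((A \<inter> F) - (B \<inter> F)) \<union> ((B \<inter> F) - (A \<inter> F))" by auto
    have "card (sym_diff A B \<inter> F) = card ((A \<inter> F) - (B \<inter> F)) + card ((B \<inter> F) - (A \<inter> F))"
      unfolding eq by (rule card_Un_disjoint) (use that in auto)
    moreover have "card (A \<inter> F) = card ((A \<inter> F) - (B \<inter> F)) + card (A \<inter> F \<inter> (B \<inter> F))"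
      using card_Int_Diff[of "A \<inter> F" "B \<inter> F"] that by simp
    moreover have "card (B \<inter> F) = card ((B \<inter> F) - (A \<inter> F)) + card (A \<inter> F \<inter> (B \<inter> F))"
      using card_Int_Diff[of "B \<inter> F" "A \<inter> F"] that by (simp add: Int_commute)
    ultimately show ?thesis using that by presburger
  qed
  then show ?thesis unfolding F2_subspace_def by auto
qed

lemma F2_span_even:
  assumes "A \<in> F2_span C" "\<And>B. B \<in> C \<Longrightarrow> finite B \<and> even (card (B \<inter> F))"
  shows "even (card (A \<inter> F))"
proof -
  have "F2_span C \<subseteq> {A. finite A \<and> even (card (A \<inter> F))}"
    unfolding F2_span_def by (rule hull_minimal) (use assms F2_subspace_even in auto)
  then show ?thesis using assms by auto
qed

locale graph_component = conn_graph V r for V :: "'a set" and r +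
  fixes G :: "'a ugraph"
  assumes r_iff: "(u, v) \<in> r \<longleftrightarrow> u \<in> V \<and> {u, v} \<in> edges G"
    and simple: "simple_graph G"
    and V_sub: "V \<subseteq> vertices G"
begin

lemma link_path:
  assumes "(x, y) \<in> linked A" "x \<in> A" "A \<subseteq> V"
  shows "\<exists>p. graph_path G p \<and> set p \<subseteq> A \<and> hd p = x \<and> last p = y"
  using assms(1)
proof (induction rule: rtrancl_induct)
  case base
  show ?case using assms V_sub by (intro exI[of _ "[x]"]) (auto simp: graph_path_succ)
next
  case (step y z)
  then obtain p where p: "graph_path G p" "set p \<subseteq> A" "hd p = x" "last p = y" by auto
  have pne: "p \<noteq> []" using p(1) by (simp add: graph_path_def)
  have yz: "{y, z} \<in> edges G" "z \<in> A" using step r_iff by auto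
  show ?case
  proof (cases "z \<in> set p")
    case True
    then obtain xs ys where xs: "p = (xs @ [z]) @ ys" by (metis append.assoc append_Cons append_Nil split_list)
    have "graph_path G (xs @ [z])" using graph_path_sublist[of G "[]" "xs @ [z]" ys] p(1) xs by simp
    moreover have "hd (xs @ [z]) = x" using p(3) xs by (cases xs) auto
    ultimately show ?thesis using p xs by (intro exI[of _ "xs @ [z]"]) auto
  next
    case False
    have "graph_path G (p @ [z])"
      using p False yz assms(3) V_sub by (auto simp: graph_path_succ successively_append_iff)
    then show ?thesis using p pne yz by (intro exI[of _ "p @ [z]"]) auto
  qed
qed

lemma path_nth:
  assumes p: "graph_path G p" and i: "i < length p" "p ! i \<in> V"
  shows "i + k < length p \<Longrightarrow> p ! (i + k) \<in> V \<and> (p ! i, p ! (i + k)) \<in> linked (set p)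
    \<and> (p ! i, p ! (i + k)) \<in> r ^^ k"
proof (induction k)
  case 0
  then show ?case using i by simp
next
  case (Suc k)
  have "{p ! (i + k), p ! Suc (i + k)} \<in> edges G" using p Suc.prems by (auto simp: graph_path_def)
  then have e: "(p ! (i + k), p ! Suc (i + k)) \<in> r" using Suc r_iff by auto
  moreover from e have "(p ! (i + k), p ! Suc (i + k)) \<in> linked (set p)"
    using Suc.prems linked_edge nth_mem by (metis Suc_lessD add_Suc_right)
  ultimately show ?case using Suc r_sub linked_trans by auto
qed

lemma path_linked:
  assumes p: "graph_path G p" and u: "u \<in> set p" "u \<in> V" and v: "v \<in> set p"
  shows "v \<in> V \<and> (u, v) \<in> linked (set p) \<and> d u v \<le> length p - 1"
proof -
  have "p \<noteq> []" using u by auto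
  obtain i where i: "i < length p" "p ! i = u" using u by (metis in_set_conv_nth)
  obtain j where j: "j < length p" "p ! j = v" using v by (metis in_set_conv_nth)
  have V0: "p ! 0 \<in> V"
  proof -
    have "graph_path G (rev p)"
      using p by (auto simp: graph_path_succ successively_rev insert_commute)
    moreover have ri: "rev p ! (length p - Suc i) = u" using i by (simp add: rev_nth)
    ultimately have "rev p ! (length p - Suc i + i) \<in> V"
      using path_nth[of "rev p" "length p - Suc i" i] u i by auto
    moreover have "rev p ! (length p - Suc i + i) = p ! 0" using i by (simp add: rev_nth)
    ultimately show ?thesis by simp
  qed
  have Vj: "p ! k \<in> V" if "k < length p" for k
    using path_nth[OF p, of 0 k] V0 \<open>p \<noteq> []\<close> that by auto
  show ?thesis
  proof (cases "i \<le> j")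
    case True
    then have "(u, v) \<in> linked (set p)" "(u, v) \<in> r ^^ (j - i)"
      using path_nth[OF p i(1), of "j - i"] i j u by auto
    then show ?thesis using d_le[of u v "j - i"] Vj j by auto
  next
    case False
    then have "(v, u) \<in> linked (set p)" "(v, u) \<in> r ^^ (i - j)"
      using path_nth[OF p j(1), of "i - j"] i j Vj by auto
    then show ?thesis using d_le[of v u "i - j"] Vj j d_sym[of u v] linked_sym i by auto
  qed
qed

text \<open>Suppose that some boundary vertices are linked to \<open>y0\<close> in the neighbourhood and some are not.
  Since \<open>D\<close> and its complement are connected, there is a cycle which crosses between them
  exactly twice: once at \<open>y0\<close> and once at a vertex \<open>y2\<close> that is not linked to \<open>y0\<close>. A short cycle
  links all its boundary vertices to one another, so its crossing edges are either all at vertices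
  of the first kind or all at vertices of the second kind, and the number of those at vertices of
  the first kind is even. By linearity the same parity holds for the long cycle, which has just
  one.\<close>
lemma bond_nbhd_conn:
  assumes gen: "F2_span {cycle_edges c |c. graph_cycle G c \<and> length c \<le> \<kappa>} = cycle_space G"
    and D: "conn D" and cD: "conn (V - D)"
  shows "conn {v \<in> V. \<exists>y\<in>boundary D. d y v \<le> \<kappa>}"
proof -
  let ?H = "{v \<in> V. \<exists>y\<in>boundary D. d y v \<le> \<kappa>}"
  have bV: "boundary D \<subseteq> V" using r_sub by (auto simp: boundary_def)
  have bH: "boundary D \<subseteq> ?H"
  proof
    fix y assume "y \<in> boundary D"
    then show "y \<in> ?H" using bV by (auto intro!: bexI[of _ y])
  qed
  have key: "(y0, y2) \<in> linked ?H" if y0: "y0 \<in> boundary D" and y2: "y2 \<in> boundary D" for y0 y2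
  proof (rule ccontr)
    assume neg: "(y0, y2) \<notin> linked ?H"
    define Y1 where "Y1 = {y \<in> boundary D. (y0, y) \<in> linked ?H}"
    define F1 where "F1 = {e. crosses D e \<and> e \<inter> Y1 \<noteq> {}}"
    obtain x0 where x0: "x0 \<in> D" "(x0, y0) \<in> r" using y0 by (auto simp: boundary_def)
    obtain x2 where x2: "x2 \<in> D" "(x2, y2) \<in> r" using y2 by (auto simp: boundary_def)
    have DV: "D \<subseteq> V" using D conn_sub by simp
    have yD: "y0 \<in> V - D" "y2 \<in> V - D" using y0 y2 bV by (auto simp: boundary_def)
    obtain p where p: "graph_path G p" "set p \<subseteq> D" "hd p = x2" "last p = x0"
      using link_path[OF conn_linked[OF D x2(1) x0(1) subset_refl] x2(1) DV] by auto
    obtain q where q: "graph_path G q" "set q \<subseteq> V - D" "hd q = y0" "last q = y2"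
      using link_path[OF conn_linked[OF cD yD subset_refl] yD(1) Diff_subset] by auto
    have ne: "p \<noteq> []" "q \<noteq> []" using p q by (auto simp: graph_path_def)
    have y02: "y0 \<noteq> y2" using neg by auto
    have e0: "{x0, y0} \<in> edges G" and e2: "{y2, x2} \<in> edges G"
      using x0 x2 r_iff by (auto simp: insert_commute)
    \<comment> \<open>The cycle runs inside \<open>D\<close> from \<open>x2\<close> to \<open>x0\<close> and back outside \<open>D\<close> from \<open>y0\<close> to \<open>y2\<close>.\<close>
    let ?c = "p @ q"
    have cyc: "graph_cycle G ?c"
    proof -
      have "graph_path G ?c" using p q ne e0 by (auto simp: graph_path_succ successively_append_iff)
      moreover have "length ?c \<ge> 3"
      proof -
        have "length q \<noteq> 1" using q y02 by (auto simp: length_Suc_conv)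
        then show ?thesis using ne by (cases p; cases q; cases "tl q") auto
      qed
      ultimately show ?thesis using ne q(4) p(3) e2 by (auto simp: graph_cycle_def)
    qed
    have c_in: "cycle_edges ?c \<in> cycle_space G"
      unfolding cycle_space_def F2_span_def by (rule hull_inc) (use cyc in auto)
    have "cycle_edges ?c \<inter> F1 = {{x0, y0}}"
    proof -
      have "e \<notin> F1" if "e \<in> path_edges p" for e
        using path_edges_subset[OF that] p(2) by (auto simp: F1_def crosses_def)
      moreover have "e \<notin> F1" if "e \<in> path_edges q" for e
        using path_edges_subset[OF that] q(2) by (auto simp: F1_def crosses_def)
      moreover have "{y2, x2} \<notin> F1"
        using x2 neg by (auto simp: F1_def Y1_def boundary_def)
      moreover have "{x0, y0} \<in> F1"
        using x0 y0 by (auto simp: F1_def Y1_def boundary_def crosses_def)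
      moreover have "cycle_edges ?c = {{y2, x2}} \<union> path_edges p \<union> path_edges q \<union> {{x0, y0}}"
        unfolding cycle_edges_path_edges path_edges_append[OF ne] using ne p q by auto
      ultimately show ?thesis by (simp add: Int_Un_distrib2) blast
    qed
    then have odd: "odd (card (cycle_edges ?c \<inter> F1))" by simp
    have short: "even (card (cycle_edges b \<inter> F1))"
      if b: "graph_cycle G b" "length b \<le> \<kappa>" for b
    proof (cases "cycle_edges b \<inter> F1 = {}")
      case False
      then obtain e y where e: "e \<in> cycle_edges b" "y \<in> e" "y \<in> Y1" unfolding F1_def by auto
      have bp: "graph_path G b" "b \<noteq> []" using b by (auto simp: graph_cycle_def graph_path_def)
      have vs: "e' \<subseteq> set b" if "e' \<in> cycle_edges b" for e'
        using that path_edges_subset[of e' b] bp by (auto simp: cycle_edges_path_edges)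
      have yb: "y \<in> set b" "y \<in> V" using vs e bV by (auto simp: Y1_def)
      have bV2: "set b \<subseteq> V" using path_linked[OF bp(1) yb] by auto
      have "set b \<subseteq> ?H"
      proof
        fix v assume "v \<in> set b"
        then have "v \<in> V" "d y v \<le> \<kappa>" using path_linked[OF bp(1) yb, of v] b by auto
        then show "v \<in> ?H" using e by (auto simp: Y1_def)
      qed
      have "e' \<in> F1" if e': "e' \<in> cycle_edges b" and cr: "crosses D e'" for e'
      proof -
        have "e' \<in> edges G"
          using e' b bp by (auto simp: cycle_edges_def graph_cycle_def graph_path_def)
        then have "card e' = 2" using simple by (auto simp: simple_graph_def)
        then obtain u v where uv: "e' = {u, v}" "u \<in> D" "v \<notin> D"
          using cr unfolding crosses_def card_2_iff by auto
        have "(u, v) \<in> r" using uv \<open>e' \<in> edges G\<close> r_iff DV by auto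
        then have vb: "v \<in> boundary D" using uv by (auto simp: boundary_def)
        have "v \<in> set b" using vs[OF e'] uv by auto
        then have "(y, v) \<in> linked ?H"
          using path_linked[OF bp(1) yb, of v] linked_mono \<open>set b \<subseteq> ?H\<close> by blast
        then have "(y0, v) \<in> linked ?H" using e(3) linked_trans by (auto simp: Y1_def)
        then have "v \<in> Y1" using vb by (simp add: Y1_def)
        then show ?thesis using cr uv by (auto simp: F1_def)
      qed
      then have "cycle_edges b \<inter> F1 = {e \<in> cycle_edges b. crosses D e}" by (auto simp: F1_def)
      then show ?thesis using even_crossing_cycle[OF b(1)] by simp
    qed simp
    have "even (card (cycle_edges ?c \<inter> F1))"
      by (rule F2_span_even[of _ "{cycle_edges c |c. graph_cycle G c \<and> length c \<le> \<kappa>}"])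
         (use gen c_in short in \<open>auto simp: cycle_edges_path_edges\<close>)
    then show False using odd by simp
  qed
  show ?thesis
  proof (cases "boundary D = {}")
    case True
    then show ?thesis by (simp add: conn_def)
  next
    case False
    then obtain y0 where y0: "y0 \<in> boundary D" by auto
    show ?thesis
    proof (rule connI[where c=y0])
      fix v assume v: "v \<in> ?H"
      then obtain y where y: "y \<in> boundary D" "d y v \<le> \<kappa>" by auto
      have yV: "y \<in> V" "v \<in> V" using y bV v by auto
      have "geodesics y v \<subseteq> ?H"
      proof
        fix w assume "w \<in> geodesics y v"
        then have "w \<in> V" "d y w \<le> \<kappa>" using y(2) by (auto simp: geodesics_def)
        then show "w \<in> ?H" using y(1) by blast
      qed
      then have "(y, v) \<in> linked ?H" using conn_linked[OF geodesics_conn[OF yV]] geodesics_ends[OF yV] by blast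
      then show "(y0, v) \<in> linked ?H" using key[OF y0 y(1)] linked_trans by blast
    qed simp
  qed
qed

end

section \<open>Tracks along a geodesic ray\<close>

text \<open>The rays \<open>q i\<close> are disjoint rays of one end: by the last assumption no finite set separates two of
  them, even if it contains initial segments of the rays.\<close>
locale thick_component = graph_component V r G for V :: "'a set" and r and G :: "'a ugraph" +
  fixes root :: 'a and \<kappa> \<Delta> :: nat and q :: "nat \<Rightarrow> nat \<Rightarrow> 'a"
  assumes root: "root \<in> V"
    and gen: "F2_span {cycle_edges c |c. graph_cycle G c \<and> length c \<le> \<kappa>} = cycle_space G"
    and deg: "card (r `` {x}) \<le> \<Delta>"
    and q_inj: "inj (q i)"
    and q_ray: "(q i n, q i (Suc n)) \<in> r"
    and q_disj: "i \<noteq> j \<Longrightarrow> range (q i) \<inter> range (q j) = {}"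
    and q_eq: "finite B \<Longrightarrow> \<exists>S. conn S \<and> S \<inter> B = {} \<and> S \<inter> range (q i) \<noteq> {} \<and> S \<inter> range (q j) \<noteq> {}"
begin

definition level :: "'a \<Rightarrow> nat" where "level v = d root v"

lemma level_tri: "u \<in> V \<Longrightarrow> v \<in> V \<Longrightarrow> level v \<le> level u + d u v"
  unfolding level_def using d_tri root by simp

lemma level_tri': "u \<in> V \<Longrightarrow> v \<in> V \<Longrightarrow> level u \<le> level v + d u v"
  using level_tri[of v u] d_sym[of u v] by simp

lemma level_edge: "(u, v) \<in> r \<Longrightarrow> level v \<le> level u + 1"
  using level_tri[of u v] d_edge[of u v] r_sub by fastforce

lemma finite_lev: "finite {v \<in> V. level v \<le> n}"
  unfolding level_def by (rule finite_ball[OF root])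

text \<open>The bounded degree is used for this: the bound does not depend on the centre, so one and the same
  number of disjoint rays suffices to have one that avoids a given ball, wherever the ball lies.\<close>
lemma card_ball: "x \<in> V \<Longrightarrow> card {v \<in> V. d x v \<le> n} \<le> (\<Delta> + 1) ^ n"
proof (induction n)
  case 0
  have "{v \<in> V. d x v \<le> 0} \<subseteq> {x}" using d_zero 0 by auto
  then show ?case using card_mono[of "{x}"] by fastforce
next
  case (Suc n)
  let ?B = "{v \<in> V. d x v \<le> n}"
  have fB: "finite ?B" using finite_ball Suc.prems by simp
  have "{v \<in> V. d x v \<le> Suc n} \<subseteq> ?B \<union> (\<Union>u\<in>?B. r `` {u})" by (rule ball_Suc[OF Suc.prems])
  then have "card {v \<in> V. d x v \<le> Suc n} \<le> card (?B \<union> (\<Union>u\<in>?B. r `` {u}))"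
    by (rule card_mono[rotated]) (use fB r_fin in auto)
  also have "\<dots> \<le> card ?B + card (\<Union>u\<in>?B. r `` {u})" by (rule card_Un_le)
  also have "card (\<Union>u\<in>?B. r `` {u}) \<le> (\<Sum>u\<in>?B. card (r `` {u}))" by (rule card_UN_le[OF fB])
  also have "(\<Sum>u\<in>?B. card (r `` {u})) \<le> card ?B * \<Delta>"
    using sum_bounded_above[of ?B "\<lambda>u. card (r `` {u})" \<Delta>] deg by simp
  also have "card ?B + card ?B * \<Delta> = card ?B * (\<Delta> + 1)" by simp
  also have "\<dots> \<le> (\<Delta> + 1) ^ n * (\<Delta> + 1)" using Suc by (intro mult_right_mono) auto
  finally show ?case by (simp add: mult.commute)
qed

lemma q_V: "q i n \<in> V"
  using q_ray r_sub by blast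

lemma q_escapes: "finite {k. level (q i k) \<le> n}"
proof (rule finite_imageD)
  show "finite (q i ` {k. level (q i k) \<le> n})"
    by (rule finite_subset[OF _ finite_lev[of n]]) (use q_V in auto)
  show "inj_on (q i) {k. level (q i k) \<le> n}" using q_inj inj_on_subset by blast
qed

abbreviation limit_ray :: "(nat \<Rightarrow> 'a) \<Rightarrow> bool" where
  "limit_ray R \<equiv> (\<forall>n. R n \<in> V \<and> level (R n) = n \<and> (R n, R (Suc n)) \<in> r
    \<and> infinite {k. R n \<in> geodesics root (q 0 k)}) \<and> R 0 = root"

text \<open>A compactness argument: infinitely many of the geodesics from the root to the vertices of \<open>q 0\<close>
  agree on their first \<open>n\<close> vertices. The condition that \<open>R n\<close> lies on geodesics to infinitely many
  vertices of \<open>q 0\<close> keeps \<open>R\<close> in the same end: from far out on \<open>R\<close> one reaches \<open>q 0\<close> without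
  descending to a lower level.\<close>
lemma geodesic_ray: "\<exists>R. limit_ray R"
proof -
  let ?P = "\<lambda>n x. x \<in> V \<and> level x = n \<and> infinite {k. x \<in> geodesics root (q 0 k)}"
  have "\<exists>R. \<forall>n. ?P n (R n) \<and> (R n, R (Suc n)) \<in> r"
  proof (rule dependent_nat_choice)
    have "{k. root \<in> geodesics root (q 0 k)} = UNIV" using geodesics_ends[OF root q_V] by auto
    then show "\<exists>x. ?P 0 x" using root by (intro exI[of _ root]) (auto simp: level_def)
  next
    fix x n assume P: "?P n x"
    let ?K = "{k. x \<in> geodesics root (q 0 k)}"
    let ?K' = "\<lambda>y. {k. y \<in> geodesics root (q 0 k)}"
    let ?Y = "{y \<in> r `` {x}. level y = Suc n}"
    have "?K \<subseteq> {k. level (q 0 k) \<le> n} \<union> (\<Union>y\<in>?Y. ?K' y)"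
    proof
      fix k assume k: "k \<in> ?K"
      show "k \<in> {k. level (q 0 k) \<le> n} \<union> (\<Union>y\<in>?Y. ?K' y)"
      proof (cases "level (q 0 k) \<le> n")
        case False
        have s: "n + d x (q 0 k) = level (q 0 k)" using k P by (auto simp: geodesics_def level_def)
        then have "1 \<le> d x (q 0 k)" using False by simp
        then obtain y where y: "y \<in> V" "d x y = 1" "d y (q 0 k) = d x (q 0 k) - 1"
          using d_between[of x "q 0 k" 1] P q_V by auto
        have xy: "(x, y) \<in> r" using d_walk[of x y] P y by simp
        have l1: "level y \<le> n + 1" using level_edge[OF xy] P by simp
        have l2: "level (q 0 k) \<le> level y + d y (q 0 k)" by (rule level_tri[OF y(1) q_V])
        have "level y = Suc n" using l1 l2 s y \<open>1 \<le> d x (q 0 k)\<close> by linarith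
        moreover have "y \<in> geodesics root (q 0 k)"
          using y s \<open>level y = Suc n\<close> \<open>1 \<le> d x (q 0 k)\<close> by (auto simp: geodesics_def level_def)
        ultimately show ?thesis using xy by auto
      qed simp
    qed
    then have "infinite ({k. level (q 0 k) \<le> n} \<union> (\<Union>y\<in>?Y. ?K' y))" using P finite_subset by blast
    then have "infinite (\<Union>y\<in>?Y. ?K' y)" using q_escapes by simp
    moreover have "finite ?Y" by (rule finite_subset[OF _ r_fin[of x]]) auto
    ultimately obtain y where "y \<in> ?Y" "infinite (?K' y)" by (meson finite_UN_I)
    then show "\<exists>y. ?P (Suc n) y \<and> (x, y) \<in> r" using r_sub by auto
  qed
  then obtain R where R: "\<forall>n. ?P n (R n) \<and> (R n, R (Suc n)) \<in> r" by auto
  have "R 0 = root" using R d_zero[OF root, of "R 0"] by (auto simp: level_def)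
  then show ?thesis using R by auto
qed

definition R :: "nat \<Rightarrow> 'a" where "R = (SOME R. limit_ray R)"

lemma R_all: "limit_ray R"
  unfolding R_def by (rule someI_ex[OF geodesic_ray])

lemma R_V[simp]: "R n \<in> V" and R_lev[simp]: "level (R n) = n" and R_edge: "(R n, R (Suc n)) \<in> r"
  and R_inf: "infinite {k. R n \<in> geodesics root (q 0 k)}" and R_0: "R 0 = root"
  using R_all by auto

definition ray_dist :: "'a \<Rightarrow> nat" where "ray_dist v = dist_set (range R) v"

lemma ray_dist_tri: "u \<in> V \<Longrightarrow> v \<in> V \<Longrightarrow> ray_dist v \<le> ray_dist u + d u v"
  unfolding ray_dist_def by (rule dist_set_tri) auto

lemma ray_dist_tri': "u \<in> V \<Longrightarrow> v \<in> V \<Longrightarrow> ray_dist u \<le> ray_dist v + d u v"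
  using ray_dist_tri[of v u] d_sym[of u v] by simp

lemma ray_dist_le: "ray_dist v \<le> d (R m) v"
  unfolding ray_dist_def by (rule dist_set_le) auto

text \<open>As \<open>R\<close> is geodesic, the index of the vertex of \<open>R\<close> nearest to \<open>v\<close> differs from the level of \<open>v\<close>
  by at most the distance of \<open>v\<close> from \<open>R\<close>. This is why levels can serve as a coordinate along \<open>R\<close>.\<close>
lemma ray_dist_foot:
  assumes "v \<in> V"
  shows "\<exists>m. d (R m) v = ray_dist v \<and> m \<le> level v + ray_dist v \<and> level v \<le> m + ray_dist v"
proof -
  obtain m where m: "d (R m) v = ray_dist v" using dist_set_attained[of "range R" v] unfolding ray_dist_def by auto
  then show ?thesis
    using level_tri[of "R m" v] level_tri'[of "R m" v] assms by (intro exI[of _ m]) auto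
qed

text \<open>There are more rays \<open>q i\<close> than vertices in the ball, so one of them avoids it. The connected set
  goes from the root to that ray along a low geodesic, follows the ray, changes to \<open>q 0\<close> beyond
  the ball, and finally returns to \<open>R\<close> along a high geodesic.\<close>
lemma conn_avoiding_ball:
  "\<exists>N. \<forall>n\<ge>N. \<exists>S. conn S \<and> root \<in> S \<and> (\<exists>m>n + W. R m \<in> S) \<and> (\<forall>v\<in>S. d (R n) v > W)"
proof -
  let ?M = "(\<Delta> + 1) ^ W"
  define N0 where "N0 = Max ((\<lambda>i. level (q i 0)) ` {..?M})"
  have N0: "level (q i 0) \<le> N0" if "i \<le> ?M" for i
    unfolding N0_def by (rule Max_ge) (use that in auto)
  show ?thesis
  proof (intro exI[of _ "N0 + W + 1"] allI impI)
    fix n assume n: "n \<ge> N0 + W + 1"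
    let ?B = "{v \<in> V. d (R n) v \<le> W}"
    have "\<exists>i\<le>?M. range (q i) \<inter> ?B = {}"
    proof (rule ccontr)
      assume "\<not> ?thesis"
      then have "\<forall>i\<in>{..?M}. \<exists>x. x \<in> range (q i) \<inter> ?B" by blast
      then obtain f where f: "\<forall>i\<in>{..?M}. f i \<in> range (q i) \<inter> ?B" by metis
      have "inj_on f {..?M}"
      proof (rule inj_onI)
        fix i j assume "i \<in> {..?M}" "j \<in> {..?M}" "f i = f j"
        then have "f i \<in> range (q i) \<inter> range (q j)" using f by force
        then show "i = j" using q_disj[of i j] by blast
      qed
      then have "card {..?M} \<le> card ?B"
        by (rule card_inj_on_le) (use f finite_ball in auto)
      then show False using card_ball[of "R n" W] by simp
    qed
    then obtain i where i: "i \<le> ?M" "range (q i) \<inter> ?B = {}" by auto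
    obtain k0 where k0: "\<And>k. k \<ge> k0 \<Longrightarrow> level (q 0 k) > n + W"
    proof -
      obtain b where "\<forall>k\<in>{k. level (q 0 k) \<le> n + W}. k < b"
        using q_escapes[of 0 "n + W"] finite_nat_set_iff_bounded by auto
      then show thesis using that[of b] by (metis linorder_not_le mem_Collect_eq)
    qed
    obtain S3 where S3: "conn S3" "S3 \<inter> ({v \<in> V. level v \<le> n + W} \<union> q 0 ` {..<k0}) = {}"
      "S3 \<inter> range (q i) \<noteq> {}" "S3 \<inter> range (q 0) \<noteq> {}"
      using q_eq[of "{v \<in> V. level v \<le> n + W} \<union> q 0 ` {..<k0}" i 0] finite_lev by auto
    define m where "m = n + W + 1"
    have "\<not> {k. R m \<in> geodesics root (q 0 k)} \<subseteq> {..<k0}"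
      using R_inf[of m] finite_subset by blast
    then obtain k where k: "k \<ge> k0" "R m \<in> geodesics root (q 0 k)"
      unfolding subset_iff by (metis lessThan_iff linorder_not_le mem_Collect_eq)
    define S1 where "S1 = geodesics root (q i 0)"
    define S5 where "S5 = geodesics (R m) (q 0 k)"
    have c1: "conn S1" "root \<in> S1" "q i 0 \<in> S1"
      using geodesics_conn[OF root q_V] geodesics_ends[OF root q_V] by (auto simp: S1_def)
    have c5: "conn S5" "R m \<in> S5" "q 0 k \<in> S5"
      using geodesics_conn[OF R_V q_V] geodesics_ends[OF R_V q_V] by (auto simp: S5_def)
    have c2: "conn (range (q i))" using conn_ray[of "q i" 0] q_ray by simp
    have c4: "conn (q 0 ` {k0..})" using conn_ray[of "q 0" k0] q_ray by simp
    have c34: "S3 \<inter> q 0 ` {k0..} \<noteq> {}"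
    proof -
      obtain j where "q 0 j \<in> S3" using S3(4) by auto
      moreover then have "\<not> j < k0" using S3(2) by auto
      ultimately show ?thesis by auto
    qed
    have "conn (S1 \<union> range (q i))" by (rule conn_Un[OF c1(1) c2]) (use c1 in auto)
    then have "conn (S1 \<union> range (q i) \<union> S3)" by (rule conn_Un[OF _ S3(1)]) (use S3 in auto)
    then have "conn (S1 \<union> range (q i) \<union> S3 \<union> q 0 ` {k0..})"
      by (rule conn_Un[OF _ c4]) (use c34 in auto)
    then have cS: "conn (S1 \<union> range (q i) \<union> S3 \<union> q 0 ` {k0..} \<union> S5)"
      by (rule conn_Un[OF _ c5(1)]) (use c5 k in auto)
    have far: "d (R n) v > W" if v: "v \<in> V" "level v > n + W" for v
      using level_tri[of "R n" v] v by simp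
    show "\<exists>S. conn S \<and> root \<in> S \<and> (\<exists>m>n + W. R m \<in> S) \<and> (\<forall>v\<in>S. d (R n) v > W)"
    proof (intro exI[of _ "S1 \<union> range (q i) \<union> S3 \<union> q 0 ` {k0..} \<union> S5"] conjI ballI)
      show "\<exists>m'>n + W. R m' \<in> S1 \<union> range (q i) \<union> S3 \<union> q 0 ` {k0..} \<union> S5"
        using c5 by (intro exI[of _ m]) (auto simp: m_def)
      fix v assume "v \<in> S1 \<union> range (q i) \<union> S3 \<union> q 0 ` {k0..} \<union> S5"
      then consider "v \<in> S1" | "v \<in> range (q i)" | "v \<in> S3" | "v \<in> q 0 ` {k0..}" | "v \<in> S5" by auto
      then show "d (R n) v > W"
      proof cases
        case 1
        then have "v \<in> V" "level v \<le> N0" using N0[OF i(1)] by (auto simp: S1_def geodesics_def level_def)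
        then show ?thesis using level_tri'[of "R n" v] n by simp
      next
        case 2
        then show ?thesis using i(2) q_V by auto
      next
        case 3
        then have vV: "v \<in> V" using conn_sub[OF S3(1)] by blast
        have "v \<notin> {v \<in> V. level v \<le> n + W}" using 3 S3(2) by blast
        then show ?thesis using far[OF vV] vV by simp
      next
        case 4
        then show ?thesis using far[of v] k0 q_V by auto
      next
        case 5
        then have v: "v \<in> V" "d (R m) v + d v (q 0 k) = d (R m) (q 0 k)" by (auto simp: S5_def geodesics_def)
        have "m + d (R m) (q 0 k) = level (q 0 k)" using k(2) R_lev[of m] by (auto simp: geodesics_def level_def)
        moreover have "level (q 0 k) \<le> level v + d v (q 0 k)" using level_tri v q_V by simp
        ultimately have "level v \<ge> m" using v by linarith
        then show ?thesis using far v by (simp add: m_def)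
      qed
    qed (use cS c1 in auto)
  qed
qed

abbreviation tube :: "nat \<Rightarrow> 'a set" where "tube h \<equiv> {v \<in> V. ray_dist v \<le> h}"

lemma conn_tube: "conn (tube h)"
  unfolding ray_dist_def using conn_nbhd[of "range R" h] conn_ray[of R 0] R_edge by simp

text \<open>Let \<open>S\<close> be a connected set from the root to a late vertex of \<open>R\<close> that avoids a large ball around
  \<open>R n\<close>. A vertex of \<open>S\<close> within distance \<open>h\<close> of \<open>R\<close> has level much less or much greater than \<open>n\<close>, or
  it would lie in the ball. So \<open>S\<close> gets from the low part of the tube to its high part through the
  outside, hence through a single component of the outside.\<close>
lemma wide_component:
  "\<exists>N. \<forall>n\<ge>N. \<exists>x\<in>V - tube h. \<exists>y1 y2.
     y1 \<in> boundary (component (V - tube h) x) \<and> level y1 + W < n \<and>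
     y2 \<in> boundary (component (V - tube h) x) \<and> n + W < level y2"
proof -
  obtain N0 where N0: "\<And>n. n \<ge> N0 \<Longrightarrow> \<exists>S. conn S \<and> root \<in> S
      \<and> (\<exists>m>n + (W + 2 * h + 1). R m \<in> S) \<and> (\<forall>v\<in>S. d (R n) v > W + 2 * h + 1)"
    using conn_avoiding_ball by meson
  let ?X = "tube h"
  show ?thesis
  proof (intro exI[of _ "N0 + W + 2"] allI impI)
    fix n assume n: "n \<ge> N0 + W + 2"
    then obtain S m where S: "conn S" "root \<in> S" "m > n + (W + 2 * h + 1)" "R m \<in> S"
      "\<And>v. v \<in> S \<Longrightarrow> d (R n) v > W + 2 * h + 1" using N0[of n] by auto
    let ?Lo = "{v \<in> ?X. level v + W + 1 < n}"
    let ?Hi = "{v \<in> ?X. n + W + 1 < level v}"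
    have split: "v \<in> ?Lo \<union> ?Hi" if v: "v \<in> S" "v \<in> ?X" for v
    proof (rule ccontr)
      assume neg: "v \<notin> ?Lo \<union> ?Hi"
      obtain k where k: "d (R k) v = ray_dist v" "k \<le> level v + ray_dist v" "level v \<le> k + ray_dist v"
        using ray_dist_foot v by blast
      have "d (R n) (R k) \<le> W + 1 + h"
      proof -
        have seg: "d (R a) (R (a + j)) \<le> j" for a j
        proof (induction j)
          case (Suc j)
          then show ?case using d_tri[of "R a" "R (a + j)" "R (a + Suc j)"] d_edge[OF R_edge[of "a + j"]]
            by simp
        qed simp
        have "d (R n) (R k) \<le> (if n \<le> k then k - n else n - k)"
          using seg[of n "k - n"] seg[of k "n - k"] d_sym[of "R n" "R k"] by auto
        then show ?thesis using k neg v by (auto split: if_splits)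
      qed
      moreover have "d (R n) v \<le> d (R n) (R k) + d (R k) v" using d_tri v by simp
      ultimately have "d (R n) v \<le> W + 1 + h + h" using k v by auto
      then show False using S(5)[OF v(1)] by simp
    qed
    show "\<exists>x\<in>V - ?X. \<exists>y1 y2. y1 \<in> boundary (component (V - ?X) x) \<and> level y1 + W < n
      \<and> y2 \<in> boundary (component (V - ?X) x) \<and> n + W < level y2"
    proof (rule ccontr)
      assume neg: "\<not> ?thesis"
      let ?A = "?Lo \<union> {v \<in> V - ?X. boundary (component (V - ?X) v) \<inter> ?Lo \<noteq> {}}"
      have "root \<in> ?A" using R_0 R_V[of 0] R_lev[of 0] ray_dist_le[of root 0] n by auto
      moreover have "R m \<notin> ?A" using S(3) ray_dist_le[of "R m" m] by auto
      ultimately obtain u v where uv: "(u, v) \<in> r" "u \<in> S \<inter> ?A" "v \<in> S - ?A"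
        using conn_crossing[OF S(1), of root ?A "R m"] S by blast
      have uV: "u \<in> V" "v \<in> V" using uv r_sub by auto
      have bd: "b \<in> boundary (component (V - ?X) a)" if "(a, b) \<in> r" "b \<in> ?X" "a \<in> V - ?X" for a b
        using that component_self[of a "V - ?X"] component_sub[of a "V - ?X"] unfolding boundary_def by blast
      show False
      proof (cases "u \<in> ?Lo")
        case True
        show False
        proof (cases "v \<in> ?X")
          case vX: True
          then have "v \<in> ?Hi" using split[of v] uv by blast
          then show False using True level_edge[OF uv(1)] by auto
        next
          case False
          then have "u \<in> boundary (component (V - ?X) v)" using bd[of v u] uv r_sym True uV by blast
          then show False using True uv False uV by blast
        qed
      next
        case False
        then have u: "u \<in> V - ?X" "boundary (component (V - ?X) u) \<inter> ?Lo \<noteq> {}" using uv by blast+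
        show False
        proof (cases "v \<in> ?X")
          case True
          then have "v \<in> ?Hi" using split[of v] uv by blast
          moreover have "v \<in> boundary (component (V - ?X) u)" using bd[OF uv(1) True u(1)] .
          moreover obtain y where "y \<in> boundary (component (V - ?X) u)" "y \<in> ?Lo" using u(2) by blast
          ultimately show False using neg u(1) by force
        next
          case vX: False
          have vc: "v \<in> component (V - ?X) u" using component_step[OF component_self u(1) uv(1)] vX uV by blast
          have "component (V - ?X) v = component (V - ?X) u"
          proof -
            have "(u, v) \<in> linked (V - ?X)" using vc by (simp add: component_def)
            then show ?thesis unfolding component_def using linked_sym linked_trans by blast
          qed
          then show False using u(2) uv(3) uV vX by auto
        qed
      qed
    qed
  qed
qed

abbreviation is_track :: "nat \<Rightarrow> nat \<Rightarrow> 'a set \<Rightarrow> 'a \<Rightarrow> 'a \<Rightarrow> bool" where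
  "is_track s lo T a b \<equiv> conn T \<and> (\<forall>v\<in>T. 7 * s \<le> ray_dist v \<and> ray_dist v \<le> 9 * s
    \<and> lo \<le> level v \<and> level v \<le> lo + 120 * s) \<and> a \<in> T \<and> level a = lo \<and> b \<in> T \<and> level b = lo + 120 * s"

text \<open>The boundary of a wide component has distance exactly \<open>8 * s\<close> from \<open>R\<close>, and by the bond lemma
  its \<open>\<kappa>\<close>-neighbourhood is connected. It begins below the prescribed band of levels and ends above
  it, so it can be truncated to the band. The width \<open>120 * s\<close> allows consecutive tracks, taken at
  steps of \<open>80 * s\<close>, to overlap in a band that is wide compared with their distance from \<open>R\<close>.\<close>
lemma track:
  assumes s: "\<kappa> \<le> s" "0 < s"
  shows "\<exists>N. \<forall>lo\<ge>N. \<exists>T a b. is_track s lo T a b"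
proof -
  let ?X = "tube (8 * s)"
  obtain N where N: "\<And>n. n \<ge> N \<Longrightarrow> \<exists>x\<in>V - ?X. \<exists>y1 y2.
     y1 \<in> boundary (component (V - ?X) x) \<and> level y1 + 120 * s < n \<and>
     y2 \<in> boundary (component (V - ?X) x) \<and> n + 120 * s < level y2" using wide_component by meson
  show ?thesis
  proof (intro exI[of _ N] allI impI)
    fix lo assume "lo \<ge> N"
    then obtain x y1 y2 where x: "x \<in> V - ?X"
      and y: "y1 \<in> boundary (component (V - ?X) x)" "level y1 + 120 * s < lo"
        "y2 \<in> boundary (component (V - ?X) x)" "lo + 120 * s < level y2" using N by blast
    let ?D = "component (V - ?X) x"
    let ?H = "{v \<in> V. \<exists>y\<in>boundary ?D. d y v \<le> \<kappa>}"
    have "R 0 \<in> ?X" using ray_dist_le[of "R 0" 0] by simp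
    then have Xne: "?X \<noteq> {}" by blast
    have "conn ?H"
      by (rule bond_nbhd_conn[OF gen component_conn[OF Diff_subset x] conn_compl_component[OF conn_tube Xne x]])
    have b: "y \<in> V \<and> ray_dist y = 8 * s" if y: "y \<in> boundary ?D" for y
    proof -
      have yX: "y \<in> ?X" using boundary_comp_not_in[OF x y] by auto
      obtain z where z: "z \<in> ?D" "(z, y) \<in> r" using y by (auto simp: boundary_def)
      then have zX: "z \<in> V" "8 * s < ray_dist z" using component_sub[OF x] by auto
      have "ray_dist z \<le> ray_dist y + d z y" using ray_dist_tri' zX yX by auto
      then show ?thesis using d_edge[OF z(2)] zX yX by auto
    qed
    have bH: "y' \<in> ?H" if y': "y' \<in> boundary ?D" for y'
      using b[OF y'] y' d_refl[of y'] by force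
    then obtain T a c where T: "conn T" "T \<subseteq> ?H" "\<And>v. v \<in> T \<Longrightarrow> lo \<le> level v \<and> level v \<le> lo + 120 * s"
      "a \<in> T" "level a = lo" "c \<in> T" "level c = lo + 120 * s"
      using conn_truncate[where f = level and H = "?H" and x = y1 and y = y2
          and lo = lo and hi = "lo + 120 * s", OF \<open>conn ?H\<close> level_edge bH[OF y(1)] _ bH[OF y(3)]] y s
      by auto
    have "7 * s \<le> ray_dist v \<and> ray_dist v \<le> 9 * s" if vT: "v \<in> T" for v
    proof -
      obtain y where y: "y \<in> boundary ?D" "d y v \<le> \<kappa>" "v \<in> V" using vT T(2) by blast
      then show ?thesis using b[OF y(1)] ray_dist_tri[of y v] ray_dist_tri'[of y v] s by auto
    qed
    then show "\<exists>T a b. is_track s lo T a b"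
      using T by (intro exI[of _ T] exI[of _ a] exI[of _ c]) auto
  qed
qed

end

section \<open>Two diverging connected sets\<close>

context thick_component
begin

text \<open>A connected set leading from \<open>x\<close> straight to the nearest vertex of \<open>R\<close>.\<close>
definition foot :: "'a \<Rightarrow> 'a set" where
  "foot x = geodesics x (R (SOME m. d (R m) x = ray_dist x \<and> m \<le> level x + ray_dist x \<and> level x \<le> m + ray_dist x))"

lemma foot:
  assumes x: "x \<in> V"
  shows foot_conn: "conn (foot x)" and foot_start: "x \<in> foot x"
    and foot_end: "\<exists>m. R m \<in> foot x \<and> m \<le> level x + ray_dist x \<and> level x \<le> m + ray_dist x"
    and foot_rad: "v \<in> foot x \<Longrightarrow> v \<in> V \<and> d x v + ray_dist v \<le> ray_dist x"
proof -
  obtain m where m: "foot x = geodesics x (R m)" "d (R m) x = ray_dist x" "m \<le> level x + ray_dist x" "level x \<le> m + ray_dist x"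
    using someI_ex[OF ray_dist_foot[OF x]] unfolding foot_def by blast
  show "conn (foot x)" "x \<in> foot x" using m(1) geodesics_conn geodesics_ends x by auto
  show "\<exists>m. R m \<in> foot x \<and> m \<le> level x + ray_dist x \<and> level x \<le> m + ray_dist x"
    using m geodesics_ends[OF x R_V[of m]] by auto
  show "v \<in> V \<and> d x v + ray_dist v \<le> ray_dist x" if "v \<in> foot x"
    using that m ray_dist_le[of v m] d_sym[of v "R m"] d_sym[of x "R m"] by (auto simp: geodesics_def)
qed

text \<open>What the first half of the proof provides. Boundaries contain vertices of arbitrarily high level, so
  they are infinite.\<close>
definition diverges :: "'a set \<Rightarrow> (nat \<Rightarrow> 'a set) \<Rightarrow> bool" where
  "diverges P C \<longleftrightarrow> conn P \<and> P \<noteq> {} \<and>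
    (\<forall>j. (\<exists>x\<in>V - nbhd P j. C j = component (V - nbhd P j) x) \<and> C (Suc j) \<subseteq> C j \<and>
      (\<forall>m. \<exists>y\<in>boundary (C j). m < level y))"

lemma level_gap: "u \<in> V \<Longrightarrow> v \<in> V \<Longrightarrow> level u + k \<le> level v \<Longrightarrow> k \<le> d u v \<and> k \<le> d v u"
  using level_tri[of u v] d_sym[of u v] by simp

end

text \<open>The track \<open>T i\<close> occupies the levels from \<open>lo i\<close> to \<open>lo i + 120 * s i\<close> and overlaps \<open>T (Suc i)\<close> in the
  last \<open>40 * s i\<close> of them, while \<open>T i\<close> and \<open>T (Suc (Suc i))\<close> are separated by their levels. Two
  travellers go outwards, one on the tracks and one on \<open>R\<close>. In the overlap of \<open>T i\<close> and \<open>T (Suc i)\<close>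
  one of two things happens.

  If the two tracks come close, the first traveller jumps from one to the other and the second
  continues on \<open>R\<close>. If not, they change places: at the start of the overlap the traveller on \<open>R\<close>
  moves to the start of \<open>T (Suc i)\<close>, and at its end the traveller on \<open>T i\<close> moves down to the part of \<open>R\<close>
  that has become free. Each connection is local, so nothing that happens later can spoil the
  distance between the two.

  The scale changes by at most one per step, so that the constants of neighbouring tracks are
  comparable, and it is unbounded, so that the travellers diverge.\<close>
locale ladder = thick_component V r G root \<kappa> \<Delta> q
  for V :: "'a set" and r and G :: "'a ugraph" and root \<kappa> \<Delta> q +
  fixes s lo :: "nat \<Rightarrow> nat" and T :: "nat \<Rightarrow> 'a set" and a b :: "nat \<Rightarrow> 'a"
  assumes s_ge: "9 \<le> s i"
    and s_step: "s (Suc i) = s i \<or> s (Suc i) = Suc (s i)"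
    and s_unb: "\<exists>i. j < s i"
    and lo_step: "lo (Suc i) = lo i + 80 * s i"
    and lo_ge: "20 * s i + i \<le> lo i"
    and T_conn: "conn (T i)"
    and T_bounds: "v \<in> T i \<Longrightarrow> 7 * s i \<le> ray_dist v \<and> ray_dist v \<le> 9 * s i \<and> lo i \<le> level v
      \<and> level v \<le> lo i + 120 * s i"
    and a: "a i \<in> T i" "level (a i) = lo i"
    and b: "b i \<in> T i" "level (b i) = lo i + 120 * s i"
begin

lemma T_V: "v \<in> T i \<Longrightarrow> v \<in> V" using T_conn conn_sub by blast

lemma s_mono: "i \<le> j \<Longrightarrow> s i \<le> s j"
proof (rule lift_Suc_mono_le[of s])
  show "s n \<le> s (Suc n)" for n using s_step[of n] by auto
qed

lemma s_next: "s i \<le> s (Suc i)" "s (Suc i) \<le> Suc (s i)" using s_step[of i] by auto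

lemma lo_mono: "i \<le> j \<Longrightarrow> lo i \<le> lo j"
  by (rule lift_Suc_mono_le[of lo]) (use lo_step in auto)

definition close :: "nat \<Rightarrow> bool" where
  "close i \<longleftrightarrow> (\<exists>x\<in>T i. \<exists>y\<in>T (Suc i). d x y \<le> 5 * s i)"

abbreviation joins :: "nat \<Rightarrow> 'a set \<Rightarrow> bool" where
  "joins i J \<equiv> conn J \<and> J \<inter> T i \<noteq> {} \<and> J \<inter> T (Suc i) \<noteq> {} \<and>
     (\<forall>v\<in>J. (\<exists>x\<in>T i. d x v \<le> 5 * s i) \<and> (\<exists>y\<in>T (Suc i). d v y \<le> 5 * s i))"

text \<open>A set that joins the two tracks if they are close; it exists then by the next lemma.\<close>
definition jump :: "nat \<Rightarrow> 'a set" where "jump i = (SOME J. joins i J)"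

lemma jump:
  assumes "close i"
  shows jump_conn: "conn (jump i)" and jump_meets: "jump i \<inter> T i \<noteq> {}" "jump i \<inter> T (Suc i) \<noteq> {}"
    and jump_near: "v \<in> jump i \<Longrightarrow> v \<in> V \<and> (\<exists>x\<in>T i. d x v \<le> 5 * s i) \<and> (\<exists>y\<in>T (Suc i). d v y \<le> 5 * s i)"
proof -
  obtain x y where xy: "x \<in> T i" "y \<in> T (Suc i)" "d x y \<le> 5 * s i"
    using assms by (auto simp: close_def)
  have xyV: "x \<in> V" "y \<in> V" using xy T_V by auto
  have "joins i (geodesics x y)"
  proof (intro conjI ballI)
    show "conn (geodesics x y)" using geodesics_conn xyV by simp
    show "geodesics x y \<inter> T i \<noteq> {}" "geodesics x y \<inter> T (Suc i) \<noteq> {}" using geodesics_ends[OF xyV] xy by auto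
    fix v assume "v \<in> geodesics x y"
    then have "d x v + d v y = d x y" by (simp add: geodesics_def)
    then have "d x v \<le> 5 * s i" "d v y \<le> 5 * s i" using xy(3) by auto
    then show "\<exists>x\<in>T i. d x v \<le> 5 * s i" "\<exists>y\<in>T (Suc i). d v y \<le> 5 * s i" using xy by blast+
  qed
  from someI[of "\<lambda>J. joins i J", OF this]
  have J: "joins i (jump i)"
    unfolding jump_def .
  then show "conn (jump i)" "jump i \<inter> T i \<noteq> {}" "jump i \<inter> T (Suc i) \<noteq> {}" by auto
  show "v \<in> V \<and> (\<exists>x\<in>T i. d x v \<le> 5 * s i) \<and> (\<exists>y\<in>T (Suc i). d v y \<le> 5 * s i)" if "v \<in> jump i"
    using that J conn_sub by blast
qed

text \<open>The ray is entered at stage \<open>Suc i\<close> where a foot from the end of \<open>T i\<close> can land, namely within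
  \<open>9 * s i\<close> of the index \<open>lo (Suc i) + 40 * s i\<close>.\<close>
fun ray_start :: "nat \<Rightarrow> nat" where
  "ray_start 0 = lo 0"
| "ray_start (Suc i) = lo (Suc i) + 30 * s i"

lemma ray_start_bounds: "lo i \<le> ray_start i" "ray_start i \<le> lo i + 30 * s i"
  using s_next by (cases i; simp)+

definition ray_part :: "nat \<Rightarrow> 'a set" where "ray_part i = R ` {ray_start i..lo (Suc i) + 10 * s i}"
definition ray_link :: "nat \<Rightarrow> 'a set" where "ray_link i = R ` {lo (Suc i) + 10 * s i..lo (Suc i) + 30 * s i}"
definition foot_in :: "nat \<Rightarrow> 'a set" where "foot_in i = foot (a (Suc i))"
definition foot_out :: "nat \<Rightarrow> 'a set" where "foot_out i = foot (b i)"

lemma aV: "a i \<in> V" and bV: "b i \<in> V" using a(1) b(1) T_V by blast+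

lemma foot_in_bounds:
  assumes "v \<in> foot_in i"
  shows "v \<in> V" "d (a (Suc i)) v + ray_dist v \<le> 9 * s (Suc i)"
    "level v \<le> lo (Suc i) + 9 * s (Suc i)" "lo (Suc i) \<le> level v + 9 * s (Suc i)"
proof -
  have v: "v \<in> V" "d (a (Suc i)) v + ray_dist v \<le> ray_dist (a (Suc i))"
    using foot_rad[OF aV] assms by (auto simp: foot_in_def)
  moreover have "ray_dist (a (Suc i)) \<le> 9 * s (Suc i)" using T_bounds a by auto
  ultimately show "v \<in> V" "d (a (Suc i)) v + ray_dist v \<le> 9 * s (Suc i)" by auto
  then show "level v \<le> lo (Suc i) + 9 * s (Suc i)" "lo (Suc i) \<le> level v + 9 * s (Suc i)"
    using level_tri[OF aV v(1), of "Suc i"] level_tri'[OF aV v(1), of "Suc i"] a(2)[of "Suc i"] by auto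
qed

lemma foot_out_bounds:
  assumes "v \<in> foot_out i"
  shows "v \<in> V" "d (b i) v + ray_dist v \<le> 9 * s i"
    "level v \<le> lo (Suc i) + 49 * s i" "lo (Suc i) + 31 * s i \<le> level v"
proof -
  have v: "v \<in> V" "d (b i) v + ray_dist v \<le> ray_dist (b i)"
    using foot_rad[OF bV] assms by (auto simp: foot_out_def)
  moreover have "ray_dist (b i) \<le> 9 * s i" using T_bounds b by auto
  ultimately show "v \<in> V" "d (b i) v + ray_dist v \<le> 9 * s i" by auto
  then show "level v \<le> lo (Suc i) + 49 * s i" "lo (Suc i) + 31 * s i \<le> level v"
    using level_tri[OF bV v(1), of "i"] level_tri'[OF bV v(1), of "i"] b(2)[of "i"] lo_step[of i] by auto
qed

lemma jump_bounds:
  assumes "close i" "v \<in> jump i"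
  shows "v \<in> V" "2 * s i \<le> ray_dist v" "level v \<le> lo (Suc i) + 45 * s i" "lo (Suc i) \<le> level v + 5 * s i"
proof -
  obtain x y where xy: "v \<in> V" "x \<in> T i" "d x v \<le> 5 * s i" "y \<in> T (Suc i)" "d v y \<le> 5 * s i"
    using jump_near[OF assms] by auto
  have V: "x \<in> V" "y \<in> V" using xy T_V by auto
  show "v \<in> V" by fact
  show "2 * s i \<le> ray_dist v" using ray_dist_tri'[OF V(1) xy(1)] T_bounds[OF xy(2)] xy by auto
  show "level v \<le> lo (Suc i) + 45 * s i"
    using level_tri[OF V(1) xy(1)] T_bounds[OF xy(2)] xy lo_step[of i] by auto
  show "lo (Suc i) \<le> level v + 5 * s i"
    using level_tri[OF xy(1) V(2)] T_bounds[OF xy(4)] xy by auto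
qed

text \<open>What a traveller uses in stage \<open>i\<close>, including the connection to the next stage; the flag tells
  whether the traveller is on the track or on the ray.\<close>
definition piece :: "nat \<Rightarrow> bool \<Rightarrow> 'a set" where
  "piece i t = (if t then T i \<union> (if close i then jump i else foot_out i)
    else ray_part i \<union> (if close i then ray_link i else foot_in i))"

lemma piece_conn: "conn (piece i t)"
proof -
  have R1: "conn (ray_part i)" "conn (ray_link i)" unfolding ray_part_def ray_link_def using conn_ray_segment R_edge by auto
  consider "t" "close i" | "t" "\<not> close i" | "\<not> t" "close i" | "\<not> t" "\<not> close i" by blast
  then show ?thesis
  proof cases
    case 1
    then have "conn (T i \<union> jump i)"
      by (intro conn_Un T_conn) (use jump_conn[OF 1(2)] jump_meets[OF 1(2)] in auto)
    then show ?thesis using 1 by (simp add: piece_def)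
  next
    case 2
    have "conn (T i \<union> foot_out i)"
      unfolding foot_out_def using b(1)[of i] foot_start[OF bV, of i]
      by (intro conn_Un[OF T_conn foot_conn[OF bV]]) blast
    then show ?thesis using 2 by (simp add: piece_def)
  next
    case 3
    have "R (lo (Suc i) + 10 * s i) \<in> ray_part i \<inter> ray_link i"
      unfolding ray_part_def ray_link_def using ray_start_bounds(2)[of i] lo_step[of i] by auto
    then have "conn (ray_part i \<union> ray_link i)" using R1 by (intro conn_Un) auto
    then show ?thesis using 3 by (simp add: piece_def)
  next
    case 4
    obtain m where m: "R m \<in> foot_in i" "m \<le> level (a (Suc i)) + ray_dist (a (Suc i))"
      "level (a (Suc i)) \<le> m + ray_dist (a (Suc i))"
      using foot_end[OF aV] unfolding foot_in_def by blast
    have "ray_dist (a (Suc i)) \<le> 9 * s (Suc i)" using T_bounds a by auto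
    then have "m \<le> lo (Suc i) + 10 * s i" "lo (Suc i) \<le> m + 10 * s i"
      using m a(2)[of "Suc i"] s_next[of i] s_ge[of i] by auto
    then have "R m \<in> ray_part i" unfolding ray_part_def using ray_start_bounds(2)[of i] lo_step[of i] by auto
    then have "conn (ray_part i \<union> foot_in i)"
      using R1 m foot_conn[OF aV] by (intro conn_Un) (auto simp: foot_in_def)
    then show ?thesis using 4 by (simp add: piece_def)
  qed
qed

text \<open>A role is kept if the tracks are close and changed otherwise, so the new role is \<open>t = close i\<close>.\<close>
lemma piece_meets: "piece i t \<inter> piece (Suc i) (t = close i) \<noteq> {}"
proof -
  consider "t" "close i" | "t" "\<not> close i" | "\<not> t" "close i" | "\<not> t" "\<not> close i" by blast
  then show ?thesis
  proof cases
    case 1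
    then show ?thesis using jump_meets(2)[of i] by (auto simp: piece_def)
  next
    case 2
    obtain m where m: "R m \<in> foot_out i" using foot_end[OF bV] unfolding foot_out_def by blast
    have "R m \<in> ray_part (Suc i)" unfolding ray_part_def
      using foot_out_bounds(3,4)[OF m] lo_step[of "Suc i"] s_next[of i] by auto
    then show ?thesis using m 2 by (auto simp: piece_def)
  next
    case 3
    have "R (lo (Suc i) + 30 * s i) \<in> ray_link i \<inter> ray_part (Suc i)"
      unfolding ray_part_def ray_link_def using lo_step[of "Suc i"] s_next[of i] by auto
    then show ?thesis using 3 by (auto simp: piece_def)
  next
    case 4
    then show ?thesis using foot_start[OF aV, of "Suc i"] a(1)[of "Suc i"]
      by (auto simp: piece_def foot_in_def)
  qed
qed

lemma piece_V: "v \<in> piece i t \<Longrightarrow> v \<in> V" using piece_conn conn_sub by blast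

lemma piece_lev: assumes "v \<in> piece i t" shows "lo i \<le> level v \<and> level v \<le> lo (Suc i) + 50 * s i"
proof -
  have "v \<in> T i \<or> (close i \<and> v \<in> jump i) \<or> v \<in> foot_out i \<or> v \<in> ray_part i \<or> v \<in> ray_link i \<or> v \<in> foot_in i"
    using assms by (auto simp: piece_def split: if_splits)
  then show ?thesis
    using T_bounds[of v i] jump_bounds[of i v] foot_out_bounds[of v i] foot_in_bounds[of v i] lo_step[of i] s_next[of i]
      s_ge[of i] ray_start_bounds[of i]
    by (elim disjE conjE) (auto simp: ray_part_def ray_link_def)
qed

lemma dist_R: "v \<in> range R \<Longrightarrow> ray_dist u \<le> d u v \<and> ray_dist u \<le> d v u"
  using ray_dist_le d_sym by fastforce

lemma T_R: "u \<in> T i \<Longrightarrow> v \<in> range R \<Longrightarrow> s i \<le> d u v"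
  using dist_R[of v u] T_bounds[of u i] by auto

lemma jump_R: "close i \<Longrightarrow> u \<in> jump i \<Longrightarrow> v \<in> range R \<Longrightarrow> s i \<le> d u v"
  using dist_R[of v u] jump_bounds[of i u] by auto

lemma ray_part_range: "v \<in> ray_part i \<Longrightarrow> v \<in> range R" and ray_link_range: "v \<in> ray_link i \<Longrightarrow> v \<in> range R"
  by (auto simp: ray_part_def ray_link_def)

text \<open>The foot of the new track passes the old one at a safe distance. A point \<open>u\<close> of the foot that is
  within \<open>s i\<close> of a vertex \<open>v\<close> of the old track is more than \<open>4 * s i\<close> away from the start of the foot,
  since the tracks are not close, and more than \<open>6 * s i\<close> away from \<open>R\<close>, since \<open>v\<close> is at distance at
  least \<open>7 * s i\<close> from \<open>R\<close>. But the whole foot has length at most \<open>9 * s (Suc i)\<close>.\<close>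
lemma far_foot_in_T:
  assumes "\<not> close i" "u \<in> foot_in i" "v \<in> T i"
  shows "s i \<le> d v u"
proof (rule ccontr)
  assume "\<not> ?thesis"
  moreover have V: "u \<in> V" "v \<in> V" using foot_in_bounds assms T_V by auto
  moreover have "5 * s i < d v (a (Suc i))" using assms a unfolding close_def by force
  moreover have "d v (a (Suc i)) \<le> d v u + d u (a (Suc i))" using d_tri V aV by simp
  moreover have "ray_dist v \<le> ray_dist u + d v u" using ray_dist_tri' V by simp
  moreover have "7 * s i \<le> ray_dist v" using T_bounds assms by auto
  ultimately show False
    using foot_in_bounds(2)[OF assms(2)] d_sym[of u "a (Suc i)"] s_next[of i] s_ge[of i] by linarith
qed

lemma far_foot_out_T:
  assumes "\<not> close i" "u \<in> foot_out i" "v \<in> T (Suc i)"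
  shows "s i \<le> d u v"
proof (rule ccontr)
  assume "\<not> ?thesis"
  moreover have V: "u \<in> V" "v \<in> V" using foot_out_bounds assms T_V by auto
  moreover have "5 * s i < d (b i) v" using assms b unfolding close_def by force
  moreover have "d (b i) v \<le> d (b i) u + d u v" using d_tri V bV by simp
  moreover have "ray_dist v \<le> ray_dist u + d u v" using ray_dist_tri V by simp
  moreover have "7 * s (Suc i) \<le> ray_dist v" using T_bounds assms by auto
  ultimately show False
    using foot_out_bounds(2)[OF assms(2)] s_next[of i] s_ge[of i] by linarith
qed

text \<open>Opposite pieces are separated by the distance of the track from \<open>R\<close>, by the preceding lemmas on
  feet, or by their levels; the next lemma treats consecutive stages in the same way.\<close>
lemma piece_apart_same:
  assumes u: "u \<in> piece i True" and v: "v \<in> piece i False"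
  shows "s i \<le> d u v"
proof (cases "close i")
  case True
  then have "u \<in> T i \<or> u \<in> jump i" "v \<in> range R" using u v ray_part_range ray_link_range by (auto simp: piece_def)
  then show ?thesis using T_R jump_R True by blast
next
  case False
  then have u': "u \<in> T i \<or> u \<in> foot_out i" and v': "v \<in> ray_part i \<or> v \<in> foot_in i" using u v by (auto simp: piece_def)
  show ?thesis
  proof (cases "u \<in> T i")
    case True
    from v' show ?thesis
    proof
      assume "v \<in> ray_part i" then show ?thesis using T_R[OF True] ray_part_range by blast
    next
      assume "v \<in> foot_in i" then show ?thesis using far_foot_in_T[OF False _ True] by blast
    qed
  next
    case uT: False
    then have "lo (Suc i) + 31 * s i \<le> level u" using u' foot_out_bounds by auto
    moreover have "level v \<le> lo (Suc i) + 10 * s i"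
      using v'
    proof
      assume "v \<in> ray_part i" then show ?thesis by (auto simp: ray_part_def)
    next
      assume "v \<in> foot_in i" then show ?thesis using foot_in_bounds(3)[of v i] s_next[of i] s_ge[of i] by auto
    qed
    ultimately show ?thesis using level_gap[OF piece_V[OF v] piece_V[OF u], of "s i"] by auto
  qed
qed

lemma piece_apart_next:
  assumes u: "u \<in> piece i t" and v: "v \<in> piece (Suc i) (t \<noteq> close i)"
  shows "s i \<le> d u v"
proof -
  note gap = level_gap[OF piece_V[OF u] piece_V[OF v], of "s i"]
  have V: "u \<in> V" "v \<in> V" using piece_V u v by auto
  have st2: "lo (Suc (Suc i)) = lo (Suc i) + 80 * s (Suc i)" using lo_step by simp
  have Fv: "lo (Suc i) + 70 * s (Suc i) \<le> level v" if "v \<in> foot_in (Suc i)"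
    using foot_in_bounds(4)[OF that] st2 s_next(2)[of "Suc i"] s_ge[of "Suc i"] by linarith
  have Bv: "lo (Suc i) + 70 * s (Suc i) \<le> level v" if "v \<in> foot_out (Suc i)"
    using foot_out_bounds(4)[OF that] st2 by linarith
  have Jv: "lo (Suc i) + 70 * s (Suc i) \<le> level v" if "v \<in> jump (Suc i)" "close (Suc i)"
    using jump_bounds(4)[OF that(2,1)] st2 by linarith
  have Rv: "lo (Suc i) + 30 * s i \<le> level v" if "v \<in> ray_part (Suc i) \<or> v \<in> ray_link (Suc i)"
    using that st2 s_next[of i] by (auto simp: ray_part_def ray_link_def)
  show ?thesis
  proof (cases "close i")
    case cl: True
    show ?thesis
    proof (cases t)
      case True
      then have u': "u \<in> T i \<or> u \<in> jump i" and v': "v \<in> range R \<or> v \<in> foot_in (Suc i)"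
        using u v cl ray_part_range ray_link_range by (auto simp: piece_def split: if_splits)
      show ?thesis
      proof (cases "v \<in> range R")
        case True
        then show ?thesis using u' T_R jump_R cl by blast
      next
        case False
        have "level u \<le> lo (Suc i) + 45 * s i"
          using u' jump_bounds(3)[OF cl, of u] T_bounds[of u i] lo_step[of i] by auto
        then show ?thesis using gap Fv v' False s_next[of i] by auto
      qed
    next
      case False
      then have u': "u \<in> ray_part i \<or> u \<in> ray_link i"
        and v': "v \<in> T (Suc i) \<or> (close (Suc i) \<and> v \<in> jump (Suc i)) \<or> v \<in> foot_out (Suc i)"
        using u v cl by (auto simp: piece_def split: if_splits)
      have uR: "u \<in> range R" "level u \<le> lo (Suc i) + 30 * s i"
        using u' by (auto simp: ray_part_def ray_link_def)
      show ?thesis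
        using v'
      proof (elim disjE conjE)
        assume "v \<in> T (Suc i)"
        then show ?thesis using T_R[OF _ uR(1)] d_sym[of u v] s_next[of i] by fastforce
      qed (use uR gap Bv Jv s_next[of i] in auto)
    qed
  next
    case fr: False
    show ?thesis
    proof (cases t)
      case True
      then have u': "u \<in> T i \<or> u \<in> foot_out i"
        and v': "v \<in> T (Suc i) \<or> (close (Suc i) \<and> v \<in> jump (Suc i)) \<or> v \<in> foot_out (Suc i)"
        using u v fr by (auto simp: piece_def split: if_splits)
      have ul: "level u \<le> lo (Suc i) + 49 * s i"
        using u' foot_out_bounds(3)[of u i] T_bounds[of u i] lo_step[of i] by auto
      show ?thesis
        using v'
      proof (elim disjE conjE)
        assume vT: "v \<in> T (Suc i)"
        show ?thesis using u'
        proof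
          assume "u \<in> T i"
          then have "\<not> d u v \<le> 5 * s i" using fr vT unfolding close_def by blast
          then show ?thesis by simp
        qed (use far_foot_out_T[OF fr _ vT] in simp)
      qed (use ul gap Bv Jv s_next[of i] in auto)
    next
      case False
      then have u': "u \<in> ray_part i \<or> u \<in> foot_in i"
        and v': "v \<in> ray_part (Suc i) \<or> v \<in> ray_link (Suc i) \<or> v \<in> foot_in (Suc i)"
        using u v fr by (auto simp: piece_def split: if_splits)
      have ul: "level u \<le> lo (Suc i) + 10 * s i"
        using u' foot_in_bounds(3)[of u i] s_next[of i] s_ge[of i] by (auto simp: ray_part_def)
      have vl: "lo (Suc i) + 30 * s i \<le> level v"
        using v' Rv Fv s_next[of i] by fastforce
      show ?thesis using gap ul vl by auto
    qed
  qed
qed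

lemma piece_apart_far:
  assumes u: "u \<in> piece i t" and v: "v \<in> piece k t'" and ik: "Suc (Suc i) \<le> k"
  shows "s (k - 1) \<le> d u v"
proof -
  obtain k' where k: "k = Suc k'" using ik by (cases k) auto
  have "level u \<le> lo (Suc i) + 50 * s i" "lo k \<le> level v" using piece_lev u v by auto
  moreover have "lo (Suc i) \<le> lo k'" "s i \<le> s k'" using lo_mono s_mono ik k by auto
  ultimately show ?thesis using level_gap[OF piece_V[OF u] piece_V[OF v], of "s k'"] lo_step[of k'] k by auto
qed

text \<open>Whether \<open>P\<close> has the track in stage \<open>i\<close>; the other role belongs to \<open>Q\<close>.\<close>
fun on_track :: "nat \<Rightarrow> bool" where
  "on_track 0 = True"
| "on_track (Suc i) = (on_track i = close i)"

definition P :: "'a set" where "P = (\<Union>i\<in>{0..}. piece i (on_track i))"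

definition Q :: "nat \<Rightarrow> 'a set" where "Q i = piece i (\<not> on_track i)"

lemma P_conn: "conn P"
  unfolding P_def by (rule conn_chain) (use piece_conn piece_meets in auto)

lemma Q_meets: "Q i \<inter> Q (Suc i) \<noteq> {}"
proof -
  have "(\<not> on_track (Suc i)) = ((\<not> on_track i) = close i)" by auto
  then show ?thesis using piece_meets[of i "\<not> on_track i"] unfolding Q_def by simp
qed

lemma P_Q_apart:
  assumes "u \<in> P" "v \<in> Q k" "Suc i \<le> k"
  shows "s i \<le> d u v"
proof -
  obtain l where l: "u \<in> piece l (on_track l)" using assms by (auto simp: P_def)
  have v: "v \<in> piece k (\<not> on_track k)" using assms by (simp add: Q_def)
  consider "l = k" | "l = Suc k" | "k = Suc l" | "Suc (Suc k) \<le> l" | "Suc (Suc l) \<le> k" by linarith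
  then show ?thesis
  proof cases
    case 1
    have "s k \<le> d u v"
    proof (cases "on_track k")
      case True
      then show ?thesis using piece_apart_same[of u k v] l v 1 by simp
    next
      case False
      then show ?thesis using piece_apart_same[of v k u] l v 1 d_sym[of u v] by simp
    qed
    then show ?thesis using s_mono[of i k] assms by simp
  next
    case 2
    have "on_track l = ((\<not> on_track k) \<noteq> close k)" using 2 by auto
    then have "u \<in> piece (Suc k) ((\<not> on_track k) \<noteq> close k)" using l 2 by simp
    then have "s k \<le> d v u" by (rule piece_apart_next[OF v])
    then show ?thesis using s_mono[of i k] assms d_sym[of u v] by simp
  next
    case 3
    have "(\<not> on_track k) = (on_track l \<noteq> close l)" using 3 by auto
    then have "v \<in> piece (Suc l) (on_track l \<noteq> close l)" using v 3 by simp
    then have "s l \<le> d u v" by (rule piece_apart_next[OF l])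
    then show ?thesis using s_mono[of i l] assms 3 by simp
  next
    case 4
    then have "s (l - 1) \<le> d v u" using piece_apart_far[OF v l] by simp
    moreover have "s i \<le> s (l - 1)" using 4 assms by (intro s_mono) linarith
    ultimately show ?thesis using d_sym[of u v] by linarith
  next
    case 5
    then have "s (k - 1) \<le> d u v" using piece_apart_far[OF l v] by simp
    moreover have "s i \<le> s (k - 1)" using assms by (intro s_mono) linarith
    ultimately show ?thesis by linarith
  qed
qed

text \<open>From this stage on, \<open>Q\<close> is more than \<open>j\<close> away from all of \<open>P\<close>. The successor is needed since the
  pieces of stage \<open>k\<close> are compared with those of stage \<open>k - 1\<close>, whose scale may be smaller by one.\<close>
definition late :: "nat \<Rightarrow> nat" where "late j = Suc (LEAST i. j < s i)"

lemma late_mono: "late j \<le> late (Suc j)"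
proof -
  have "j < s (LEAST i. Suc j < s i)" using LeastI_ex[OF s_unb[of "Suc j"]] by simp
  then show ?thesis unfolding late_def by (simp add: Least_le)
qed

lemma P_ne: "P \<noteq> {}" using piece_meets[of 0 "on_track 0"] unfolding P_def by blast

lemma P_tube: "P \<subseteq> nbhd P j"
proof
  fix x assume "x \<in> P"
  then show "x \<in> nbhd P j" using dist_set_le[of x P x] P_conn conn_sub by auto
qed

lemma Q_tail: "(\<Union>k\<in>{late j..}. Q k) \<subseteq> V - nbhd P j"
proof
  fix v assume "v \<in> (\<Union>k\<in>{late j..}. Q k)"
  then obtain k where k: "late j \<le> k" "v \<in> Q k" by auto
  have "v \<in> V" using k piece_V by (auto simp: Q_def)
  moreover have "\<not> dist_set P v \<le> j"
  proof
    assume "dist_set P v \<le> j"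
    then obtain u where u: "u \<in> P" "d u v \<le> j" using dist_set_attained[OF P_ne, of v] by auto
    have "s (LEAST i. j < s i) \<le> d u v" by (rule P_Q_apart[OF u(1) k(2)]) (use k late_def in auto)
    moreover have "j < s (LEAST i. j < s i)" by (rule LeastI_ex[OF s_unb])
    ultimately show False using u by simp
  qed
  ultimately show "v \<in> V - nbhd P j" by simp
qed

text \<open>The component \<open>C j\<close> is the one that contains the tail of \<open>Q\<close> outside the \<open>j\<close>-neighbourhood of
  \<open>P\<close>; tails are nested, hence so are the components. For the boundary, a track together with a foot
  and a tail of \<open>R\<close> is a connected set of high levels which meets both \<open>P\<close> and \<open>Q\<close>.\<close>
lemma diverging_components: "\<exists>P C. diverges P C"
proof -
  have "\<forall>j. \<exists>x. x \<in> Q (late j)" using Q_meets by blast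
  then obtain x where x: "\<And>j. x j \<in> Q (late j)" by metis
  have xV: "x j \<in> V - nbhd P j" for j using Q_tail[of j] x[of j] by blast
  define C where "C j = component (V - nbhd P j) (x j)" for j
  have tail: "(\<Union>k\<in>{late j..}. Q k) \<subseteq> C j" for j
  proof -
    have "conn (\<Union>k\<in>{late j..}. Q k)" by (rule conn_chain) (use piece_conn Q_meets Q_def in auto)
    then show ?thesis unfolding C_def
      by (rule component_max[OF _ Q_tail, of _ "x j"]) (use x[of j] component_self in auto)
  qed
  have nested: "C (Suc j) \<subseteq> C j" for j
  proof -
    have "x (Suc j) \<in> C j" using tail[of j] x[of "Suc j"] late_mono[of j] by auto
    moreover have "conn (C (Suc j))" "C (Suc j) \<subseteq> V - nbhd P (Suc j)" "x (Suc j) \<in> C (Suc j)"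
      unfolding C_def using component_conn[OF Diff_subset xV] component_sub[OF xV] component_self by auto
    moreover from this have "C (Suc j) \<subseteq> V - nbhd P j" by auto
    ultimately show ?thesis unfolding C_def using component_max by blast
  qed
  have inf: "\<exists>y\<in>boundary (C j). m < level y" for j m
  proof -
    define k where "k = late j + m"
    let ?Z = "T k \<union> foot (a k) \<union> R ` {lo k - 9 * s k..}"
    have ak: "ray_dist (a k) \<le> 9 * s k" using T_bounds a by auto
    have "conn (T k \<union> foot (a k))"
      using a(1)[of k] foot_start[OF aV, of k] by (intro conn_Un[OF T_conn foot_conn[OF aV]]) blast
    then have Zc: "conn ?Z"
    proof (rule conn_Un)
      show "conn (R ` {lo k - 9 * s k..})" using conn_ray R_edge by auto
      obtain m where "R m \<in> foot (a k)" "level (a k) \<le> m + ray_dist (a k)" using foot_end[OF aV] by blast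
      then show "(T k \<union> foot (a k)) \<inter> R ` {lo k - 9 * s k..} \<noteq> {}" using ak a(2)[of k] by auto
    qed
    have Zl: "m < level v" if "v \<in> ?Z" for v
    proof -
      have "lo k \<le> level v + 9 * s k"
        using that
      proof (elim UnE)
        assume "v \<in> foot (a k)"
        then have "v \<in> V" "d (a k) v \<le> ray_dist (a k)" using foot_rad[OF aV] by fastforce+
        then show ?thesis using level_tri'[OF aV, of v k] a(2)[of k] ak by auto
      next
        assume "v \<in> T k"
        then show ?thesis using T_bounds[of v k] by simp
      qed auto
      then show ?thesis using lo_ge[of k] s_ge[of k] k_def by auto
    qed
    have 1: "a k \<in> piece k True" "a k \<in> ?Z" using a by (auto simp: piece_def)
    have 2: "R (lo (Suc k)) \<in> piece k False" "R (lo (Suc k)) \<in> ?Z"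
      using ray_start_bounds(2)[of k] lo_step[of k] by (auto simp: piece_def ray_part_def)
    have XP: "piece k (on_track k) \<subseteq> P" unfolding P_def by (rule UN_upper) simp
    obtain u v where u: "u \<in> ?Z" "u \<in> Q k" and v: "v \<in> ?Z" "v \<in> P"
    proof (cases "on_track k")
      case True
      then have "R (lo (Suc k)) \<in> Q k" "a k \<in> P" using 1 2 XP by (auto simp: Q_def)
      then show ?thesis using that 1(2) 2(2) by blast
    next
      case False
      then have "a k \<in> Q k" "R (lo (Suc k)) \<in> P" using 1 2 XP by (auto simp: Q_def)
      then show ?thesis using that 1(2) 2(2) by blast
    qed
    have "Q k \<subseteq> (\<Union>k\<in>{late j..}. Q k)" by (rule UN_upper) (simp add: k_def)
    then have "u \<in> C j" using tail[of j] u(2) by blast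
    moreover have "v \<notin> C j" using v(2) P_tube[of j] component_sub[OF xV, of j] by (auto simp: C_def)
    ultimately obtain w z where "(w, z) \<in> r" "w \<in> C j" "z \<in> ?Z - C j"
      using conn_crossing[OF Zc, of u "C j" v] u v by blast
    then have "z \<in> boundary (C j)" "m < level z" using Zl by (auto simp: boundary_def)
    then show ?thesis by blast
  qed
  show ?thesis unfolding diverges_def
    by (rule exI[of _ P], rule exI[of _ C])
       (use P_conn P_ne xV nested inf C_def in blast)
qed

end

context thick_component
begin

text \<open>The scale is raised at the first stage at which tracks of the next scale are available. If it
  were raised only finitely often, the levels \<open>lo i\<close> would grow past any threshold without
  raising it, a contradiction.\<close>
lemma ladder_exists: "\<exists>s lo T a b. ladder V r G root \<kappa> \<Delta> q s lo T a b"
proof -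
  have "\<forall>s. \<exists>N. \<kappa> + 9 \<le> s \<longrightarrow> (\<forall>lo\<ge>N. \<exists>T a b. is_track s lo T a b)"
    using track by auto
  then obtain N where N: "\<And>s lo. \<kappa> + 9 \<le> s \<Longrightarrow> N s \<le> lo \<Longrightarrow> \<exists>T a b. is_track s lo T a b"
    using choice[of "\<lambda>s N. \<kappa> + 9 \<le> s \<longrightarrow> (\<forall>lo\<ge>N. \<exists>T a b. is_track s lo T a b)"] by blast
  define s0 where "s0 = \<kappa> + 9"
  define f where "f = rec_nat (s0, N s0 + 20 * s0) (\<lambda>_ (s, lo).
      (if N (Suc s) \<le> lo + 80 * s then Suc s else s, lo + 80 * s))"
  define s where "s i = fst (f i)" for i
  define lo where "lo i = snd (f i)" for i
  have s0: "s 0 = s0" "lo 0 = N s0 + 20 * s0" by (auto simp: s_def lo_def f_def)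
  have lo_Suc: "lo (Suc i) = lo i + 80 * s i" for i by (auto simp: s_def lo_def f_def split: prod.split)
  have s_Suc: "s (Suc i) = (if N (Suc (s i)) \<le> lo (Suc i) then Suc (s i) else s i)" for i
    by (auto simp: s_def lo_def f_def split: prod.split)
  have s_ge: "s0 \<le> s i" for i by (induction i) (auto simp: s0 s_Suc)
  have lo_ge: "20 * s i + i \<le> lo i" for i
  proof (induction i)
    case (Suc i)
    then show ?case using s_ge[of i] by (auto simp: s_Suc lo_Suc s0_def)
  qed (simp add: s0)
  have N_le: "N (s i) \<le> lo i" for i
    by (induction i) (auto simp: s0 s_Suc lo_Suc)
  have unb: "\<exists>i. j < s i" for j
  proof (induction j)
    case 0
    show ?case using s_ge[of 0] by (auto simp: s0_def intro!: exI[of _ 0])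
  next
    case (Suc j)
    then obtain i where i: "j < s i" by auto
    show ?case
    proof (rule ccontr)
      assume neg: "\<nexists>i. Suc j < s i"
      have s_mono: "s i \<le> s k" if "i \<le> k" for i k
        by (rule lift_Suc_mono_le[of s]) (use that s_Suc in auto)
      have const: "s k = Suc j" if "k \<ge> i" for k
        using neg i s_mono[OF that] by (metis le_less_Suc_eq linorder_not_le order_less_le_trans Suc_leI le_antisym)
      define k where "k = i + N (Suc (Suc j))"
      have "N (Suc (Suc j)) \<le> lo (Suc k)" using lo_ge[of "Suc k"] by (simp add: k_def)
      then have "Suc j < s (Suc k)" using s_Suc[of k] const[of k] by (simp add: k_def)
      then show False using neg by blast
    qed
  qed
  have "\<forall>i. \<exists>T a b. is_track (s i) (lo i) T a b" using N N_le s_ge s0_def by simp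
  then obtain T where "\<forall>i. \<exists>a b. is_track (s i) (lo i) (T i) a b"
    using choice[of "\<lambda>i T. \<exists>a b. is_track (s i) (lo i) T a b"] by blast
  then obtain a where "\<forall>i. \<exists>b. is_track (s i) (lo i) (T i) (a i) b"
    using choice[of "\<lambda>i a. \<exists>b. is_track (s i) (lo i) (T i) a b"] by blast
  then obtain b where Tab: "\<And>i. is_track (s i) (lo i) (T i) (a i) (b i)"
    using choice[of "\<lambda>i b. is_track (s i) (lo i) (T i) (a i) b"] by blast
  have "ladder V r G root \<kappa> \<Delta> q s lo T a b"
  proof (unfold_locales, goal_cases)
    case (1 i) show ?case using s_ge[of i] by (simp add: s0_def)
  next
    case (2 i) show ?case using s_Suc by simp
  next
    case (3 j) show ?case by (rule unb)
  next
    case (4 i) show ?case by (rule lo_Suc)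
  next
    case (5 i) show ?case by (rule lo_ge)
  qed (use Tab in auto)
  then show ?thesis by blast
qed

lemma diverging_components: "\<exists>P C. diverges P C"
proof -
  obtain s lo T a b where "ladder V r G root \<kappa> \<Delta> q s lo T a b" using ladder_exists by blast
  then interpret ladder V r G root \<kappa> \<Delta> q s lo T a b .
  show ?thesis by (rule diverging_components)
qed

end

section \<open>A fat triangular grid\<close>

context conn_graph
begin

definition apart :: "nat \<Rightarrow> 'a set \<Rightarrow> 'a set \<Rightarrow> bool" where
  "apart K A B \<longleftrightarrow> (\<forall>a\<in>A. \<forall>b\<in>B. K \<le> d a b)"

lemma apart_sym: "apart K A B \<Longrightarrow> apart K B A"
  unfolding apart_def using d_sym by metis

text \<open>A \<open>K\<close>-fat model in which the branch paths are replaced by connected sets that meet the two branch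
  sets. Nothing is required about how they meet them, which makes such families easy to construct
  and to compose.\<close>
definition fat_sets :: "nat \<Rightarrow> 'x ugraph \<Rightarrow> ('x \<Rightarrow> 'a set) \<Rightarrow> ('x set \<Rightarrow> 'a set) \<Rightarrow> bool" where
  "fat_sets K X W S \<longleftrightarrow>
    (\<forall>x\<in>vertices X. conn (W x) \<and> W x \<noteq> {}) \<and>
    (\<forall>e\<in>edges X. conn (S e) \<and> (\<forall>x\<in>e. S e \<inter> W x \<noteq> {})) \<and>
    (\<forall>x\<in>vertices X. \<forall>y\<in>vertices X. x \<noteq> y \<longrightarrow> apart K (W x) (W y)) \<and>
    (\<forall>e\<in>edges X. \<forall>f\<in>edges X. e \<noteq> f \<longrightarrow> apart K (S e) (S f)) \<and>
    (\<forall>e\<in>edges X. \<forall>x\<in>vertices X. x \<notin> e \<longrightarrow> apart K (S e) (W x))"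

end

text \<open>Vertex \<open>(t, i)\<close> stands for column \<open>i\<close> at time \<open>t\<close>. A row of time \<open>t\<close> crosses only finitely many
  columns, which is why column \<open>i\<close> begins at time \<open>i\<close>.\<close>
definition triangle_grid :: "(nat \<times> nat) ugraph" where
  "triangle_grid = \<lparr>vertices = {(t, i). i \<le> t},
     edges = {{(t, i), (Suc t, i)} |t i. i \<le> t} \<union> {{(t, i), (t, Suc i)} |t i. Suc i \<le> t}\<rparr>"

text \<open>The outcome of the previous section. The distance from \<open>P\<close> is the horizontal coordinate of the
  grid, the level is the vertical one; both are Lipschitz.\<close>
locale diverging = thick_component V r G root \<kappa> \<Delta> q
  for V :: "'a set" and r and G :: "'a ugraph" and root \<kappa> \<Delta> q +
  fixes P :: "'a set" and C :: "nat \<Rightarrow> 'a set" and K :: nat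
  assumes diverges: "diverges P C"
begin

lemma P: "conn P" "P \<noteq> {}"
  and C_comp: "\<exists>x\<in>V - nbhd P j. C j = component (V - nbhd P j) x"
  and C_Suc: "C (Suc j) \<subseteq> C j"
  and C_unb: "\<exists>y\<in>boundary (C j). m < level y"
  using diverges unfolding diverges_def by blast+

abbreviation lam :: "'a \<Rightarrow> nat" where "lam v \<equiv> dist_set P v"

lemma lam_tri: "u \<in> V \<Longrightarrow> v \<in> V \<Longrightarrow> lam v \<le> lam u + d u v"
  using dist_set_tri P conn_sub by blast

lemma lam_tri': "u \<in> V \<Longrightarrow> v \<in> V \<Longrightarrow> lam u \<le> lam v + d u v"
  using lam_tri[of v u] d_sym[of u v] by simp

lemma C_mono: "i \<le> j \<Longrightarrow> C j \<subseteq> C i"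
  by (rule lift_Suc_antimono_le[of C]) (use C_Suc in auto)

lemma C_conn: "conn (C j)"
  using C_comp[of j] component_conn[OF Diff_subset] by metis

lemma C_lam: "v \<in> C j \<Longrightarrow> v \<in> V \<and> j < lam v"
  using C_comp[of j] component_sub[of _ "V - nbhd P j"] by fastforce

lemma C_step: "u \<in> C j \<Longrightarrow> (u, v) \<in> r \<Longrightarrow> j < lam v \<Longrightarrow> v \<in> C j"
  using C_comp[of j] component_step[of u "V - nbhd P j" _ v] r_sub by fastforce

lemma compl_C_conn: "conn (V - C j)"
proof -
  obtain p where "p \<in> P" using P by auto
  then have "p \<in> nbhd P j" using dist_set_le[of p P p] P(1) conn_sub by auto
  then have "nbhd P j \<noteq> {}" by blast
  then show ?thesis
    using C_comp[of j] conn_compl_component[OF conn_nbhd[OF P, of j]] by metis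
qed

text \<open>A neighbour of a vertex outside the \<open>j\<close>-neighbourhood of \<open>P\<close> cannot be closer to \<open>P\<close> than \<open>j\<close>.\<close>
lemma boundary_C: assumes "y \<in> boundary (C j)" shows "y \<in> V \<and> lam y = j"
proof -
  obtain x where x: "x \<in> C j" "(x, y) \<in> r" "y \<notin> C j" using assms by (auto simp: boundary_def)
  have yV: "y \<in> V" using x r_sub by auto
  have "lam y \<le> j" using C_step[OF x(1,2)] x(3) by (meson not_le)
  moreover have "lam x \<le> lam y + d x y" using lam_tri' C_lam x yV by blast
  ultimately show ?thesis using C_lam[OF x(1)] d_edge[OF x(2)] yV by auto
qed

text \<open>A column has distance at most \<open>M\<close> from the distance \<open>\<rho> i\<close> prescribed for it; the gap \<open>10 * M\<close> leaves
  room for branch paths of rows that are far from each other and from the other columns.\<close>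
definition M :: nat where "M = K + \<kappa> + 1"
definition \<rho> :: "nat \<Rightarrow> nat" where "\<rho> i = 10 * M * (i + 1)"

lemma rho_less: "i < j \<Longrightarrow> \<rho> i + 10 * M \<le> \<rho> j"
  unfolding \<rho>_def using mult_le_mono2[of "Suc i + 1" "j + 1" "10 * M"] by (simp add: algebra_simps)

lemma rho_mono: "i \<le> j \<Longrightarrow> \<rho> i \<le> \<rho> j"
  unfolding \<rho>_def by simp

definition column :: "nat \<Rightarrow> 'a set" where "column i = {v \<in> V. \<exists>y\<in>boundary (C (\<rho> i)). d y v \<le> \<kappa>}"

lemma column_conn: "conn (column i)"
  unfolding column_def by (rule bond_nbhd_conn[OF gen C_conn compl_C_conn])

lemma column_lam: "v \<in> column i \<Longrightarrow> v \<in> V \<and> lam v \<le> \<rho> i + M \<and> \<rho> i \<le> lam v + M"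
proof -
  assume "v \<in> column i"
  then obtain y where y: "v \<in> V" "y \<in> boundary (C (\<rho> i))" "d y v \<le> \<kappa>" by (auto simp: column_def)
  then show ?thesis
    using boundary_C[OF y(2)] lam_tri[of y v] lam_tri'[of y v] by (auto simp: M_def)
qed

lemma boundary_column: "y \<in> boundary (C (\<rho> i)) \<Longrightarrow> y \<in> column i"
  using boundary_C[of y "\<rho> i"] d_refl[of y] unfolding column_def by force

text \<open>The row is a geodesic to \<open>P\<close> from a vertex of the boundary of \<open>C (\<rho> k)\<close>, numbered by the distance
  from \<open>P\<close>. As long as this distance exceeds \<open>\<rho> i\<close> the geodesic cannot leave \<open>C (\<rho> i)\<close>, so it
  arrives at distance \<open>\<rho> i\<close> in the boundary of \<open>C (\<rho> i)\<close>. Its first vertex has level at least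
  \<open>\<rho> k + k\<close>, and levels drop by at most one per step.\<close>
lemma row_exists:
  "\<exists>f. (\<forall>j\<le>\<rho> k. f j \<in> V \<and> lam (f j) = j \<and> k \<le> level (f j)) \<and>
       (\<forall>j<\<rho> k. (f j, f (Suc j)) \<in> r) \<and> (\<forall>i\<le>k. f (\<rho> i) \<in> boundary (C (\<rho> i)))"
proof -
  obtain z where z: "z \<in> boundary (C (\<rho> k))" "\<rho> k + k < level z" using C_unb by blast
  have zV: "z \<in> V" "lam z = \<rho> k" using boundary_C z by auto
  obtain p where p: "p \<in> P" "d p z = \<rho> k" using dist_set_attained[OF P(2), of z] zV by auto
  have pV: "p \<in> V" using p P conn_sub by auto
  obtain f where f: "f 0 = p" "f (\<rho> k) = z" "\<And>j. j < \<rho> k \<Longrightarrow> (f j, f (Suc j)) \<in> r"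
    using d_walk[OF pV zV(1)] p(2) by (auto simp: relpow_fun_conv)
  have walk: "(f j, f (j + m)) \<in> r ^^ m" if "j + m \<le> \<rho> k" for j m
    using that
  proof (induction m)
    case (Suc m)
    then show ?case using f(3)[of "j + m"] by auto
  qed simp
  have fV: "f j \<in> V" if "j \<le> \<rho> k" for j
  proof (cases "j = 0")
    case False
    then obtain j' where "j = Suc j'" by (cases j) auto
    then show ?thesis using f(3)[of j'] that r_sub by auto
  qed (use f pV in simp)
  have flam: "lam (f j) = j" and flev: "k \<le> level (f j)" if j: "j \<le> \<rho> k" for j
  proof -
    have "d (f j) z \<le> \<rho> k - j" using d_le walk[of j "\<rho> k - j"] f(2) j by fastforce
    moreover have "d p (f j) \<le> j" using d_le walk[of 0 j] f(1) j by fastforce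
    moreover have "lam (f j) \<le> d p (f j)" using dist_set_le p by simp
    moreover have "lam z \<le> lam (f j) + d (f j) z" by (rule lam_tri[OF fV[OF j] zV(1)])
    moreover have "level z \<le> level (f j) + d (f j) z" by (rule level_tri[OF fV[OF j] zV(1)])
    ultimately show "lam (f j) = j" "k \<le> level (f j)" using zV z(2) j by auto
  qed
  have "f (\<rho> i) \<in> boundary (C (\<rho> i))" if i: "i \<le> k" for i
  proof (cases "i = k")
    case True
    then show ?thesis using z f by simp
  next
    case False
    then have ik: "\<rho> i < \<rho> k" using i rho_less[of i k] by (simp add: M_def)
    obtain w where w: "w \<in> C (\<rho> k)" "(w, z) \<in> r" using z by (auto simp: boundary_def)
    have z_in: "z \<in> C (\<rho> i)"
      using C_step[of w "\<rho> i" z] C_mono[of "\<rho> i" "\<rho> k"] w ik zV by auto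
    have "f (\<rho> k - m) \<in> C (\<rho> i)" if "m < \<rho> k - \<rho> i" for m
      using that
    proof (induction m)
      case 0
      then show ?case using z_in f by simp
    next
      case (Suc m)
      then have "(f (\<rho> k - Suc m), f (\<rho> k - m)) \<in> r" using f(3)[of "\<rho> k - Suc m"] by (simp add: Suc_diff_Suc)
      then show ?case using C_step[of "f (\<rho> k - m)" "\<rho> i" "f (\<rho> k - Suc m)"] Suc r_sym
        flam[of "\<rho> k - Suc m"] by auto
    qed
    from this[of "\<rho> k - Suc (\<rho> i)"] have "f (Suc (\<rho> i)) \<in> C (\<rho> i)" using ik by auto
    moreover have "(f (Suc (\<rho> i)), f (\<rho> i)) \<in> r" using f(3)[OF ik] r_sym by simp
    moreover have "f (\<rho> i) \<notin> C (\<rho> i)" using C_lam[of "f (\<rho> i)" "\<rho> i"] flam[of "\<rho> i"] ik by auto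
    ultimately show ?thesis by (auto simp: boundary_def)
  qed
  then show ?thesis using fV flam flev f(3) by (intro exI[of _ f]) auto
qed

definition row :: "nat \<Rightarrow> nat \<Rightarrow> 'a" where
  "row k = (SOME f. (\<forall>j\<le>\<rho> k. f j \<in> V \<and> lam (f j) = j \<and> k \<le> level (f j)) \<and>
       (\<forall>j<\<rho> k. (f j, f (Suc j)) \<in> r) \<and> (\<forall>i\<le>k. f (\<rho> i) \<in> boundary (C (\<rho> i))))"

lemma row:
  shows row_point: "j \<le> \<rho> k \<Longrightarrow> row k j \<in> V \<and> lam (row k j) = j \<and> k \<le> level (row k j)"
    and row_edge: "j < \<rho> k \<Longrightarrow> (row k j, row k (Suc j)) \<in> r"
    and row_boundary: "i \<le> k \<Longrightarrow> row k (\<rho> i) \<in> boundary (C (\<rho> i))"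
  using someI_ex[OF row_exists[of k]] unfolding row_def by blast+

text \<open>The crossings of the rows \<open>k\<close> and \<open>k'\<close> with column \<open>i\<close> are linked in the column above level \<open>w\<close>.\<close>
definition joined :: "nat \<Rightarrow> nat \<Rightarrow> nat \<Rightarrow> nat \<Rightarrow> bool" where
  "joined i w k k' \<longleftrightarrow> i \<le> k \<and> (row k (\<rho> i), row k' (\<rho> i)) \<in> linked (column i \<inter> {v. w \<le> level v})"

text \<open>Unless the column lies above level \<open>w\<close> entirely, each of its parts above level \<open>w\<close> has a vertex of
  level \<open>w\<close>. There are finitely many such vertices, so infinitely many crossings are linked to the
  same one.\<close>
lemma joined_infinite:
  assumes "infinite I"
  shows "\<exists>J\<subseteq>I. infinite J \<and> (\<forall>k\<in>J. \<forall>k'\<in>J. joined i w k k')"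
proof -
  define I' where "I' = {k \<in> I. max i w \<le> k}"
  have "I \<subseteq> I' \<union> {..max i w}" by (auto simp: I'_def)
  then have infI: "infinite I'" using assms finite_subset by blast
  let ?A = "column i \<inter> {v. w \<le> level v}"
  have x: "row k (\<rho> i) \<in> ?A" "i \<le> k" if "k \<in> I'" for k
    using that row_boundary[of i k] boundary_column row_point[of "\<rho> i" k] rho_mono[of i k] by (force simp: I'_def)+
  show ?thesis
  proof (cases "column i \<subseteq> {v. w \<le> level v}")
    case True
    then have "joined i w k k'" if "k \<in> I'" "k' \<in> I'" for k k'
      using x that conn_linked[OF column_conn, of "row k (\<rho> i)" i "row k' (\<rho> i)" ?A] by (auto simp: joined_def)
    then show ?thesis using infI by (intro exI[of _ I']) (auto simp: I'_def)
  next
    case False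
    then obtain h where h: "h \<in> column i" "\<not> w \<le> level h" by auto
    have "\<exists>u. level u \<le> w \<and> u \<in> V \<and> (row k (\<rho> i), u) \<in> linked ?A" if k: "k \<in> I'" for k
    proof -
      have "(row k (\<rho> i), h) \<in> linked (column i)" using conn_linked[OF column_conn _ h(1) subset_refl] x(1)[OF k] by blast
      from linked_crossing[OF this, of "{v. w \<le> level v}"] x(1)[OF k] h(2)
      obtain u v where uv: "(u, v) \<in> r" "\<not> w \<le> level v" "(row k (\<rho> i), u) \<in> linked ?A" by blast
      then have "level u \<le> w" using level_edge[OF r_sym[OF uv(1)]] by simp
      then show ?thesis using uv r_sub by blast
    qed
    then obtain g where g: "\<And>k. k \<in> I' \<Longrightarrow> level (g k) \<le> w \<and> g k \<in> V \<and> (row k (\<rho> i), g k) \<in> linked ?A"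
      by metis
    have "finite (g ` I')" by (rule finite_subset[OF _ finite_lev[of w]]) (use g in auto)
    from pigeonhole_infinite[OF infI this] obtain k0 where
      k0: "infinite {k \<in> I'. g k = g k0}" by auto
    have "joined i w k k'" if "k \<in> {k \<in> I'. g k = g k0}" "k' \<in> {k \<in> I'. g k = g k0}" for k k'
    proof -
      have "(row k (\<rho> i), g k0) \<in> linked ?A" "(row k' (\<rho> i), g k0) \<in> linked ?A" using g[of k] g[of k'] that by auto
      then show ?thesis using x that linked_sym linked_trans unfolding joined_def by blast
    qed
    then show ?thesis using k0 by (intro exI[of _ "{k \<in> I'. g k = g k0}"]) (auto simp: I'_def)
  qed
qed

text \<open>Passing to subsequences for all pairs of a column and a level in turn. In the limit, in each column
  the late crossings are linked to one another outside any given finite set: they converge to an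
  end of the column.\<close>
lemma diagonal:
  "\<exists>\<sigma> :: nat \<Rightarrow> nat. strict_mono \<sigma> \<and> (\<forall>i w. \<exists>\<theta>. \<forall>k\<ge>\<theta>. \<forall>k'\<ge>\<theta>. joined i w (\<sigma> k) (\<sigma> k'))"
proof -
  define PP where "PP n \<tau> \<longleftrightarrow> (\<forall>k k'. joined (fst (prod_decode n)) (snd (prod_decode n)) (\<tau> k) (\<tau> k'))"
    for n and \<tau> :: "nat \<Rightarrow> nat"
  interpret subseqs PP
  proof
    fix n and \<tau> :: "nat \<Rightarrow> nat" assume \<tau>: "strict_mono \<tau>"
    have "infinite (range \<tau>)" using range_inj_infinite[OF strict_mono_imp_inj_on[OF \<tau>]] .
    then obtain J where J: "J \<subseteq> range \<tau>" "infinite J"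
      "\<forall>k\<in>J. \<forall>k'\<in>J. joined (fst (prod_decode n)) (snd (prod_decode n)) k k'"
      using joined_infinite by meson
    define J' where "J' = {m. \<tau> m \<in> J}"
    have "J = \<tau> ` J'" using J(1) by (auto simp: J'_def)
    then have infJ: "infinite J'" using J(2) by auto
    have "\<tau> (enumerate J' k) \<in> J" for k using enumerate_in_set[OF infJ, of k] by (simp add: J'_def)
    then have "PP n (\<tau> \<circ> enumerate J')" using J(3) by (auto simp: PP_def)
    moreover have "strict_mono (enumerate J')" using strict_mono_enumerate[OF infJ] .
    ultimately show "\<exists>r'. strict_mono r' \<and> PP n (\<tau> \<circ> r')" by blast
  qed
  have "PP n (diagseq \<circ> (+) (Suc n))" for n
    by (rule diagseq_holds) (auto simp: PP_def)
  then have key: "joined i w (diagseq (Suc n + k)) (diagseq (Suc n + k'))"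
    if n: "n = prod_encode (i, w)" for n i w k k'
  proof -
    have "fst (prod_decode n) = i" "snd (prod_decode n) = w" using n by auto
    then show ?thesis using \<open>\<And>n. PP n (diagseq \<circ> (+) (Suc n))\<close>[of n] by (auto simp: PP_def)
  qed
  have "\<exists>\<theta>. \<forall>k\<ge>\<theta>. \<forall>k'\<ge>\<theta>. joined i w (diagseq k) (diagseq k')" for i w
  proof (intro exI allI impI)
    fix k k' assume "Suc (prod_encode (i, w)) \<le> k" "Suc (prod_encode (i, w)) \<le> k'"
    then show "joined i w (diagseq k) (diagseq k')"
      using key[OF refl, of i w "k - Suc (prod_encode (i, w))" "k' - Suc (prod_encode (i, w))"] by simp
  qed
  then show ?thesis using subseq_diagseq by blast
qed

text \<open>The rows \<open>\<mu> n\<close> and the column pieces \<open>\<pi> n i\<close> joining row \<open>\<mu> n\<close> to row \<open>\<mu> (Suc n)\<close> are chosen one after the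
  other. The level bound \<open>A (Suc n)\<close> is chosen above row \<open>\<mu> n\<close> and above the pieces \<open>\<pi> (n - 1) i\<close>, which
  are all known by then, and row \<open>\<mu> (Suc n)\<close> is taken so late that it lies above \<open>A (Suc n)\<close> and that
  its crossings can be joined to those of its neighbours above the bounds in force.\<close>
lemma stages:
  "\<exists>A \<mu> \<pi>. (\<forall>n. n \<le> \<mu> n \<and> (\<forall>j\<le>\<rho> (\<mu> n). A n \<le> level (row (\<mu> n) j) \<and> level (row (\<mu> n) j) + K < A (Suc n))) \<and>
    (\<forall>n. \<forall>i\<le>n. conn (\<pi> n i) \<and> \<pi> n i \<subseteq> column i \<and> row (\<mu> n) (\<rho> i) \<in> \<pi> n i \<and> row (\<mu> (Suc n)) (\<rho> i) \<in> \<pi> n i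
      \<and> (\<forall>v\<in>\<pi> n i. A n \<le> level v \<and> level v + K < A (Suc (Suc n))))"
proof -
  obtain \<sigma> :: "nat \<Rightarrow> nat" where \<sigma>: "strict_mono \<sigma>"
    and ex: "\<And>i w. \<exists>\<theta>. \<forall>k\<ge>\<theta>. \<forall>k'\<ge>\<theta>. joined i w (\<sigma> k) (\<sigma> k')" using diagonal by blast
  define \<Theta> where "\<Theta> i w = (SOME \<theta>. \<forall>k\<ge>\<theta>. \<forall>k'\<ge>\<theta>. joined i w (\<sigma> k) (\<sigma> k'))" for i w
  have \<Theta>: "joined i w (\<sigma> k) (\<sigma> k')" if "\<Theta> i w \<le> k" "\<Theta> i w \<le> k'" for i w k k'
    using someI_ex[OF ex[of i w]] that unfolding \<Theta>_def by blast
  have \<sigma>k: "k \<le> \<sigma> k" for k using strict_mono_imp_increasing[OF \<sigma>] .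
  let ?good = "\<lambda>i w k k' F. finite F \<and> conn F \<and> F \<subseteq> column i \<inter> {v. w \<le> level v} \<and>
    row (\<sigma> k) (\<rho> i) \<in> F \<and> row (\<sigma> k') (\<rho> i) \<in> F"
  have ex_good: "\<exists>F. ?good i w k k' F" if th: "\<Theta> i w \<le> k" "\<Theta> i w \<le> k'" for i w k k'
  proof -
    have jn: "joined i w (\<sigma> k) (\<sigma> k')" "joined i w (\<sigma> (k + w)) (\<sigma> k)" using \<Theta> th by auto
    have "row (\<sigma> (k + w)) (\<rho> i) \<in> column i \<inter> {v. w \<le> level v}"
      using jn(2) row_boundary[of i "\<sigma> (k + w)"] boundary_column row_point[of "\<rho> i" "\<sigma> (k + w)"] rho_mono[of i "\<sigma> (k + w)"]
        \<sigma>k[of "k + w"] by (auto simp: joined_def)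
    then have "row (\<sigma> k) (\<rho> i) \<in> column i \<inter> {v. w \<le> level v}"
      using jn(2) linked_in unfolding joined_def by blast
    moreover have "column i \<inter> {v. w \<le> level v} \<subseteq> V" using column_conn conn_sub by blast
    ultimately show ?thesis
      using linked_finite_conn[of "row (\<sigma> k) (\<rho> i)" "row (\<sigma> k') (\<rho> i)" "column i \<inter> {v. w \<le> level v}"] jn(1)
      unfolding joined_def by blast
  qed
  define \<Pi> where "\<Pi> i w k k' = (SOME F. ?good i w k k' F)" for i w k k'
  have \<Pi>: "?good i w k k' (\<Pi> i w k k')" if "\<Theta> i w \<le> k" "\<Theta> i w \<le> k'" for i w k k'
    using someI_ex[OF ex_good[OF that]] unfolding \<Pi>_def .
  have bound: "\<exists>b. \<forall>v\<in>F. level v + K < b" if finF: "finite F" for F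
  proof -
    obtain b where "\<forall>n\<in>(\<lambda>v. level v + K) ` F. n < b"
      using finite_nat_set_iff_bounded[THEN iffD1, OF finite_imageI[OF finF]] by blast
    then show ?thesis by auto
  qed
  \<comment> \<open>A state consists of the current row, its level bound and the next level bound.\<close>
  define Inv where "Inv n st \<longleftrightarrow> (case st of (k, w, w') \<Rightarrow> (\<forall>i\<le>n. \<Theta> i w \<le> k) \<and> w \<le> k \<and> n \<le> k \<and>
      (\<forall>j\<le>\<rho> (\<sigma> k). level (row (\<sigma> k) j) + K < w'))" for n and st :: "nat \<times> nat \<times> nat"
  define Step where "Step n st st2 \<longleftrightarrow> (case st of (k, w, w') \<Rightarrow> case st2 of (k2, w2, w2') \<Rightarrow>
      w2 = w' \<and> (\<forall>i\<le>n. \<Theta> i w \<le> k2 \<and> (\<forall>v\<in>\<Pi> i w k k2. level v + K < w2')))"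
    for n and st st2 :: "nat \<times> nat \<times> nat"
  have large: "\<exists>k. (\<forall>i\<le>n. f i \<le> k) \<and> (m::nat) \<le> k" for f :: "nat \<Rightarrow> nat" and n m
    by (rule exI[of _ "m + Max (f ` {..n})"]) (auto intro!: trans_le_add2 Max_ge)
  have row_bound: "\<exists>b. \<forall>j\<le>\<rho> (\<sigma> k). level (row (\<sigma> k) j) + K < b" for k
    using bound[of "row (\<sigma> k) ` {..\<rho> (\<sigma> k)}"] by auto
  have "\<exists>st. \<forall>n. Inv n (st n) \<and> Step n (st n) (st (Suc n))"
  proof (rule dependent_nat_choice)
    obtain b where "\<forall>j\<le>\<rho> (\<sigma> (\<Theta> 0 0)). level (row (\<sigma> (\<Theta> 0 0)) j) + K < b" using row_bound by blast
    then show "\<exists>st. Inv 0 st" by (intro exI[of _ "(\<Theta> 0 0, 0, b)"]) (auto simp: Inv_def)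
  next
    fix st n assume inv: "Inv n st"
    obtain k w w' where st: "st = (k, w, w')" by (cases st)
    obtain k1 where k1: "\<forall>i\<le>Suc n. \<Theta> i w \<le> k1" "w' + Suc n \<le> k1"
      using large[of "Suc n" "\<lambda>i. \<Theta> i w" "w' + Suc n"] by auto
    obtain k2 where k2: "\<forall>i\<le>Suc n. \<Theta> i w' \<le> k2" "k1 \<le> k2"
      using large[of "Suc n" "\<lambda>i. \<Theta> i w'" k1] by auto
    have k2w: "\<Theta> i w \<le> k2" if "i \<le> n" for i using that k1(1) k2(2) by (meson le_SucI le_trans)
    have "finite (\<Union>i\<in>{..n}. \<Pi> i w k k2)" using \<Pi> k2w inv st by (auto simp: Inv_def)
    then obtain b1 where b1: "\<forall>v\<in>(\<Union>i\<in>{..n}. \<Pi> i w k k2). level v + K < b1" using bound by blast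
    obtain b2 where b2: "\<forall>j\<le>\<rho> (\<sigma> k2). level (row (\<sigma> k2) j) + K < b2" using row_bound by blast
    have "Inv (Suc n) (k2, w', b1 + b2)" using k1 k2 b2 by (auto simp: Inv_def trans_less_add2)
    moreover have "Step n st (k2, w', b1 + b2)"
      using k2w b1 by (auto simp: Step_def st trans_less_add1)
    ultimately show "\<exists>st2. Inv (Suc n) st2 \<and> Step n st st2" by blast
  qed
  then obtain st where st: "\<And>n. Inv n (st n)" "\<And>n. Step n (st n) (st (Suc n))" by blast
  define k where "k n = fst (st n)" for n
  define A where "A n = fst (snd (st n))" for n
  have A_Suc: "snd (snd (st n)) = A (Suc n)" for n
    using st(2)[of n] by (auto simp: Step_def A_def split: prod.splits)
  have stn: "st n = (k n, A n, A (Suc n))" for n using A_Suc[of n] by (simp add: k_def A_def prod_eq_iff)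
  have I: "(\<forall>i\<le>n. \<Theta> i (A n) \<le> k n) \<and> A n \<le> k n \<and> n \<le> k n \<and>
      (\<forall>j\<le>\<rho> (\<sigma> (k n)). level (row (\<sigma> (k n)) j) + K < A (Suc n))" for n
    using st(1)[of n] unfolding stn Inv_def by simp
  have S: "\<forall>i\<le>n. \<Theta> i (A n) \<le> k (Suc n) \<and> (\<forall>v\<in>\<Pi> i (A n) (k n) (k (Suc n)). level v + K < A (Suc (Suc n)))" for n
    using st(2)[of n] unfolding stn Step_def by simp
  show ?thesis
  proof (rule exI[of _ A], rule exI[of _ "\<lambda>n. \<sigma> (k n)"],
      rule exI[of _ "\<lambda>n i. \<Pi> i (A n) (k n) (k (Suc n))"], intro conjI allI impI)
    fix n
    show "n \<le> \<sigma> (k n)" using I[of n] \<sigma>k[of "k n"] by simp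
    fix j assume "j \<le> \<rho> (\<sigma> (k n))"
    then show "A n \<le> level (row (\<sigma> (k n)) j)" "level (row (\<sigma> (k n)) j) + K < A (Suc n)"
      using I[of n] \<sigma>k[of "k n"] row_point[of j "\<sigma> (k n)"] by auto
  next
    fix n i :: nat assume i: "i \<le> n"
    have p: "\<Theta> i (A n) \<le> k n" "\<Theta> i (A n) \<le> k (Suc n)" using I[of n] S[of n] i by auto
    note q = \<Pi>[OF p]
    show "conn (\<Pi> i (A n) (k n) (k (Suc n)))" "\<Pi> i (A n) (k n) (k (Suc n)) \<subseteq> column i"
      "row (\<sigma> (k n)) (\<rho> i) \<in> \<Pi> i (A n) (k n) (k (Suc n))"
      "row (\<sigma> (k (Suc n))) (\<rho> i) \<in> \<Pi> i (A n) (k n) (k (Suc n))" using q by auto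
    show "\<forall>v\<in>\<Pi> i (A n) (k n) (k (Suc n)). A n \<le> level v \<and> level v + K < A (Suc (Suc n))"
      using q S[of n] i by auto
  qed
qed

text \<open>A range of coordinates for the vertices of \<open>B\<close>; the upper bound for the level includes the margin \<open>K\<close>.\<close>
definition box :: "nat \<Rightarrow> nat \<Rightarrow> nat \<Rightarrow> nat \<Rightarrow> 'a set \<Rightarrow> bool" where
  "box a b c e B \<longleftrightarrow> B \<subseteq> V \<and> (\<forall>v\<in>B. a \<le> level v \<and> level v + K \<le> b \<and> c \<le> lam v \<and> lam v \<le> e)"

lemma box_apart:
  assumes B: "box a b c e B" and B': "box a' b' c' e' B'"
    and sep: "b \<le> a' \<or> b' \<le> a \<or> e + K \<le> c' \<or> e' + K \<le> c"
  shows "apart K B B'"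
  unfolding apart_def
proof (intro ballI)
  fix u v assume uv: "u \<in> B" "v \<in> B'"
  then have V: "u \<in> V" "v \<in> V" using B B' by (auto simp: box_def)
  have "a \<le> level u" "level u + K \<le> b" "c \<le> lam u" "lam u \<le> e" using B uv by (auto simp: box_def)
  moreover have "a' \<le> level v" "level v + K \<le> b'" "c' \<le> lam v" "lam v \<le> e'"
    using B' uv by (auto simp: box_def)
  ultimately show "K \<le> d u v"
    using sep level_tri[OF V] level_tri'[OF V] lam_tri[OF V] lam_tri'[OF V] by linarith
qed

text \<open>Three times \<open>3 * t\<close>, \<open>3 * t + 1\<close>, \<open>3 * t + 2\<close> are spent on step \<open>t\<close> of the grid. The branch set of \<open>(t, i)\<close>
  consists of the column pieces of the first two, the vertical branch path is the column piece of
  the third, and the horizontal branch paths are cut out of row \<open>3 * t + 1\<close>, the one in the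
  middle of the branch sets. Two pieces of a column whose times differ by at least two are separated
  by their levels, and a row is separated from all column pieces except those that it meets.
  To separate consecutive branch paths in one row, the branch sets also absorb the parts of the row
  within \<open>M\<close> of the columns. Everything else is separated by the distance from \<open>P\<close>.\<close>
lemma triangle_model: "\<exists>W S. fat_sets K triangle_grid W S"
proof -
  obtain A \<mu> \<pi> where \<mu>: "\<And>n. n \<le> \<mu> n"
    and row_level: "\<And>n j. j \<le> \<rho> (\<mu> n) \<Longrightarrow> A n \<le> level (row (\<mu> n) j) \<and> level (row (\<mu> n) j) + K < A (Suc n)"
    and \<pi>: "\<And>n i. i \<le> n \<Longrightarrow> conn (\<pi> n i) \<and> \<pi> n i \<subseteq> column i \<and> row (\<mu> n) (\<rho> i) \<in> \<pi> n i
        \<and> row (\<mu> (Suc n)) (\<rho> i) \<in> \<pi> n i"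
    and piece_level: "\<And>n i v. i \<le> n \<Longrightarrow> v \<in> \<pi> n i \<Longrightarrow> A n \<le> level v \<and> level v + K < A (Suc (Suc n))"
    using stages by metis
  have A_Suc: "A n \<le> A (Suc n)" for n using row_level[of 0 n] by auto
  have A_mono: "A m \<le> A n" if "m \<le> n" for m n by (rule lift_Suc_mono_le[of A, OF A_Suc that])
  define N where "N t = 3 * t + 1" for t :: nat
  define W where "W = (\<lambda>(t, i). \<pi> (3 * t) i \<union> \<pi> (N t) i \<union> row (\<mu> (N t)) ` {\<rho> i - M..\<rho> i + M})"
  define Ve where "Ve t i = \<pi> (3 * t + 2) i" for t i
  define Ho where "Ho t i = row (\<mu> (N t)) ` {\<rho> i + M..\<rho> (Suc i) - M}" for t i
  define S where "S e = (\<Union>(t, i)\<in>{(t, i). e = {(t, i), (Suc t, i)}}. Ve t i)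
      \<union> (\<Union>(t, i)\<in>{(t, i). e = {(t, i), (t, Suc i)}}. Ho t i)" for e
  have SV: "S {(t, i), (Suc t, i)} = Ve t i" for t i
  proof -
    have "{(t', i'). {(t, i), (Suc t, i)} = {(t', i'), (Suc t', i')}} = {(t, i)}"
      "{(t', i'). {(t, i), (Suc t, i)} = {(t', i'), (t', Suc i')}} = {}"
      by (auto simp: doubleton_eq_iff)
    then show ?thesis by (simp add: S_def)
  qed
  have SH: "S {(t, i), (t, Suc i)} = Ho t i" for t i
  proof -
    have "{(t', i'). {(t, i), (t, Suc i)} = {(t', i'), (Suc t', i')}} = {}"
      "{(t', i'). {(t, i), (t, Suc i)} = {(t', i'), (t', Suc i')}} = {(t, i)}"
      by (auto simp: doubleton_eq_iff)
    then show ?thesis by (simp add: S_def)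
  qed
  have M1: "K \<le> M" "1 \<le> M" by (auto simp: M_def)
  have rho_M: "10 * M \<le> \<rho> i" for i by (simp add: \<rho>_def)
  have rlen: "\<rho> i + 10 * M \<le> \<rho> (\<mu> (N t))" if "i \<le> t" for i t
    using rho_less[of i "\<mu> (N t)"] \<mu>[of "N t"] that by (simp add: N_def)
  have W_conn: "conn (W (t, i))" if i: "i \<le> t" for t i
  proof -
    have "conn (\<pi> (3 * t) i \<union> \<pi> (N t) i)"
      using \<pi>[of i "3 * t"] \<pi>[of i "N t"] i by (intro conn_Un) (auto simp: N_def)
    moreover have "conn (row (\<mu> (N t)) ` {\<rho> i - M..\<rho> i + M})"
      using rlen[OF i] M1 by (intro conn_walk) (auto intro!: row_edge simp: row_point)
    moreover have "row (\<mu> (N t)) (\<rho> i) \<in> row (\<mu> (N t)) ` {\<rho> i - M..\<rho> i + M}" by simp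
    moreover have "row (\<mu> (N t)) (\<rho> i) \<in> \<pi> (N t) i" using \<pi>[of i "N t"] i by (simp add: N_def)
    ultimately show ?thesis unfolding W_def prod.case by (intro conn_Un[of "_ \<union> _"]) blast+
  qed
  have W_box: "A (3 * t) \<le> level v \<and> level v + K < A (3 * t + 3) \<and> lam v \<le> \<rho> i + M \<and> \<rho> i \<le> lam v + M"
    if i: "i \<le> t" and v: "v \<in> W (t, i)" for t i v
  proof -
    from v consider "v \<in> \<pi> (3 * t) i" | "v \<in> \<pi> (N t) i"
      | j where "v = row (\<mu> (N t)) j" "\<rho> i - M \<le> j" "j \<le> \<rho> i + M" by (auto simp: W_def)
    then show ?thesis
    proof cases
      case 1
      then show ?thesis using \<pi>[of i "3 * t"] piece_level[of i "3 * t" v] i column_lam[of v i]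
        A_mono[of "Suc (Suc (3 * t))" "3 * t + 3"] by (auto dest: subsetD)
    next
      case 2
      have e: "Suc (Suc (N t)) = 3 * t + 3" by (simp add: N_def)
      have "A (3 * t) \<le> A (N t)" using A_mono by (auto simp: N_def)
      moreover have iN: "i \<le> N t" using i by (simp add: N_def)
      moreover have "v \<in> column i" using 2 \<pi>[OF iN] by blast
      ultimately show ?thesis using piece_level[OF iN 2, unfolded e] column_lam[of v i] by linarith
    next
      case 3
      have "A (3 * t) \<le> A (N t)" "A (Suc (N t)) \<le> A (3 * t + 3)" using A_mono by (auto simp: N_def)
      moreover have "j \<le> \<rho> (\<mu> (N t))" using 3 rlen[OF i] by linarith
      ultimately show ?thesis using 3 row_level[of j "N t"] row_point[of j "\<mu> (N t)"] by auto
    qed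
  qed
  have Ve_box: "A (3 * t + 2) \<le> level v \<and> level v + K < A (3 * t + 4) \<and> lam v \<le> \<rho> i + M \<and> \<rho> i \<le> lam v + M"
    if i: "i \<le> t" and v: "v \<in> Ve t i" for t i v
  proof -
    have e: "Suc (Suc (3 * t + 2)) = 3 * t + 4" by simp
    have "i \<le> 3 * t + 2" "v \<in> \<pi> (3 * t + 2) i" using i v by (auto simp: Ve_def)
    note piece_level[OF this, unfolded e]
    moreover have "v \<in> column i" using v \<pi>[of i "3 * t + 2"] i by (auto simp: Ve_def)
    ultimately show ?thesis using column_lam[of v i] by linarith
  qed
  have Ho_box: "A (3 * t + 1) \<le> level v \<and> level v + K < A (3 * t + 2) \<and> \<rho> i + M \<le> lam v \<and> lam v + M \<le> \<rho> (Suc i)"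
    if i: "Suc i \<le> t" and v: "v \<in> Ho t i" for t i v
  proof -
    obtain j where j: "v = row (\<mu> (N t)) j" "\<rho> i + M \<le> j" "j \<le> \<rho> (Suc i) - M" using v by (auto simp: Ho_def)
    have jl: "j \<le> \<rho> (\<mu> (N t))" using j rlen[OF i] by linarith
    have "lam v = j" using jl j(1) row_point by blast
    moreover have "M \<le> \<rho> (Suc i)" using rho_M[of "Suc i"] by linarith
    ultimately show ?thesis using j row_level[OF jl] by (simp add: N_def)
  qed
  have Ho_conn: "conn (Ho t i)" if i: "Suc i \<le> t" for t i
    unfolding Ho_def
  proof (rule conn_walk)
    show "\<rho> i + M \<le> \<rho> (Suc i) - M" using rho_less[of i "Suc i"] by simp
    show "row (\<mu> (N t)) (\<rho> i + M) \<in> V" using row_point rlen[of i t] i by simp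
    show "(row (\<mu> (N t)) j, row (\<mu> (N t)) (Suc j)) \<in> r" if "\<rho> i + M \<le> j" "j < \<rho> (Suc i) - M" for j
      using that rlen[OF i] by (intro row_edge) linarith
  qed
  have Ve_conn: "conn (Ve t i)" if "i \<le> t" for t i using \<pi>[of i "3 * t + 2"] that by (simp add: Ve_def)
  have Wb: "box (A (3 * t)) (A (3 * t + 3)) (\<rho> i - M) (\<rho> i + M) (W (t, i))" if "i \<le> t" for t i
    unfolding box_def using conn_sub[OF W_conn[OF that]] by (auto dest!: W_box[OF that])
  have Vb: "box (A (3 * t + 2)) (A (3 * t + 4)) (\<rho> i - M) (\<rho> i + M) (Ve t i)" if "i \<le> t" for t i
    unfolding box_def using conn_sub[OF Ve_conn[OF that]] by (auto dest!: Ve_box[OF that])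
  have Hb: "box (A (3 * t + 1)) (A (3 * t + 2)) (\<rho> i + M) (\<rho> (Suc i) - M) (Ho t i)" if "Suc i \<le> t" for t i
    unfolding box_def using conn_sub[OF Ho_conn[OF that]] by (auto dest!: Ho_box[OF that])
  have left: "\<rho> i + M + K \<le> \<rho> i' - M" if "i < i'" for i i'
    using rho_less[OF that] M1 by linarith
  have left': "\<rho> (Suc i) - M + K \<le> \<rho> i' + M" if "i < i'" for i i'
    using rho_mono[of "Suc i" i'] that M1 by linarith
  have leftH: "\<rho> (Suc i) - M + K \<le> \<rho> i' - M" if "Suc i < i'" for i i'
    using rho_less[OF that] M1 by linarith
  have Hleft: "\<rho> i + M + K \<le> \<rho> i' + M" if "i < i'" for i i'
    using rho_less[OF that] M1 by linarith
  have WW: "apart K (W x) (W y)" if "x \<in> vertices triangle_grid" "y \<in> vertices triangle_grid" and ne: "x \<noteq> y" for x y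
  proof -
    obtain t i t' i' where xy: "x = (t, i)" "y = (t', i')" by (cases x; cases y)
    then have le: "i \<le> t" "i' \<le> t'" using that by (auto simp: triangle_grid_def)
    consider "t < t'" | "t' < t" | "i < i'" | "i' < i" using ne xy by force
    then show ?thesis unfolding xy
      by (intro box_apart[OF Wb[OF le(1)] Wb[OF le(2)]]; cases) (simp_all add: A_mono left)
  qed
  have VV: "apart K (Ve t i) (Ve t' i')" if le: "i \<le> t" "i' \<le> t'" and ne: "(t, i) \<noteq> (t', i')" for t i t' i'
  proof -
    consider "t < t'" | "t' < t" | "i < i'" | "i' < i" using ne by force
    then show ?thesis
      by (intro box_apart[OF Vb[OF le(1)] Vb[OF le(2)]]; cases) (simp_all add: A_mono left)
  qed
  have HH: "apart K (Ho t i) (Ho t' i')" if le: "Suc i \<le> t" "Suc i' \<le> t'" and ne: "(t, i) \<noteq> (t', i')" for t i t' i'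
  proof -
    consider "t < t'" | "t' < t" | "i < i'" | "i' < i" using ne by force
    then show ?thesis
      by (intro box_apart[OF Hb[OF le(1)] Hb[OF le(2)]]; cases) (simp_all add: A_mono left')
  qed
  have HV: "apart K (Ho t i) (Ve t' i')" if le: "Suc i \<le> t" "i' \<le> t'" for t i t' i'
  proof -
    consider "t \<le> t'" | "t' < t" by linarith
    then show ?thesis
      by (intro box_apart[OF Hb[OF le(1)] Vb[OF le(2)]]; cases) (simp_all add: A_mono)
  qed
  have VW: "apart K (Ve t i) (W (t', i'))"
    if le: "i \<le> t" "i' \<le> t'" and ne: "(t', i') \<noteq> (t, i)" "(t', i') \<noteq> (Suc t, i)" for t i t' i'
  proof -
    consider "i < i'" | "i' < i" | "Suc (Suc t) \<le> t'" | "t' < t" using ne by force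
    then show ?thesis
      by (intro box_apart[OF Vb[OF le(1)] Wb[OF le(2)]]; cases) (simp_all add: A_mono left)
  qed
  have HW: "apart K (Ho t i) (W (t', i'))"
    if le: "Suc i \<le> t" "i' \<le> t'" and ne: "(t', i') \<noteq> (t, i)" "(t', i') \<noteq> (t, Suc i)" for t i t' i'
  proof -
    consider "Suc i < i'" | "i' < i" | "t < t'" | "t' < t" using ne by force
    then show ?thesis
      by (intro box_apart[OF Hb[OF le(1)] Wb[OF le(2)]]; cases) (simp_all add: A_mono leftH Hleft)
  qed
  have Ve_meets: "Ve t i \<inter> W (t, i) \<noteq> {} \<and> Ve t i \<inter> W (Suc t, i) \<noteq> {}" if i: "i \<le> t" for t i
  proof -
    have "row (\<mu> (3 * t + 2)) (\<rho> i) \<in> Ve t i" "row (\<mu> (Suc (3 * t + 2))) (\<rho> i) \<in> Ve t i"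
      using \<pi>[of i "3 * t + 2"] i by (auto simp: Ve_def)
    moreover have "row (\<mu> (3 * t + 2)) (\<rho> i) \<in> W (t, i)"
      using \<pi>[of i "N t"] i by (auto simp: W_def N_def)
    moreover have "row (\<mu> (Suc (3 * t + 2))) (\<rho> i) \<in> W (Suc t, i)"
    proof -
      have e: "Suc (3 * t + 2) = 3 * Suc t" by simp
      show ?thesis unfolding e using \<pi>[of i "3 * Suc t"] i by (auto simp: W_def)
    qed
    ultimately show ?thesis by blast
  qed
  have Ho_meets: "Ho t i \<inter> W (t, i) \<noteq> {} \<and> Ho t i \<inter> W (t, Suc i) \<noteq> {}" if i: "Suc i \<le> t" for t i
  proof -
    have "\<rho> i + 10 * M \<le> \<rho> (Suc i)" using rho_less[of i "Suc i"] by simp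
    then have "row (\<mu> (N t)) (\<rho> i + M) \<in> Ho t i" "row (\<mu> (N t)) (\<rho> (Suc i) - M) \<in> Ho t i"
      by (auto simp: Ho_def)
    moreover have "row (\<mu> (N t)) (\<rho> i + M) \<in> W (t, i)" "row (\<mu> (N t)) (\<rho> (Suc i) - M) \<in> W (t, Suc i)"
      by (auto simp: W_def)
    ultimately show ?thesis by blast
  qed
  have W_ne: "W (t, i) \<noteq> {}" for t i by (auto simp: W_def)
  have edges: "(\<exists>t i. i \<le> t \<and> e = {(t, i), (Suc t, i)}) \<or> (\<exists>t i. Suc i \<le> t \<and> e = {(t, i), (t, Suc i)})"
    if "e \<in> edges triangle_grid" for e using that by (auto simp: triangle_grid_def)
  have "fat_sets K triangle_grid W S"
    unfolding fat_sets_def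
  proof (intro conjI ballI impI)
    fix x assume "x \<in> vertices triangle_grid"
    then show "conn (W x)" "W x \<noteq> {}" using W_conn W_ne by (auto simp: triangle_grid_def)
  next
    fix e assume "e \<in> edges triangle_grid"
    then show "conn (S e)" using edges[of e] Ve_conn Ho_conn SV SH by auto
  next
    fix e x assume "e \<in> edges triangle_grid" "x \<in> e"
    then show "S e \<inter> W x \<noteq> {}" using edges[of e] Ve_meets Ho_meets SV SH by auto
  next
    fix x y assume "x \<in> vertices triangle_grid" "y \<in> vertices triangle_grid" "x \<noteq> y"
    then show "apart K (W x) (W y)" by (rule WW)
  next
    fix e f assume ef: "e \<in> edges triangle_grid" "f \<in> edges triangle_grid" "e \<noteq> f"
    from edges[OF ef(1)] show "apart K (S e) (S f)"
    proof (elim disjE exE conjE)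
      fix t i assume e: "i \<le> t" "e = {(t, i), (Suc t, i)}"
      from edges[OF ef(2)] show ?thesis
      proof (elim disjE exE conjE)
        fix t' i' assume f: "i' \<le> t'" "f = {(t', i'), (Suc t', i')}"
        then show ?thesis using VV[OF e(1) f(1)] e ef(3) SV by auto
      next
        fix t' i' assume f: "Suc i' \<le> t'" "f = {(t', i'), (t', Suc i')}"
        then show ?thesis using apart_sym[OF HV[OF f(1) e(1)]] e SV SH by auto
      qed
    next
      fix t i assume e: "Suc i \<le> t" "e = {(t, i), (t, Suc i)}"
      from edges[OF ef(2)] show ?thesis
      proof (elim disjE exE conjE)
        fix t' i' assume f: "i' \<le> t'" "f = {(t', i'), (Suc t', i')}"
        then show ?thesis using HV[OF e(1) f(1)] e SV SH by auto
      next
        fix t' i' assume f: "Suc i' \<le> t'" "f = {(t', i'), (t', Suc i')}"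
        then show ?thesis using HH[OF e(1) f(1)] e ef(3) SH by auto
      qed
    qed
  next
    fix e x assume ex: "e \<in> edges triangle_grid" "x \<in> vertices triangle_grid" "x \<notin> e"
    obtain t' i' where x: "x = (t', i')" "i' \<le> t'" using ex(2) by (auto simp: triangle_grid_def)
    from edges[OF ex(1)] show "apart K (S e) (W x)"
    proof (elim disjE exE conjE)
      fix t i assume e: "i \<le> t" "e = {(t, i), (Suc t, i)}"
      show ?thesis unfolding e(2) SV x(1) by (rule VW[OF e(1) x(2)]) (use ex(3) e x in auto)
    next
      fix t i assume e: "Suc i \<le> t" "e = {(t, i), (t, Suc i)}"
      show ?thesis unfolding e(2) SH x(1) by (rule HW[OF e(1) x(2)]) (use ex(3) e x in auto)
    qed
  qed
  then show ?thesis by blast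
qed

end

section \<open>Contracting the triangular grid to the half-grid\<close>

abbreviation edges_within :: "'x ugraph \<Rightarrow> 'x set \<Rightarrow> ('x \<times> 'x) set" where
  "edges_within Y C \<equiv> {(y, z). y \<in> C \<and> z \<in> C \<and> {y, z} \<in> edges Y}"

context conn_graph
begin

text \<open>The new branch set of \<open>x\<close> is the union of the old branch sets in \<open>U x\<close> and of the connectors between
  them. For an edge of \<open>X\<close> one of the edges of \<open>Y\<close> between the two classes is selected. Since the
  classes are disjoint, sets belonging to different vertices or edges of \<open>X\<close> are made of pieces
  that belong to different vertices or edges of \<open>Y\<close>, or to a non-incident pair.\<close>
lemma fat_sets_contract:
  assumes fat: "fat_sets K Y W S" and Yne: "\<And>g. g \<in> edges Y \<Longrightarrow> g \<noteq> {}"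
    and U_sub: "\<And>x. x \<in> vertices X \<Longrightarrow> U x \<subseteq> vertices Y"
    and U_conn: "\<And>x. x \<in> vertices X \<Longrightarrow>
      \<exists>c\<in>U x. \<forall>y\<in>U x. (c, y) \<in> (edges_within Y (U x))\<^sup>*"
    and U_disj: "\<And>x x'. x \<in> vertices X \<Longrightarrow> x' \<in> vertices X \<Longrightarrow> x \<noteq> x' \<Longrightarrow> U x \<inter> U x' = {}"
    and U_edge: "\<And>e. e \<in> edges X \<Longrightarrow> \<exists>x\<in>vertices X. \<exists>x'\<in>vertices X. e = {x, x'}
      \<and> (\<exists>y\<in>U x. \<exists>y'\<in>U x'. {y, y'} \<in> edges Y)"
  shows "\<exists>W' S'. fat_sets K X W' S'"
proof -
  have W: "conn (W y)" "W y \<noteq> {}" if "y \<in> vertices Y" for y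
    using fat that unfolding fat_sets_def by auto
  have S: "conn (S g)" if "g \<in> edges Y" for g using fat that unfolding fat_sets_def by auto
  have SW: "S g \<inter> W y \<noteq> {}" if "g \<in> edges Y" "y \<in> g" for g y
    using fat that unfolding fat_sets_def by auto
  have aWW: "K \<le> d u v" if "y \<in> vertices Y" "z \<in> vertices Y" "y \<noteq> z" "u \<in> W y" "v \<in> W z" for y z u v
    using fat that unfolding fat_sets_def apart_def by auto
  have aSS: "K \<le> d u v" if "g \<in> edges Y" "h \<in> edges Y" "g \<noteq> h" "u \<in> S g" "v \<in> S h" for g h u v
    using fat that unfolding fat_sets_def apart_def by auto
  have aSW: "K \<le> d u v" if "g \<in> edges Y" "y \<in> vertices Y" "y \<notin> g" "u \<in> S g" "v \<in> W y" for g y u v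
    using fat that unfolding fat_sets_def apart_def by auto
  have aWS: "K \<le> d v u" if "g \<in> edges Y" "y \<in> vertices Y" "y \<notin> g" "u \<in> S g" "v \<in> W y" for g y u v
    using aSW[OF that] d_sym[of u v] by simp
  have "\<forall>e\<in>edges X. \<exists>g\<in>edges Y. e \<subseteq> vertices X \<and> g \<subseteq> (\<Union>x\<in>e. U x) \<and> (\<forall>x\<in>e. g \<inter> U x \<noteq> {})"
  proof
    fix e assume "e \<in> edges X"
    from U_edge[OF this] obtain x x' y y' where
      "x \<in> vertices X" "x' \<in> vertices X" "e = {x, x'}" "y \<in> U x" "y' \<in> U x'" "{y, y'} \<in> edges Y" by blast
    then show "\<exists>g\<in>edges Y. e \<subseteq> vertices X \<and> g \<subseteq> (\<Union>x\<in>e. U x) \<and> (\<forall>x\<in>e. g \<inter> U x \<noteq> {})"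
      by (intro bexI[of _ "{y, y'}"]) auto
  qed
  then obtain \<epsilon> where \<epsilon>: "\<And>e. e \<in> edges X \<Longrightarrow> \<epsilon> e \<in> edges Y \<and> e \<subseteq> vertices X
    \<and> \<epsilon> e \<subseteq> (\<Union>x\<in>e. U x) \<and> (\<forall>x\<in>e. \<epsilon> e \<inter> U x \<noteq> {})" by metis
  have \<epsilon>_disj: "\<epsilon> e \<inter> U x = {}" if "e \<in> edges X" "x \<in> vertices X" "x \<notin> e" for e x
  proof -
    have "U x' \<inter> U x = {}" if "x' \<in> e" for x'
      using U_disj[of x' x] \<epsilon>[OF \<open>e \<in> edges X\<close>] that \<open>x \<in> vertices X\<close> \<open>x \<notin> e\<close> by blast
    then show ?thesis using \<epsilon>[OF that(1)] by blast
  qed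
  have \<epsilon>_sub: "e \<subseteq> f" if "e \<in> edges X" "f \<in> edges X" "\<epsilon> e = \<epsilon> f" for e f
  proof
    fix x assume "x \<in> e"
    then have "\<epsilon> f \<inter> U x \<noteq> {}" "x \<in> vertices X" using \<epsilon>[OF that(1)] that(3) by auto
    then show "x \<in> f" using \<epsilon>_disj[OF that(2)] by blast
  qed
  define W' where "W' x = (\<Union>y\<in>U x. W y) \<union> (\<Union>g\<in>{g \<in> edges Y. g \<subseteq> U x}. S g)" for x
  have W'_conn: "conn (W' x)" if x: "x \<in> vertices X" for x
  proof -
    obtain c where c: "c \<in> U x" "\<And>y. y \<in> U x \<Longrightarrow>
        (c, y) \<in> (edges_within Y (U x))\<^sup>*" using U_conn[OF x] by blast
    obtain c0 where c0: "c0 \<in> W c" using W(2)[of c] c(1) U_sub[OF x] by blast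
    have WW': "W y \<subseteq> W' x" if "y \<in> U x" for y using that by (auto simp: W'_def)
    have SW': "S g \<subseteq> W' x" if "g \<in> edges Y" "g \<subseteq> U x" for g using that by (auto simp: W'_def)
    have Wl: "(u, v) \<in> linked (W' x)" if "y \<in> U x" "u \<in> W y" "v \<in> W y" for y u v
    proof -
      have "conn (W y)" using W(1) U_sub[OF x] that(1) by blast
      then show ?thesis using conn_linked WW'[OF that(1)] that by blast
    qed
    have Sl: "(u, v) \<in> linked (W' x)" if "g \<in> edges Y" "g \<subseteq> U x" "u \<in> S g" "v \<in> S g" for g u v
      using conn_linked[OF S[OF that(1)] that(3,4) SW'[OF that(1,2)]] .
    have reach: "\<forall>w\<in>W y. (c0, w) \<in> linked (W' x)" if y: "y \<in> U x" for y
      using c(2)[OF y]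
    proof (induction rule: rtrancl_induct)
      case base
      show ?case using Wl[OF c(1) c0] by blast
    next
      case (step y z)
      then have g: "{y, z} \<in> edges Y" "{y, z} \<subseteq> U x" "y \<in> U x" "z \<in> U x" by auto
      obtain p where p: "p \<in> S {y, z}" "p \<in> W y" using SW[OF g(1), of y] by auto
      obtain t where t: "t \<in> S {y, z}" "t \<in> W z" using SW[OF g(1), of z] by auto
      have "(c0, p) \<in> linked (W' x)" using step.IH p by blast
      then have "(c0, t) \<in> linked (W' x)" using Sl[OF g(1,2) p(1) t(1)] linked_trans by blast
      then show ?case using Wl[OF g(4) t(2)] linked_trans by blast
    qed
    show ?thesis
    proof (rule connI[where c=c0])
      show "W' x \<subseteq> V" unfolding W'_def using W(1) S conn_sub U_sub[OF x] by blast
      fix w assume "w \<in> W' x"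
      then consider y where "y \<in> U x" "w \<in> W y" | g where "g \<in> edges Y" "g \<subseteq> U x" "w \<in> S g"
        by (auto simp: W'_def)
      then show "(c0, w) \<in> linked (W' x)"
      proof cases
        case 1
        then show ?thesis using reach by blast
      next
        case 2
        obtain y where y: "y \<in> g" using Yne[OF 2(1)] by auto
        then obtain p where p: "p \<in> S g" "p \<in> W y" using SW[OF 2(1)] by blast
        have "(c0, p) \<in> linked (W' x)" using reach[of y] y 2(2) p(2) by blast
        then show ?thesis using Sl[OF 2(1,2) p(1) 2(3)] linked_trans by blast
      qed
    qed
  qed
  have piece: "(\<exists>y. y \<in> U x \<and> y \<in> vertices Y \<and> w \<in> W y) \<or> (\<exists>g. g \<in> edges Y \<and> g \<subseteq> U x \<and> g \<noteq> {} \<and> w \<in> S g)"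
    if "w \<in> W' x" "x \<in> vertices X" for w x
    using that U_sub[OF that(2)] Yne by (auto simp: W'_def)
  have "fat_sets K X W' (\<lambda>e. S (\<epsilon> e))"
    unfolding fat_sets_def
  proof (intro conjI ballI impI)
    fix x assume x: "x \<in> vertices X"
    show "conn (W' x)" by (rule W'_conn[OF x])
    obtain c where "c \<in> U x" using U_conn[OF x] by blast
    then show "W' x \<noteq> {}" using W(2)[of c] U_sub[OF x] by (auto simp: W'_def)
  next
    fix e assume "e \<in> edges X"
    then show "conn (S (\<epsilon> e))" using \<epsilon> S by blast
  next
    fix e x assume e: "e \<in> edges X" "x \<in> e"
    then obtain y where y: "y \<in> \<epsilon> e" "y \<in> U x" using \<epsilon>[OF e(1)] by blast
    have "S (\<epsilon> e) \<inter> W y \<noteq> {}" using SW \<epsilon>[OF e(1)] y by blast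
    then show "S (\<epsilon> e) \<inter> W' x \<noteq> {}" using y(2) by (auto simp: W'_def)
  next
    fix x x' assume x: "x \<in> vertices X" "x' \<in> vertices X" "x \<noteq> x'"
    have dj: "U x \<inter> U x' = {}" by (rule U_disj[OF x])
    show "apart K (W' x) (W' x')" unfolding apart_def
    proof (intro ballI)
      fix u v assume u: "u \<in> W' x" and v: "v \<in> W' x'"
      show "K \<le> d u v"
        using piece[OF u x(1)] piece[OF v x(2)]
      proof (elim disjE exE conjE)
        fix y z assume "y \<in> U x" "y \<in> vertices Y" "u \<in> W y" "z \<in> U x'" "z \<in> vertices Y" "v \<in> W z"
        then show ?thesis using aWW[of y z u v] dj by blast
      next
        fix y g assume "y \<in> U x" "y \<in> vertices Y" "u \<in> W y" "g \<in> edges Y" "g \<subseteq> U x'" "v \<in> S g"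
        then show ?thesis using aWS[of g y v u] dj by blast
      next
        fix y g assume "y \<in> U x'" "y \<in> vertices Y" "v \<in> W y" "g \<in> edges Y" "g \<subseteq> U x" "u \<in> S g"
        then show ?thesis using aSW[of g y u v] dj by blast
      next
        fix g h assume "g \<in> edges Y" "g \<subseteq> U x" "g \<noteq> {}" "u \<in> S g" "h \<in> edges Y" "h \<subseteq> U x'" "v \<in> S h"
        then show ?thesis using aSS[of g h u v] dj by blast
      qed
    qed
  next
    fix e f assume ef: "e \<in> edges X" "f \<in> edges X" "e \<noteq> f"
    then have "\<epsilon> e \<noteq> \<epsilon> f" using \<epsilon>_sub[of e f] \<epsilon>_sub[of f e] by auto
    then show "apart K (S (\<epsilon> e)) (S (\<epsilon> f))"
      unfolding apart_def using aSS \<epsilon>[OF ef(1)] \<epsilon>[OF ef(2)] by blast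
  next
    fix e x assume ex: "e \<in> edges X" "x \<in> vertices X" "x \<notin> e"
    have dj: "\<epsilon> e \<inter> U x = {}" by (rule \<epsilon>_disj[OF ex])
    have eY: "\<epsilon> e \<in> edges Y" using \<epsilon>[OF ex(1)] by blast
    show "apart K (S (\<epsilon> e)) (W' x)" unfolding apart_def
    proof (intro ballI)
      fix u v assume u: "u \<in> S (\<epsilon> e)" and v: "v \<in> W' x"
      show "K \<le> d u v"
        using piece[OF v ex(2)]
      proof (elim disjE exE conjE)
        fix y assume "y \<in> U x" "y \<in> vertices Y" "v \<in> W y"
        then show ?thesis using aSW[OF eY _ _ u] dj by blast
      next
        fix g assume "g \<in> edges Y" "g \<subseteq> U x" "g \<noteq> {}" "v \<in> S g"
        then show ?thesis using aSS[OF eY _ _ u] dj by blast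
      qed
    qed
  qed
  then show ?thesis by blast
qed

end

definition quarter_grid :: "(nat \<times> nat) ugraph" where
  "quarter_grid = \<lparr>vertices = UNIV,
     edges = {{(x, y), (Suc x, y)} |x y. True} \<union> {{(x, y), (x, Suc y)} |x y. True}\<rparr>"

lemma triangle_edge_v: "i \<le> t \<Longrightarrow> {(t, i), (Suc t, i)} \<in> edges triangle_grid"
  and triangle_edge_h: "Suc i \<le> t \<Longrightarrow> {(t, i), (t, Suc i)} \<in> edges triangle_grid"
  unfolding triangle_grid_def ugraph.simps by blast+

context conn_graph
begin

text \<open>A shear: in column \<open>x\<close>, the branch set of height \<open>y\<close> takes the two times \<open>x + 2 * y\<close> and
  \<open>x + 2 * y + 1\<close>. Thus it is adjacent to the branch set of height \<open>y\<close> in the next column at time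
  \<open>x + 2 * y + 1\<close>, and all times used in column \<open>x\<close> are at least \<open>x\<close>.\<close>
lemma quarter_model:
  assumes "fat_sets K triangle_grid W S"
  shows "\<exists>W' S'. fat_sets K quarter_grid W' S'"
proof -
  let ?U = "\<lambda>(x, y). {(x + 2 * y, x), (Suc (x + 2 * y), x)}"
  show ?thesis
  proof (rule fat_sets_contract[OF assms, where U = ?U])
    fix g assume "g \<in> edges triangle_grid" then show "g \<noteq> {}" by (auto simp: triangle_grid_def)
  next
    fix p show "?U p \<subseteq> vertices triangle_grid" by (cases p) (auto simp: triangle_grid_def)
  next
    fix p :: "nat \<times> nat"
    obtain x y where p: "p = (x, y)" by (cases p)
    let ?E = "edges_within triangle_grid (?U p)"
    have "((x + 2 * y, x), (Suc (x + 2 * y), x)) \<in> ?E" using triangle_edge_v[of x "x + 2 * y"] p by simp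
    then have "((x + 2 * y, x), (Suc (x + 2 * y), x)) \<in> ?E\<^sup>*" by (rule r_into_rtrancl)
    then show "\<exists>c\<in>?U p. \<forall>y\<in>?U p. (c, y) \<in> ?E\<^sup>*"
      unfolding p prod.case by blast
  next
    fix p p' :: "nat \<times> nat" assume ne: "p \<noteq> p'"
    have inv: "p = (snd a, (fst a - snd a) div 2)" if "a \<in> ?U p" for a p
      using that by (cases p) auto
    show "?U p \<inter> ?U p' = {}" using inv[of _ p] inv[of _ p'] ne by blast
  next
    fix e assume "e \<in> edges quarter_grid"
    then consider x y where "e = {(x, y), (Suc x, y)}" | x y where "e = {(x, y), (x, Suc y)}"
      by (auto simp: quarter_grid_def)
    then show "\<exists>p\<in>vertices quarter_grid. \<exists>p'\<in>vertices quarter_grid. e = {p, p'}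
      \<and> (\<exists>y\<in>?U p. \<exists>y'\<in>?U p'. {y, y'} \<in> edges triangle_grid)"
    proof cases
      case 1
      have "{(Suc (x + 2 * y), x), (Suc x + 2 * y, Suc x)} \<in> edges triangle_grid"
        using triangle_edge_h[of x "Suc (x + 2 * y)"] by simp
      then have "\<exists>u\<in>?U (x, y). \<exists>v\<in>?U (Suc x, y). {u, v} \<in> edges triangle_grid" by auto
      then show ?thesis unfolding 1 quarter_grid_def ugraph.simps by blast
    next
      case 2
      have "{(Suc (x + 2 * y), x), (x + 2 * Suc y, x)} \<in> edges triangle_grid"
        using triangle_edge_v[of x "Suc (x + 2 * y)"] by simp
      then have "\<exists>u\<in>?U (x, y). \<exists>v\<in>?U (x, Suc y). {u, v} \<in> edges triangle_grid" by auto
      then show ?thesis unfolding 2 quarter_grid_def ugraph.simps by blast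
    qed
  qed
qed

end

text \<open>The lines of the half-grid are bent at a right angle. With coordinates doubled, line \<open>m\<close> becomes the
  set of points with minimum coordinate \<open>m\<close>, which has its corner on the diagonal, and vertex
  \<open>n\<close> of the line is placed at distance \<open>\<bar>n\<bar>\<close> from the corner, on the lower arm for positive and on the
  upper arm for negative \<open>n\<close>. As the corners move along the diagonal, a perpendicular of the
  half-grid has to move one unit along the arm from each line to the next, hence the staircase.\<close>
definition staircase :: "nat \<Rightarrow> nat \<Rightarrow> (nat \<times> nat) set" where
  "staircase m k = {(2 * k, 2 * m), (2 * k + 1, 2 * m), (2 * k + 1, 2 * m + 1), (2 * k + 2, 2 * m + 1)}"

text \<open>The additional point for \<open>n = 0\<close> connects the corner to the upper arm.\<close>
definition cell :: "nat \<times> int \<Rightarrow> (nat \<times> nat) set" where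
  "cell = (\<lambda>(m, n). if n < 0 then prod.swap ` staircase m (m + nat (- n))
     else staircase m (m + nat n) \<union> (if n = 0 then {(2 * m, 2 * m + 1)} else {}))"

lemma cell_fst:
  assumes "(a, b) \<in> cell (m, n)"
  shows "m = min (a div 2) (b div 2)"
  using assms by (auto simp: cell_def staircase_def split: if_splits)

text \<open>The maximum with \<open>m\<close> takes care of the additional point of the corner cells.\<close>
lemma cell_snd:
  assumes "(a, b) \<in> cell (m, n)"
  shows "n = (if b div 2 \<le> a div 2
    then int (max m (if odd b then (a + 1) div 2 - 1 else a div 2)) - int m
    else int m - int (if odd a then (b + 1) div 2 - 1 else b div 2))"
  using assms by (auto simp: cell_def staircase_def split: if_splits)

lemma cell_disjoint: "p \<noteq> p' \<Longrightarrow> cell p \<inter> cell p' = {}"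
proof (rule ccontr)
  assume ne: "p \<noteq> p'" "cell p \<inter> cell p' \<noteq> {}"
  obtain m n m' n' where p: "p = (m, n)" "p' = (m', n')" by (cases p; cases p')
  obtain a b where ab: "(a, b) \<in> cell (m, n)" "(a, b) \<in> cell (m', n')" using ne p by auto
  have "m = m'" using cell_fst[OF ab(1)] cell_fst[OF ab(2)] by simp
  moreover have "n = n'" using cell_snd[OF ab(1)] cell_snd[OF ab(2)] \<open>m = m'\<close> by simp
  ultimately show False using ne p by simp
qed

lemma half_grid_edge:
  assumes "e \<in> edges half_grid"
  shows "\<exists>m n. e = {(m, n), (m, n + 1)} \<or> e = {(m, n), (Suc m, n)}"
proof -
  obtain m n m' n' where e: "e = {(m, n), (m', n')}" "\<bar>int m - int m'\<bar> + \<bar>n - n'\<bar> = 1"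
    using assms by (auto simp: half_grid_def)
  then consider "m = m'" "n' = n + 1" | "m = m'" "n = n' + 1" | "n = n'" "m' = Suc m" | "n = n'" "m = Suc m'"
    by linarith
  then show ?thesis by cases (use e in \<open>auto simp: insert_commute\<close>)
qed

lemma quarter_edge_h: "{(x, y), (Suc x, y)} \<in> edges quarter_grid"
  and quarter_edge_v: "{(x, y), (x, Suc y)} \<in> edges quarter_grid"
  by (auto simp: quarter_grid_def)

lemma quarter_edge_swap: "{p, p'} \<in> edges quarter_grid \<Longrightarrow> {prod.swap p, prod.swap p'} \<in> edges quarter_grid"
  by (auto simp: quarter_grid_def doubleton_eq_iff)

lemma staircase_conn:
  assumes "staircase m k \<subseteq> C" "c \<in> staircase m k"
  shows "((2 * k, 2 * m), c) \<in> (edges_within quarter_grid C)\<^sup>*"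
proof -
  let ?E = "edges_within quarter_grid C"
  have "((2 * k, 2 * m), (2 * k + 1, 2 * m)) \<in> ?E"
    "((2 * k + 1, 2 * m), (2 * k + 1, 2 * m + 1)) \<in> ?E"
    "((2 * k + 1, 2 * m + 1), (2 * k + 2, 2 * m + 1)) \<in> ?E"
    using assms(1) quarter_edge_h[of "2 * k" "2 * m"] quarter_edge_v[of "2 * k + 1" "2 * m"]
      quarter_edge_h[of "2 * k + 1" "2 * m + 1"] by (auto simp: staircase_def)
  then have "((2 * k, 2 * m), (2 * k + 1, 2 * m)) \<in> ?E\<^sup>*"
    "((2 * k, 2 * m), (2 * k + 1, 2 * m + 1)) \<in> ?E\<^sup>*"
    "((2 * k, 2 * m), (2 * k + 2, 2 * m + 1)) \<in> ?E\<^sup>*"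
    by (meson rtrancl.rtrancl_into_rtrancl rtrancl.rtrancl_refl)+
  then show ?thesis using assms(2) by (auto simp: staircase_def)
qed

lemma cell_conn:
  "\<exists>c\<in>cell p. \<forall>y\<in>cell p. (c, y) \<in> (edges_within quarter_grid (cell p))\<^sup>*"
proof -
  obtain m n where p: "p = (m, n)" by (cases p)
  let ?E = "edges_within quarter_grid (cell p)"
  show ?thesis
  proof (cases "n < 0")
    case True
    define k where "k = m + nat (- n)"
    have cp: "cell p = prod.swap ` staircase m k" using True by (simp add: cell_def p k_def)
    have "((2 * m, 2 * k), prod.swap c) \<in> ?E\<^sup>*" if "c \<in> staircase m k" for c
      using staircase_conn[OF subset_refl that]
    proof (induction rule: rtrancl_induct)
      case (step y z)
      then have "(prod.swap y, prod.swap z) \<in> ?E" using quarter_edge_swap by (auto simp: cp)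
      then show ?case using step.IH by (meson rtrancl.rtrancl_into_rtrancl)
    qed simp
    then have "\<forall>y\<in>cell p. ((2 * m, 2 * k), y) \<in> ?E\<^sup>*" unfolding cp by blast
    moreover have "(2 * m, 2 * k) \<in> cell p" by (simp add: cp staircase_def)
    ultimately show ?thesis by blast
  next
    case False
    define k where "k = m + nat n"
    have sub: "staircase m k \<subseteq> cell p" using False by (auto simp: cell_def p k_def)
    have "((2 * k, 2 * m), y) \<in> ?E\<^sup>*" if y: "y \<in> cell p" for y
    proof (cases "y \<in> staircase m k")
      case True
      then show ?thesis using staircase_conn[OF sub] by blast
    next
      case notin: False
      then have n: "n = 0" "y = (2 * m, 2 * m + 1)" using y False by (auto simp: cell_def p k_def split: if_splits)
      then have "k = m" by (simp add: k_def)
      then have "((2 * k, 2 * m), y) \<in> ?E"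
        using quarter_edge_v[of "2 * m" "2 * m"] n sub y by (auto simp: staircase_def)
      then show ?thesis by (rule r_into_rtrancl)
    qed
    moreover have "(2 * k, 2 * m) \<in> cell p" using sub by (auto simp: staircase_def)
    ultimately show ?thesis by blast
  qed
qed

lemma cell_edge:
  assumes "e \<in> edges half_grid"
  shows "\<exists>p p'. e = {p, p'} \<and> (\<exists>y\<in>cell p. \<exists>y'\<in>cell p'. {y, y'} \<in> edges quarter_grid)"
proof -
  obtain m n where "e = {(m, n), (m, n + 1)} \<or> e = {(m, n), (Suc m, n)}" using half_grid_edge[OF assms] by blast
  then show ?thesis
  proof
    assume e: "e = {(m, n), (m, n + 1)}"
    have "\<exists>y\<in>cell (m, n). \<exists>y'\<in>cell (m, n + 1). {y, y'} \<in> edges quarter_grid"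
    proof -
      consider "0 \<le> n" | "n = -1" | "n < -1" by linarith
      then show ?thesis
      proof cases
        case 1
        define k where "k = m + nat n"
        have "m + nat (n + 1) = Suc k" using 1 by (simp add: k_def)
        then have "(2 * k + 1, 2 * m) \<in> cell (m, n)" "(Suc (2 * k + 1), 2 * m) \<in> cell (m, n + 1)"
          using 1 by (auto simp: cell_def staircase_def k_def)
        then show ?thesis using quarter_edge_h by blast
      next
        case 2
        then have "(2 * m, Suc (2 * m + 1)) \<in> cell (m, n)" "(2 * m, 2 * m + 1) \<in> cell (m, n + 1)"
          by (auto simp: cell_def staircase_def)
        moreover have "{(2 * m, Suc (2 * m + 1)), (2 * m, 2 * m + 1)} \<in> edges quarter_grid"
          using quarter_edge_v[of "2 * m" "2 * m + 1"] by (simp add: insert_commute)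
        ultimately show ?thesis by blast
      next
        case 3
        define k where "k = m + nat (- (n + 1))"
        have "m + nat (- n) = Suc k" using 3 by (simp add: k_def)
        then have "(2 * m, Suc (2 * k + 1)) \<in> cell (m, n)" "(2 * m, 2 * k + 1) \<in> cell (m, n + 1)"
          using 3 by (auto simp: cell_def staircase_def k_def)
        moreover have "{(2 * m, Suc (2 * k + 1)), (2 * m, 2 * k + 1)} \<in> edges quarter_grid"
          using quarter_edge_v[of "2 * m" "2 * k + 1"] by (simp add: insert_commute)
        ultimately show ?thesis by blast
      qed
    qed
    then show ?thesis using e by blast
  next
    assume e: "e = {(m, n), (Suc m, n)}"
    have "\<exists>y\<in>cell (m, n). \<exists>y'\<in>cell (Suc m, n). {y, y'} \<in> edges quarter_grid"
    proof (cases "n < 0")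
      case True
      define k where "k = m + nat (- n)"
      have "(2 * m + 1, 2 * k + 2) \<in> cell (m, n)" "(Suc (2 * m + 1), 2 * k + 2) \<in> cell (Suc m, n)"
        using True by (auto simp: cell_def staircase_def k_def)
      then show ?thesis using quarter_edge_h by blast
    next
      case False
      define k where "k = m + nat n"
      have "(2 * k + 2, 2 * m + 1) \<in> cell (m, n)" "(2 * k + 2, Suc (2 * m + 1)) \<in> cell (Suc m, n)"
        using False by (auto simp: cell_def staircase_def k_def)
      then show ?thesis using quarter_edge_v by blast
    qed
    then show ?thesis using e by blast
  qed
qed

context conn_graph
begin

lemma half_grid_model:
  assumes "fat_sets K quarter_grid W S"
  shows "\<exists>W' S'. fat_sets K half_grid W' S'"
proof (rule fat_sets_contract[OF assms, where U = cell])
  fix g assume "g \<in> edges quarter_grid" then show "g \<noteq> {}" by (auto simp: quarter_grid_def)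
next
  fix p show "cell p \<subseteq> vertices quarter_grid" by (auto simp: quarter_grid_def)
next
  fix p show "\<exists>c\<in>cell p. \<forall>y\<in>cell p. (c, y) \<in> (edges_within quarter_grid (cell p))\<^sup>*"
    by (rule cell_conn)
next
  fix p p' :: "nat \<times> int" assume "p \<noteq> p'" then show "cell p \<inter> cell p' = {}" by (rule cell_disjoint)
next
  fix e assume "e \<in> edges half_grid"
  then show "\<exists>p\<in>vertices half_grid. \<exists>p'\<in>vertices half_grid. e = {p, p'}
    \<and> (\<exists>y\<in>cell p. \<exists>y'\<in>cell p'. {y, y'} \<in> edges quarter_grid)"
    using cell_edge by (auto simp: half_grid_def)
qed

end

section \<open>From connected sets to fat minors\<close>

context graph_component
begin

text \<open>A shortest path in \<open>S\<close> from \<open>A\<close> to \<open>B\<close> meets each of the two sets only once, since otherwise a proper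
  segment of it would be such a path.\<close>
lemma path_between_exists:
  assumes S: "conn S" and SA: "S \<inter> A \<noteq> {}" and SB: "S \<inter> B \<noteq> {}"
  shows "\<exists>p. path_between G A B p \<and> set p \<subseteq> S"
proof -
  let ?Q = "\<lambda>p. graph_path G p \<and> set p \<subseteq> S \<and> hd p \<in> A \<and> last p \<in> B"
  obtain a b where ab: "a \<in> S" "a \<in> A" "b \<in> S" "b \<in> B" using SA SB by blast
  have "\<exists>p. ?Q p" using link_path[OF conn_linked[OF S ab(1,3) subset_refl] ab(1) conn_sub[OF S]] ab by metis
  then obtain p where p: "?Q p" and least: "\<And>q. ?Q q \<Longrightarrow> length p \<le> length q"
    using ex_has_least_nat[of ?Q _ length] by blast
  have pne: "p \<noteq> []" using p by (auto simp: graph_path_def)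
  have "set p \<inter> A = {hd p}"
  proof -
    have "x = hd p" if x: "x \<in> set p" "x \<in> A" for x
    proof (rule ccontr)
      assume ne: "x \<noteq> hd p"
      obtain xs ys where p_eq: "p = xs @ x # ys" using x by (meson split_list)
      have "xs \<noteq> []" using ne p_eq by auto
      have "graph_path G (x # ys)" using graph_path_sublist[of G xs "x # ys" "[]"] p p_eq by simp
      then have "?Q (x # ys)" using p p_eq x by auto
      then show False using least[of "x # ys"] p_eq \<open>xs \<noteq> []\<close> by simp
    qed
    moreover have "hd p \<in> set p \<inter> A" using p hd_in_set[OF pne] by simp
    ultimately show ?thesis by blast
  qed
  moreover have "set p \<inter> B = {last p}"
  proof -
    have "x = last p" if x: "x \<in> set p" "x \<in> B" for x
    proof (rule ccontr)
      assume ne: "x \<noteq> last p"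
      obtain xs ys where p_eq: "p = (xs @ [x]) @ ys" using x by (metis append.assoc append_Cons append_Nil split_list)
      have "ys \<noteq> []" using ne p_eq by auto
      have "graph_path G (xs @ [x])" using graph_path_sublist[of G "[]" "xs @ [x]" ys] p p_eq by simp
      moreover have "hd (xs @ [x]) = hd p" using p_eq by (cases xs) auto
      ultimately have "?Q (xs @ [x])" using p p_eq x by auto
      then show False using least[of "xs @ [x]"] p_eq \<open>ys \<noteq> []\<close> by simp
    qed
    moreover have "last p \<in> set p \<inter> B" using p last_in_set[OF pne] by simp
    ultimately show ?thesis by blast
  qed
  ultimately show ?thesis using p by (auto simp: path_between_def)
qed

lemma apart_set_dist:
  assumes "apart K A B" "A \<subseteq> V"
  shows "enat K \<le> set_dist G A B"
  unfolding set_dist_def graph_dist_def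
proof (intro INF_greatest)
  fix u w p assume u: "u \<in> A" and w: "w \<in> B" and p: "p \<in> {p. graph_path G p \<and> hd p = u \<and> last p = w}"
  then have "p \<noteq> []" by (auto simp: graph_path_def)
  then have "u \<in> set p" "w \<in> set p" using p by auto
  then have "d u w \<le> length p - 1" using path_linked[of p u w] p u assms(2) by auto
  moreover have "K \<le> d u w" using assms(1) u w by (auto simp: apart_def)
  ultimately show "enat K \<le> enat (length p - 1)" by simp
qed

lemma apart_disjoint: "apart K A B \<Longrightarrow> 1 \<le> K \<Longrightarrow> A \<inter> B = {}"
  unfolding apart_def using d_refl by fastforce

text \<open>Positive distance makes the sets disjoint, so that every path from one branch set to another
  inside a connector is a legitimate branch path.\<close>
lemma fat_sets_fat_minor:
  assumes fat: "fat_sets K X W S" and K: "1 \<le> K"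
    and edge: "\<And>e. e \<in> edges X \<Longrightarrow> \<exists>x\<in>vertices X. \<exists>y\<in>vertices X. e = {x, y}"
  shows "fat_minor K X G"
proof -
  have W: "conn (W x)" "W x \<noteq> {}" if "x \<in> vertices X" for x
    using fat that unfolding fat_sets_def by auto
  have WW: "apart K (W x) (W y)" if "x \<in> vertices X" "y \<in> vertices X" "x \<noteq> y" for x y
    using fat that unfolding fat_sets_def by auto
  have SS: "apart K (S e) (S f)" if "e \<in> edges X" "f \<in> edges X" "e \<noteq> f" for e f
    using fat that unfolding fat_sets_def by auto
  have SW: "apart K (S e) (W x)" if "e \<in> edges X" "x \<in> vertices X" "x \<notin> e" for e x
    using fat that unfolding fat_sets_def by auto
  have "\<exists>p. (\<exists>x y. e = {x, y} \<and> path_between G (W x) (W y) p) \<and> set p \<subseteq> S e" if e: "e \<in> edges X" for e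
  proof -
    obtain x y where xy: "x \<in> vertices X" "y \<in> vertices X" "e = {x, y}" using edge[OF e] by blast
    have "conn (S e)" "S e \<inter> W x \<noteq> {}" "S e \<inter> W y \<noteq> {}" using fat e xy(3) unfolding fat_sets_def by auto
    from path_between_exists[OF this] show ?thesis unfolding xy(3) by blast
  qed
  then have ex: "\<forall>e\<in>edges X. \<exists>p. (\<exists>x y. e = {x, y} \<and> path_between G (W x) (W y) p) \<and> set p \<subseteq> S e"
    by blast
  from bchoice[OF ex] obtain E where
    E: "\<And>e. e \<in> edges X \<Longrightarrow> \<exists>x y. e = {x, y} \<and> path_between G (W x) (W y) (E e)"
    and ES: "\<And>e. e \<in> edges X \<Longrightarrow> set (E e) \<subseteq> S e" by blast
  have WV: "W x \<subseteq> V" if "x \<in> vertices X" for x using W(1)[OF that] conn_sub by blast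
  have EV: "set (E e) \<subseteq> V" if "e \<in> edges X" for e
  proof -
    have "conn (S e)" using fat that unfolding fat_sets_def by auto
    then show ?thesis using ES[OF that] conn_sub by blast
  qed
  have inner: "inner_vertices p \<subseteq> set p" for p :: "'a list"
    unfolding inner_vertices_def by (cases p) (auto dest: in_set_butlastD)
  have aE: "apart K (set (E e)) (set (E f))" if "e \<in> edges X" "f \<in> edges X" "e \<noteq> f" for e f
    using SS[OF that] ES[OF that(1)] ES[OF that(2)] unfolding apart_def by blast
  have aEW: "apart K (set (E e)) (W x)" if "e \<in> edges X" "x \<in> vertices X" "x \<notin> e" for e x
    using SW[OF that] ES[OF that(1)] unfolding apart_def by blast
  have "minor_model X G W E"
    unfolding minor_model_def
  proof (intro conjI ballI impI)
    fix x assume x: "x \<in> vertices X"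
    show "W x \<subseteq> vertices G" using WV[OF x] V_sub by auto
    show "graph_connected (induced_subgraph G (W x))"
      unfolding graph_connected_def
    proof (intro conjI ballI)
      show "vertices (induced_subgraph G (W x)) \<noteq> {}"
        using W(2)[OF x] WV[OF x] V_sub by (auto simp: induced_subgraph_def)
      fix u v assume "u \<in> vertices (induced_subgraph G (W x))" "v \<in> vertices (induced_subgraph G (W x))"
      then have uv: "u \<in> W x" "v \<in> W x" by (auto simp: induced_subgraph_def)
      obtain p where p: "graph_path G p" "set p \<subseteq> W x" "hd p = u" "last p = v"
        using link_path[OF conn_linked[OF W(1)[OF x] uv subset_refl] uv(1) WV[OF x]] by auto
      have "graph_path (induced_subgraph G (W x)) p"
        unfolding graph_path_def
      proof (intro conjI allI impI)
        show "p \<noteq> []" "distinct p" using p(1) by (auto simp: graph_path_def)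
        show "set p \<subseteq> vertices (induced_subgraph G (W x))"
          using p(1,2) by (auto simp: graph_path_def induced_subgraph_def)
        fix i assume i: "Suc i < length p"
        then have "p ! i \<in> W x" "p ! Suc i \<in> W x" using p(2) nth_mem[of i p] nth_mem[of "Suc i" p] by auto
        then show "{p ! i, p ! Suc i} \<in> edges (induced_subgraph G (W x))"
          using p(1) i by (auto simp: graph_path_def induced_subgraph_def)
      qed
      then show "\<exists>p. graph_path (induced_subgraph G (W x)) p \<and> hd p = u \<and> last p = v" using p by blast
    qed
  next
    fix x y assume "x \<in> vertices X" "y \<in> vertices X" "x \<noteq> y"
    then show "W x \<inter> W y = {}" using apart_disjoint[OF WW K] by blast
  next
    fix e assume "e \<in> edges X"
    then show "\<exists>x y. e = {x, y} \<and> path_between G (W x) (W y) (E e)" by (rule E)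
  next
    fix e f assume "e \<in> edges X" "f \<in> edges X" "e \<noteq> f"
    then have "set (E e) \<inter> set (E f) = {}" using apart_disjoint[OF aE K] by blast
    then show "internally_disjoint (E e) (E f)"
      unfolding internally_disjoint_def using inner by blast
  next
    fix e x assume "e \<in> edges X" "x \<in> vertices X" "x \<notin> e"
    then show "set (E e) \<inter> W x = {}" using apart_disjoint[OF aEW K] by blast
  qed
  then have "fat_model K X G W E"
    unfolding fat_model_def
    using apart_set_dist[OF WW WV] apart_set_dist[OF aE EV] apart_set_dist[OF aEW EV] by blast
  then show ?thesis unfolding fat_minor_def by blast
qed

lemma conn_path: "graph_path G p \<Longrightarrow> u \<in> set p \<Longrightarrow> u \<in> V \<Longrightarrow> conn (set p)"
  by (rule connI[where c=u]) (use path_linked[of p u] in auto)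

end

lemma (in thick_component) half_grid_fat_minor:
  assumes "1 \<le> K"
  shows "fat_minor K half_grid G"
proof -
  obtain P C where "diverges P C" using diverging_components by blast
  then interpret diverging V r G root \<kappa> \<Delta> q P C K by unfold_locales
  obtain W S where "fat_sets K half_grid W S" using triangle_model quarter_model half_grid_model by blast
  then show ?thesis
  proof (rule fat_sets_fat_minor[OF _ assms])
    fix e assume "e \<in> edges half_grid"
    then show "\<exists>x\<in>vertices half_grid. \<exists>y\<in>vertices half_grid. e = {x, y}" by (auto simp: half_grid_def)
  qed
qed

lemma fat_minor_mono:
  assumes "fat_minor L X G" "K \<le> L"
  shows "fat_minor K X G"
proof -
  have "enat K \<le> enat L" using assms(2) by simp
  then have "enat K \<le> x" if "enat L \<le> x" for x using that by (rule order_trans)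
  moreover obtain V E where "fat_model L X G V E" using assms(1) unfolding fat_minor_def by blast
  ultimately have "fat_model K X G V E" unfolding fat_model_def by simp
  then show ?thesis unfolding fat_minor_def by blast
qed

text \<open>Distinct disjoint paths would hit a finite set in distinct vertices.\<close>
lemma disjoint_paths_avoid:
  assumes "infinite P" "\<forall>p\<in>P. \<forall>q\<in>P. p \<noteq> q \<longrightarrow> set p \<inter> set q = {}" "finite B"
  shows "\<exists>p\<in>P. set p \<inter> B = {}"
proof (rule ccontr)
  assume "\<not> ?thesis"
  then have "\<forall>p\<in>P. \<exists>x. x \<in> set p \<inter> B" by blast
  then obtain f where f: "\<forall>p\<in>P. f p \<in> set p \<inter> B" by metis
  have "inj_on f P"
  proof (rule inj_onI)
    fix p q assume "p \<in> P" "q \<in> P" "f p = f q"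
    then show "p = q" using f assms(2) by (metis IntD1 disjoint_iff)
  qed
  then have "finite P" by (rule inj_on_finite[of f P B]) (use f assms(3) in auto)
  then show False using assms(1) by simp
qed

theorem theorem3:
  fixes G :: "'a ugraph"
  assumes "simple_graph G"
    and "finite_max_degree G"
    and "cycle_space_generated_by_bounded_cycles G"
    and "\<exists>\<omega>\<in>graph_ends G. thick_end \<omega>"
  shows "asymptotic_minor half_grid G"
proof -
  obtain \<omega> r0 where \<omega>: "thick_end \<omega>" "\<omega> = equivalent_rays G `` {r0}"
    using assms(4) by (auto simp: graph_ends_def elim!: quotientE)
  obtain Rs where Rs: "Rs \<subseteq> \<omega>" "infinite Rs"
    "\<forall>r\<in>Rs. \<forall>s\<in>Rs. r \<noteq> s \<longrightarrow> range r \<inter> range s = {}" using \<omega>(1) by (auto simp: thick_end_def)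
  obtain q :: "nat \<Rightarrow> nat \<Rightarrow> 'a" where q: "inj q" "range q \<subseteq> Rs"
    using infinite_countable_subset[OF Rs(2)] by blast
  have q_equiv: "(r0, q i) \<in> equivalent_rays G" for i using q(2) Rs(1) \<omega>(2) by blast
  have r0: "is_ray G r0" and q_ray: "is_ray G (q i)" for i
    using q_equiv by (auto simp: equivalent_rays_def)
  \<comment> \<open>Rays of the end are only known to be equivalent to \<open>r0\<close>; two of them are joined via a tail of \<open>r0\<close>.\<close>
  have avoid: "\<exists>p. path_between G (range r0) (range (q i)) p \<and> set p \<inter> B = {}" if "finite B" for i B
  proof -
    obtain P where P: "infinite P" "\<forall>p\<in>P. path_between G (range r0) (range (q i)) p"
      "\<forall>p\<in>P. \<forall>q\<in>P. p \<noteq> q \<longrightarrow> set p \<inter> set q = {}"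
      using q_equiv[of i] by (auto simp: equivalent_rays_def)
    then show ?thesis using disjoint_paths_avoid[OF P(1,3) that] by blast
  qed
  obtain \<kappa> where gen: "F2_span {cycle_edges c |c. graph_cycle G c \<and> length c \<le> \<kappa>} = cycle_space G"
    using assms(3) by (auto simp: cycle_space_generated_by_bounded_cycles_def)
  obtain \<Delta> where \<Delta>: "\<And>v. v \<in> vertices G \<Longrightarrow> finite (neighbours G v) \<and> card (neighbours G v) \<le> \<Delta>"
    using assms(2) by (auto simp: finite_max_degree_def)
  define E where "E = {(u, v). {u, v} \<in> edges G}"
  define root where "root = r0 0"
  define V where "V = {v. (root, v) \<in> E\<^sup>*}"
  define r where "r = {(u, v). u \<in> V \<and> {u, v} \<in> edges G}"
  have step: "v \<in> V" if "u \<in> V" "{u, v} \<in> edges G" for u v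
    using that by (auto simp: V_def E_def intro: rtrancl.rtrancl_into_rtrancl)
  have V_sub: "V \<subseteq> vertices G"
  proof
    fix v assume "v \<in> V"
    then have "(root, v) \<in> E\<^sup>*" by (simp add: V_def)
    then show "v \<in> vertices G"
    proof (induction rule: rtrancl_induct)
      case base then show ?case using r0 by (auto simp: is_ray_def root_def)
    next
      case (step y z) then show ?case using assms(1) by (auto simp: E_def simple_graph_def)
    qed
  qed
  have rE: "(root, v) \<in> r\<^sup>*" if "v \<in> V" for v
  proof -
    have "(root, v) \<in> E\<^sup>*" using that by (simp add: V_def)
    then show ?thesis
    proof (induction rule: rtrancl_induct)
      case (step y z)
      then have "(y, z) \<in> r" by (auto simp: r_def V_def E_def)
      then show ?case using step.IH by (meson rtrancl.rtrancl_into_rtrancl)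
    qed simp
  qed
  have rsym: "(x, y) \<in> r \<Longrightarrow> (y, x) \<in> r" for x y using step by (auto simp: r_def insert_commute)
  have nbr: "r `` {x} \<subseteq> neighbours G x" "x \<notin> V \<Longrightarrow> r `` {x} = {}" for x
    by (auto simp: r_def neighbours_def)
  have nbr_fin: "finite (r `` {x}) \<and> card (r `` {x}) \<le> \<Delta>" for x
  proof (cases "x \<in> V")
    case True
    then have "finite (neighbours G x)" "card (neighbours G x) \<le> \<Delta>" using \<Delta> V_sub by auto
    then show ?thesis using nbr(1)[of x] card_mono finite_subset by (meson le_trans)
  qed (use nbr(2) in simp)
  interpret graph_component V r G
  proof
    show "r \<subseteq> V \<times> V" using step by (auto simp: r_def)
    show "(y, x) \<in> r" if "(x, y) \<in> r" for x y using rsym[OF that] .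
    show "(x, y) \<in> r\<^sup>*" if "x \<in> V" "y \<in> V" for x y
    proof -
      have "sym (r\<^sup>*)" by (rule sym_rtrancl) (use rsym in \<open>auto simp: sym_def\<close>)
      then show ?thesis using rE[OF that(1)] rE[OF that(2)] by (meson rtrancl_trans symD)
    qed
    show "finite (r `` {x})" for x using nbr_fin by simp
    show "(u, v) \<in> r \<longleftrightarrow> u \<in> V \<and> {u, v} \<in> edges G" for u v by (auto simp: r_def)
    show "simple_graph G" by fact
    show "V \<subseteq> vertices G" by fact
  qed
  have ray_V: "s n \<in> V" if "is_ray G s" "s 0 \<in> V" for s n
    using that by (induction n) (auto simp: is_ray_def intro: step)
  have ray_V': "s 0 \<in> V" if "is_ray G s" "s n \<in> V" for s n
    using that(2)
  proof (induction n)
    case (Suc n)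
    have "{s (Suc n), s n} \<in> edges G" using that(1) by (auto simp: is_ray_def insert_commute)
    then show ?case using Suc step by blast
  qed
  have r0_V: "r0 n \<in> V" for n by (rule ray_V[OF r0]) (simp add: V_def root_def)
  have path_V: "conn (set p) \<and> hd p \<in> set p \<and> last p \<in> set p \<and> hd p \<in> range r0 \<and> last p \<in> range s"
    if "path_between G (range r0) (range s) p" for p s
  proof -
    have p: "graph_path G p" "set p \<inter> range r0 = {hd p}" "set p \<inter> range s = {last p}"
      using that by (auto simp: path_between_def)
    then have "hd p \<in> set p" "hd p \<in> range r0" "last p \<in> set p" "last p \<in> range s" by blast+
    moreover from this have "hd p \<in> V" using r0_V by auto
    ultimately show ?thesis using conn_path[OF p(1)] by simp
  qed
  have q_V: "q i n \<in> V" for i n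
  proof -
    obtain p where "path_between G (range r0) (range (q i)) p" using avoid[of "{}"] by blast
    from path_V[OF this] obtain m where "q i m \<in> V" using conn_sub[of "set p"] by auto
    then show ?thesis using ray_V[OF q_ray ray_V'[OF q_ray]] by blast
  qed
  have ray_edge: "(s n, s (Suc n)) \<in> r" if "is_ray G s" "s n \<in> V" for s n
    using that by (auto simp: is_ray_def r_def)
  have r0_tail: "conn (r0 ` {k..})" for k
    by (rule conn_ray[of r0 k, OF ray_edge[OF r0 r0_V]])
  interpret thick_component V r G root \<kappa> \<Delta> q
  proof
    show "root \<in> V" by (simp add: V_def)
    show "F2_span {cycle_edges c |c. graph_cycle G c \<and> length c \<le> \<kappa>} = cycle_space G" by (rule gen)
    show "card (r `` {x}) \<le> \<Delta>" for x using nbr_fin by simp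
    show "inj (q i)" for i using q_ray by (auto simp: is_ray_def)
    show "(q i n, q i (Suc n)) \<in> r" for i n by (rule ray_edge[OF q_ray q_V])
    show "range (q i) \<inter> range (q j) = {}" if "i \<noteq> j" for i j
      using Rs(3) q that by (metis injD range_subsetD)
    show "\<exists>S. conn S \<and> S \<inter> B = {} \<and> S \<inter> range (q i) \<noteq> {} \<and> S \<inter> range (q j) \<noteq> {}"
      if B: "finite B" for B i j
    proof -
      have "inj r0" using r0 by (simp add: is_ray_def)
      then have "finite (r0 -` B)" using finite_vimageI[OF B] by blast
      then obtain k where k: "\<forall>n\<in>r0 -` B. n < k" using finite_nat_set_iff_bounded by blast
      let ?B = "B \<union> r0 ` {..<k}"
      have fB: "finite ?B" using B by simp
      obtain p where p: "path_between G (range r0) (range (q i)) p" "set p \<inter> ?B = {}"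
        using avoid[OF fB] by blast
      obtain p' where p': "path_between G (range r0) (range (q j)) p'" "set p' \<inter> ?B = {}"
        using avoid[OF fB] by blast
      let ?T = "r0 ` {k..}"
      have T: "?T \<inter> B = {}" using k by (auto dest: bspec)
      have hit: "x \<in> ?T" if "x \<in> range r0" "x \<notin> ?B" for x
        using that by force
      note pV = path_V[OF p(1)] and pV' = path_V[OF p'(1)]
      have "hd p \<in> ?T" using pV p(2) by (intro hit) auto
      then have 1: "set p \<inter> ?T \<noteq> {}" using pV by blast
      have "hd p' \<in> ?T" using pV' p'(2) by (intro hit) auto
      then have 2: "(set p \<union> ?T) \<inter> set p' \<noteq> {}" using pV' by blast
      have "conn (set p \<union> ?T)" using pV r0_tail 1 by (intro conn_Un) auto
      then have c: "conn (set p \<union> ?T \<union> set p')" using pV' 2 by (intro conn_Un[of "set p \<union> ?T"]) auto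
      have "(set p \<union> ?T \<union> set p') \<inter> B = {}" using p(2) p'(2) T by blast
      moreover have "last p \<in> (set p \<union> ?T \<union> set p') \<inter> range (q i)" using pV by simp
      moreover have "last p' \<in> (set p \<union> ?T \<union> set p') \<inter> range (q j)" using pV' by simp
      ultimately show ?thesis using c by (intro exI[of _ "set p \<union> ?T \<union> set p'"]) blast
    qed
  qed
  show ?thesis unfolding asymptotic_minor_def
  proof
    \<comment> \<open>Fatness \<open>Suc K\<close> is used in order to have disjoint sets also for \<open>K = 0\<close>.\<close>
    fix K show "fat_minor K half_grid G"
      using half_grid_fat_minor[of "Suc K"] fat_minor_mono[of "Suc K" half_grid G K] by simp
  qed
qed

end
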